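(* Let $n\ge 1$. The principal $\mathbb{S}^1$-bundle $\mathbb{S}^1\to\mathbb{S}^{2n+1}\stackrel{\gamma_{n,\mathbb{C}}}{\longrightarrow}\mathbb{C}P^n$ gives rise to a split short exact sequence of groups $$1\to[\Omega(\mathbb{S}^2),\Omega(\mathbb{S}^{2n+1})]\stackrel{(\gamma_{n,\mathbb{C}})_*}{\longrightarrow}[\Omega(\mathbb{S}^2),\Omega(\mathbb{C}P^n)]\to\mathbb{Z}\to0$$ and an isomorphism of groups $$[\Omega(\mathbb{S}^{r+1}),\Omega(\mathbb{C}P^n)]\stackrel{\cong}{\longrightarrow}[\Omega(\mathbb{S}^{r+1}),\Omega(\mathbb{S}^{2n+1})]$$ for $r\ge2$. Consequently, $$\exp_p([\Omega(\mathbb{S}^{r+1}),\Omega(\mathbb{C}P^n)])=\exp_p([\Omega(\mathbb{S}^{r+1}),\Omega(\mathbb{S}^{2n+1})])$$ for $n,r\ge1$ and any prime $p$.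
   Context: $\gamma_{n,\mathbb{C}}:\mathbb{S}^{2n+1}\to\mathbb{C}P^n$ is the quotient map onto the complex projective space, and $(\gamma_{n,\mathbb{C}})_*$ is the homomorphism induced by composition with $\Omega(\gamma_{n,\mathbb{C}})$. $[X,Y]$ denotes the set of pointed homotopy classes of pointed maps $X\to Y$; $[\Omega(\mathbb{S}^{r+1}),\Omega(Y)]$ is a group under the multiplication induced by loop multiplication in $\Omega(Y)$. For a group $H$, $\exp_p(H)$ is the least integer $p^t$ such that $\alpha^{p^t}=1$ for every $p$-torsion element $\alpha\in H$ (element of order a power of $p$); if no such integer exists or $H$ has no $p$-torsion, $\exp_p(H)=1$. *)

theory Defs
  imports "HOL-Analysis.Analysis" "HOL-Algebra.Elementary_Groups" "HOL-Algebra.Multiplicative_Group"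
begin

section \<open>Quotient topology and compact-open topology\<close>

definition quotient_topology :: "'a topology \<Rightarrow> ('a \<Rightarrow> 'b) \<Rightarrow> 'b topology" where
  "quotient_topology X f =
     topology (\<lambda>U. U \<subseteq> f ` topspace X \<and> openin X {x \<in> topspace X. f x \<in> U})"

lemma openin_quotient_topology:
  "openin (quotient_topology X f) U \<longleftrightarrow>
     U \<subseteq> f ` topspace X \<and> openin X {x \<in> topspace X. f x \<in> U}"
proof -
  have "istopology (\<lambda>U. U \<subseteq> f ` topspace X \<and> openin X {x \<in> topspace X. f x \<in> U})"
    unfolding istopology_def
  proof (intro conjI allI impI)
    fix S T
    assume "S \<subseteq> f ` topspace X \<and> openin X {x \<in> topspace X. f x \<in> S}"
      and "T \<subseteq> f ` topspace X \<and> openin X {x \<in> topspace X. f x \<in> T}"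
    moreover have "{x \<in> topspace X. f x \<in> S \<inter> T} =
        {x \<in> topspace X. f x \<in> S} \<inter> {x \<in> topspace X. f x \<in> T}"
      by auto
    ultimately show "S \<inter> T \<subseteq> f ` topspace X" "openin X {x \<in> topspace X. f x \<in> S \<inter> T}"
      by auto
  next
    fix \<K>
    assume *: "\<forall>K\<in>\<K>. K \<subseteq> f ` topspace X \<and> openin X {x \<in> topspace X. f x \<in> K}"
    moreover have "{x \<in> topspace X. f x \<in> \<Union>\<K>} = (\<Union>K\<in>\<K>. {x \<in> topspace X. f x \<in> K})"
      by auto
    ultimately show "openin X {x \<in> topspace X. f x \<in> \<Union>\<K>}"
      by (simp only: openin_Union) auto
    show "\<Union>\<K> \<subseteq> f ` topspace X"
      using * by blast
  qed
  then show ?thesis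
    by (simp add: quotient_topology_def topology_inverse')
qed

lemma topspace_quotient_topology [simp]:
  "topspace (quotient_topology X f) = f ` topspace X"
proof -
  have "{x \<in> topspace X. f x \<in> f ` topspace X} = topspace X"
    by auto
  then have "openin (quotient_topology X f) (f ` topspace X)"
    by (simp add: openin_quotient_topology)
  then show ?thesis
    by (meson openin_quotient_topology openin_subset openin_topspace subset_antisym)
qed

lemma quotient_map_quotient_topology: "quotient_map X (quotient_topology X f) f"
  by (auto simp: quotient_map_def openin_quotient_topology)

definition compact_open_topology :: "'a topology \<Rightarrow> 'b topology \<Rightarrow> ('a \<Rightarrow> 'b) topology" where
  "compact_open_topology X Y =
     topology_generated_by
       {{f. continuous_map X Y f \<and> f \<in> extensional (topspace X) \<and> f ` K \<subseteq> U} | K U.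
          compactin X K \<and> openin Y U}"

lemma topspace_compact_open_topology:
  "topspace (compact_open_topology X Y) =
     {f. continuous_map X Y f \<and> f \<in> extensional (topspace X)}"
proof -
  have "{f. continuous_map X Y f \<and> f \<in> extensional (topspace X)} =
        {f. continuous_map X Y f \<and> f \<in> extensional (topspace X) \<and> f ` {} \<subseteq> {}}"
    by auto
  moreover have "compactin X {}" "openin Y {}"
    by auto
  ultimately show ?thesis
    unfolding compact_open_topology_def topology_generated_by_topspace by blast
qed

section \<open>Pointed homotopy classes and loop spaces\<close>

definition htpy_class ::
    "'a topology \<Rightarrow> 'a \<Rightarrow> 'b topology \<Rightarrow> 'b \<Rightarrow> ('a \<Rightarrow> 'b) \<Rightarrow> ('a \<Rightarrow> 'b) set" where
  "htpy_class X x0 Y y0 f = {g. homotopic_with (\<lambda>h. h x0 = y0) X Y f g}"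

definition htpy_classes ::
    "'a topology \<Rightarrow> 'a \<Rightarrow> 'b topology \<Rightarrow> 'b \<Rightarrow> ('a \<Rightarrow> 'b) set set" where
  "htpy_classes X x0 Y y0 = {htpy_class X x0 Y y0 f | f. continuous_map X Y f \<and> f x0 = y0}"

text \<open>The map \<open>[X,Y] \<rightarrow> [X,Z]\<close> given by composition with a pointed map \<open>k : (Y,y0) \<rightarrow> (Z,z0)\<close>.
  The union is over representatives of one class \<open>c\<close>, which all give the same class.\<close>

definition htpy_push ::
    "'a topology \<Rightarrow> 'a \<Rightarrow> 'c topology \<Rightarrow> 'c \<Rightarrow> ('b \<Rightarrow> 'c) \<Rightarrow> ('a \<Rightarrow> 'b) set \<Rightarrow> ('a \<Rightarrow> 'c) set" where
  "htpy_push X x0 Z z0 k c = (\<Union>f\<in>c. htpy_class X x0 Z z0 (k \<circ> f))"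

definition loop_space :: "'a topology \<Rightarrow> 'a \<Rightarrow> (real \<Rightarrow> 'a) topology" where
  "loop_space X x0 =
     subtopology (compact_open_topology (top_of_set {0..1}) X) {l. l 0 = x0 \<and> l 1 = x0}"

definition const_loop :: "'a \<Rightarrow> real \<Rightarrow> 'a" where
  "const_loop x0 = restrict (\<lambda>_. x0) {0..1}"

definition loop_concat :: "(real \<Rightarrow> 'a) \<Rightarrow> (real \<Rightarrow> 'a) \<Rightarrow> real \<Rightarrow> 'a" where
  "loop_concat l m = restrict (\<lambda>t. if t \<le> 1/2 then l (2 * t) else m (2 * t - 1)) {0..1}"

definition loop_map :: "('a \<Rightarrow> 'b) \<Rightarrow> (real \<Rightarrow> 'a) \<Rightarrow> real \<Rightarrow> 'b" where
  "loop_map k l = restrict (k \<circ> l) {0..1}"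

text \<open>The group \<open>[A, \<Omega>Y]\<close>; as above, the union in the product is over representatives.\<close>

definition htpy_loop_group ::
    "'a topology \<Rightarrow> 'a \<Rightarrow> 'b topology \<Rightarrow> 'b \<Rightarrow> ('a \<Rightarrow> real \<Rightarrow> 'b) set monoid" where
  "htpy_loop_group A a0 Y y0 =
     \<lparr>carrier = htpy_classes A a0 (loop_space Y y0) (const_loop y0),
      monoid.mult = (\<lambda>c d. \<Union>f\<in>c. \<Union>g\<in>d.
        htpy_class A a0 (loop_space Y y0) (const_loop y0) (\<lambda>x. loop_concat (f x) (g x))),
      one = htpy_class A a0 (loop_space Y y0) (const_loop y0) (\<lambda>_. const_loop y0)\<rparr>"

section \<open>Spheres and complex projective spaces\<close>

definition sphere_pt :: "nat \<Rightarrow> real" where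
  "sphere_pt = (\<lambda>i. if i = 0 then 1 else 0)"

lemma sphere_pt_in_nsphere: "sphere_pt \<in> topspace (nsphere m)"
  by (simp add: nsphere sphere_pt_def power2_eq_square if_distrib cong: if_cong)

text \<open>A point \<open>x\<close> of \<open>nsphere (2*n+1)\<close> stands for the unit vector of \<open>\<complex>\<^bsup>n+1\<^esup>\<close> with
  \<open>k\<close>-th coordinate \<open>x (2*k) + \<i> * x (2*k+1)\<close>.\<close>

definition complex_coord :: "(nat \<Rightarrow> real) \<Rightarrow> nat \<Rightarrow> complex" where
  "complex_coord x k = Complex (x (2 * k)) (x (2 * k + 1))"

definition circle_act :: "complex \<Rightarrow> (nat \<Rightarrow> real) \<Rightarrow> nat \<Rightarrow> real" where
  "circle_act u x = (\<lambda>i. if even i then Re (u * complex_coord x (i div 2))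
                          else Im (u * complex_coord x (i div 2)))"

lemma complex_coord_circle_act: "complex_coord (circle_act u x) k = u * complex_coord x k"
  by (simp add: complex_coord_def circle_act_def complex_eq_iff)

lemma sum_squares_complex_coord:
  "(\<Sum>i\<le>2*n+1. x i ^ 2) = (\<Sum>k\<le>n. cmod (complex_coord x k) ^ 2)"
  by (induction n) (simp_all add: complex_coord_def cmod_def numeral_2_eq_2)

lemma circle_act_in_nsphere:
  assumes "cmod u = 1" and "x \<in> topspace (nsphere (2 * n + 1))"
  shows "circle_act u x \<in> topspace (nsphere (2 * n + 1))"
proof -
  have x: "(\<Sum>i\<le>2*n+1. x i ^ 2) = 1" "\<And>i. i > 2*n+1 \<Longrightarrow> x i = 0"
    using assms(2) by (auto simp: nsphere)
  have "(\<Sum>i\<le>2*n+1. circle_act u x i ^ 2) = 1"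
    using x(1) assms(1)
    unfolding sum_squares_complex_coord complex_coord_circle_act by (simp add: norm_mult)
  moreover have "circle_act u x i = 0" if "i > 2*n+1" for i
  proof -
    have "2 * (i div 2) > 2*n+1" "2 * (i div 2) + 1 > 2*n+1"
      using that by presburger+
    then have "complex_coord x (i div 2) = 0"
      unfolding complex_coord_def by (simp only: x(2) zero_complex.code)
    then show ?thesis
      by (simp add: circle_act_def)
  qed
  ultimately show ?thesis
    by (auto simp: nsphere)
qed

text \<open>The projection \<open>\<gamma> : S\<^bsup>2n+1\<^esup> \<rightarrow> \<complex>P\<^bsup>n\<^esup>\<close> sends a point to its orbit under the unit circle;
  its defining formula does not depend on \<open>n\<close>.\<close>

definition cproj :: "(nat \<Rightarrow> real) \<Rightarrow> (nat \<Rightarrow> real) set" where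
  "cproj x = {circle_act u x | u. cmod u = 1}"

definition CP :: "nat \<Rightarrow> (nat \<Rightarrow> real) set topology" where
  "CP n = quotient_topology (nsphere (2 * n + 1)) cproj"

lemma quotient_map_cproj: "quotient_map (nsphere (2 * n + 1)) (CP n) cproj"
  by (simp add: CP_def quotient_map_quotient_topology)

text \<open>The group \<open>[\<Omega>(S\<^bsup>r+1\<^esup>), \<Omega>(Y)]\<close>.\<close>

definition sphere_loop_group ::
    "nat \<Rightarrow> 'b topology \<Rightarrow> 'b \<Rightarrow> ((real \<Rightarrow> nat \<Rightarrow> real) \<Rightarrow> real \<Rightarrow> 'b) set monoid" where
  "sphere_loop_group r Y y0 =
     htpy_loop_group (loop_space (nsphere (r + 1)) sphere_pt) (const_loop sphere_pt) Y y0"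

text \<open>The map \<open>\<gamma>\<^sub>* : [\<Omega>(S\<^bsup>r+1\<^esup>), \<Omega>(S\<^bsup>2n+1\<^esup>)] \<rightarrow> [\<Omega>(S\<^bsup>r+1\<^esup>), \<Omega>(\<complex>P\<^bsup>n\<^esup>)]\<close>.\<close>

definition cproj_push ::
    "nat \<Rightarrow> nat \<Rightarrow> ((real \<Rightarrow> nat \<Rightarrow> real) \<Rightarrow> real \<Rightarrow> nat \<Rightarrow> real) set
       \<Rightarrow> ((real \<Rightarrow> nat \<Rightarrow> real) \<Rightarrow> real \<Rightarrow> (nat \<Rightarrow> real) set) set" where
  "cproj_push r n =
     htpy_push (loop_space (nsphere (r + 1)) sphere_pt) (const_loop sphere_pt)
       (loop_space (CP n) (cproj sphere_pt)) (const_loop (cproj sphere_pt)) (loop_map cproj)"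

section \<open>Group-theoretic notions\<close>

text \<open>The library's \<open>short_exact_sequence\<close> forces the three groups to have the same element type.\<close>

definition split_short_exact ::
    "('a, 'x) monoid_scheme \<Rightarrow> ('b, 'y) monoid_scheme \<Rightarrow> ('c, 'z) monoid_scheme
       \<Rightarrow> ('a \<Rightarrow> 'b) \<Rightarrow> ('b \<Rightarrow> 'c) \<Rightarrow> bool" where
  "split_short_exact A B C f g \<longleftrightarrow>
     group A \<and> group B \<and> group C \<and> f \<in> mon A B \<and> g \<in> epi B C \<and>
     f ` carrier A = kernel B C g \<and>
     (\<exists>s \<in> hom C B. \<forall>c \<in> carrier C. g (s c) = c)"

definition p_torsion :: "nat \<Rightarrow> ('a, 'x) monoid_scheme \<Rightarrow> 'a set" where
  "p_torsion p H = {\<alpha> \<in> carrier H. \<exists>k. group.ord H \<alpha> = p ^ k}"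

text \<open>The unit belongs to \<open>p_torsion p H\<close>; when it is the only element, the least \<open>t\<close> is \<open>0\<close>
  and the exponent is \<open>1\<close>.\<close>

definition exp_p :: "nat \<Rightarrow> ('a, 'x) monoid_scheme \<Rightarrow> nat" where
  "exp_p p H =
     (if \<exists>t. \<forall>\<alpha> \<in> p_torsion p H. \<alpha> [^]\<^bsub>H\<^esub> (p ^ t) = \<one>\<^bsub>H\<^esub>
      then p ^ (LEAST t. \<forall>\<alpha> \<in> p_torsion p H. \<alpha> [^]\<^bsub>H\<^esub> (p ^ t) = \<one>\<^bsub>H\<^esub>)
      else 1)"

end

theory Submission
  imports Defs
begin

text \<open>
  Write \<open>S\<close> for the sphere \<open>S\<^bsup>2n+1\<^esup>\<close> and \<open>B\<close> for \<open>\<complex>P\<^bsup>n\<^esup>\<close>. The projection \<open>S \<rightarrow> B\<close> is a circle bundle and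
  lifts homotopies from every source space. Lifting loops of \<open>B\<close> to paths that start at the base point
  and recording in the fibre where they end gives the holonomy \<open>\<Omega>B \<rightarrow> S\<^sup>1\<close>. For every pointed space \<open>A\<close>
  this makes
  \<open>1 \<rightarrow> [A, \<Omega>S] \<rightarrow> [A, \<Omega>B] \<rightarrow> [A, S\<^sup>1] \<rightarrow> 1\<close>
  exact. If the holonomy of a map into \<open>\<Omega>B\<close> has a logarithm, then rotating the lifts back along it closes
  them up (\<open>lift_of_zero_holonomy\<close>). The kernel on the left is trivial, and the map on the right is onto,
  because the fibre is null-homotopic in \<open>S\<close> when \<open>n \<ge> 1\<close> (\<open>null_homotopic_lift\<close> and \<open>orbit_loop\<close>).

  It remains to know \<open>[A, S\<^sup>1]\<close> for \<open>A = \<Omega>S\<^bsup>r+1\<^esup>\<close>. A map to the circle lifts to the line as soon as its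
  argument has zero net change along every closed path, since loop spaces of spheres are locally
  contractible and connected (\<open>lift_sphere_loops\<close>). Maps of the square into \<open>S\<^bsup>r+1\<^esup>\<close> that are constant on
  the boundary are null-homotopic relative to it if \<open>r \<ge> 2\<close> (\<open>nullhomotopic_low_dimension\<close>), so then every
  map lifts, \<open>[A, S\<^sup>1]\<close> is trivial and the projection induces an isomorphism. For \<open>r = 1\<close> the same theory is applied to the Hopf
  bundle \<open>S\<^sup>3 \<rightarrow> S\<^sup>2\<close>: up to paths that lift to the simply connected space \<open>\<Omega>S\<^sup>3\<close>, every closed path in \<open>\<Omega>S\<^sup>2\<close>
  is an iterate of a single one, so the winding number along that path identifies \<open>[\<Omega>S\<^sup>2, S\<^sup>1]\<close> with \<open>\<int>\<close>
  (\<open>sphere_loops_2_winding\<close>). The sequence splits because \<open>\<int>\<close> is free, and torsion elements map to \<open>0\<close> in \<open>\<int>\<close>,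
  so they lie in the image of \<open>[A, \<Omega>S]\<close> and the exponents agree.

  The loop space \<open>\<Omega>S\<^bsup>r+1\<^esup>\<close> is not a cell complex, so the lifting property cannot be obtained cell by cell.
  It is proved for arbitrary source spaces by lifting in small steps whose width varies continuously with
  the point of the source (\<open>lift_by_short_transports\<close>). The covering of the circle by the line is an
  instance of the same lemma.
\<close>

section \<open>Maps into loop spaces\<close>

abbreviation unit_top :: "real topology" where
  "unit_top \<equiv> top_of_set {0..1}"

text \<open>The complement is the projection of a closed set along a compact factor. This is how compact-open
  neighbourhoods and the width of subdivisions are controlled below.\<close>

lemma openin_all_compact:
  assumes f: "continuous_map (prod_topology X Y) Z f" and K: "compactin Y K" and U: "openin Z U"
  shows "openin X {x \<in> topspace X. \<forall>k\<in>K. f (x, k) \<in> U}"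
proof -
  let ?Y = "subtopology Y K"
  have KY: "K \<subseteq> topspace Y" using K by (rule compactin_subset_topspace)
  have f': "continuous_map (prod_topology X ?Y) Z f"
    using continuous_map_from_subtopology[OF f, of "topspace X \<times> K"]
    by (metis prod_topology_subtopology(2) subtopology_restrict continuous_map_from_subtopology f)
  have *: "closedin (prod_topology X ?Y) {z \<in> topspace (prod_topology X ?Y). f z \<in> topspace Z - U}"
    using f' U by (intro closedin_continuous_map_preimage) auto
  have "closed_map (prod_topology X ?Y) X fst"
    using K by (intro Abstract_Topological_Spaces.closed_map_fst) (simp add: compact_space_subtopology)
  then have "closedin X (fst ` {z \<in> topspace (prod_topology X ?Y). f z \<in> topspace Z - U})"
    using * by (simp add: closed_map_def)
  then have "openin X (topspace X - fst ` {z \<in> topspace (prod_topology X ?Y). f z \<in> topspace Z - U})"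
    by blast
  moreover have "topspace X - fst ` {z \<in> topspace (prod_topology X ?Y). f z \<in> topspace Z - U}
     = {x \<in> topspace X. \<forall>k\<in>K. f (x, k) \<in> U}"
    using KY continuous_map_funspace[OF f] by (force simp: image_iff)
  ultimately show ?thesis by simp
qed

lemma topspace_loop_space:
  "topspace (loop_space Y y0) =
     {l. continuous_map unit_top Y l \<and> l \<in> extensional {0..1} \<and> l 0 = y0 \<and> l 1 = y0}"
  by (auto simp: loop_space_def topspace_compact_open_topology)

lemma const_loop_in_loop_space: "y \<in> topspace Y \<Longrightarrow> const_loop y \<in> topspace (loop_space Y y)"
proof -
  assume y: "y \<in> topspace Y"
  have "continuous_map unit_top Y (\<lambda>_. y)" by (rule continuous_map_const[THEN iffD2]) (simp add: y)
  then have "continuous_map unit_top Y (const_loop y)"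
    by (rule continuous_map_eq) (simp add: const_loop_def)
  then show ?thesis unfolding topspace_loop_space by (simp add: const_loop_def)
qed

text \<open>Together with \<open>continuous_map_uncurry_loop\<close> this is the exponential law for the interval: a subbasic set
  of the compact-open topology is a condition on all points of a compact set, hence open in the parameter.
  It turns maps into loop spaces into maps of one more variable.\<close>

lemma continuous_map_curry_loop:
  assumes "continuous_map (prod_topology X unit_top) Y (\<lambda>(x, t). f x t)"
    and "\<And>x. x \<in> topspace X \<Longrightarrow> f x \<in> extensional {0..1} \<and> f x 0 = y0 \<and> f x 1 = y0"
  shows "continuous_map X (loop_space Y y0) f"
proof -
  have sec: "continuous_map unit_top Y (f x)" if "x \<in> topspace X" for x
  proof -
    have "continuous_map unit_top Y ((\<lambda>(x, t). f x t) \<circ> (\<lambda>t. (x, t)))"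
      by (rule continuous_map_compose[OF _ assms(1)])
         (use that in \<open>auto simp: continuous_map_pairwise o_def\<close>)
    then show ?thesis by (simp add: o_def)
  qed
  have "continuous_map X (compact_open_topology unit_top Y) f"
    unfolding compact_open_topology_def
  proof (rule continuous_on_generated_topo, goal_cases)
    case (1 U)
    then obtain K V where U: "U = {f. continuous_map unit_top Y f \<and> f \<in> extensional (topspace unit_top) \<and> f ` K \<subseteq> V}"
      and K: "compactin unit_top K" and V: "openin Y V"
      by auto
    have "f -` U \<inter> topspace X = {x \<in> topspace X. \<forall>k\<in>K. (\<lambda>(x, t). f x t) (x, k) \<in> V}"
      unfolding U using assms(2) sec by (auto simp: image_subset_iff)
    then show ?case
      using openin_all_compact[OF assms(1) K V] by simp
  next
    case 2
    have "topspace (compact_open_topology unit_top Y) =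
      \<Union>{{f. continuous_map unit_top Y f \<and> f \<in> extensional (topspace unit_top) \<and> f ` K \<subseteq> U} | K U.
          compactin unit_top K \<and> openin Y U}"
      unfolding compact_open_topology_def topology_generated_by_topspace ..
    moreover have "f ` topspace X \<subseteq> topspace (compact_open_topology unit_top Y)"
      using assms(2) sec by (auto simp: topspace_compact_open_topology)
    ultimately show ?case by simp
  qed
  then show ?thesis
    using assms(2) by (auto simp: loop_space_def continuous_map_in_subtopology)
qed

text \<open>Evaluation is continuous because a closed interval around \<open>t\<close> is a compact neighbourhood on which a given
  loop stays in the open set.\<close>

lemma continuous_map_eval_loop:
  "continuous_map (prod_topology (loop_space Y y0) unit_top) Y (\<lambda>(l, t). l t)"
  unfolding continuous_map_def
proof (intro conjI allI impI)
  show "(\<lambda>(l, t). l t) \<in> topspace (prod_topology (loop_space Y y0) unit_top) \<rightarrow> topspace Y"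
    by (auto simp: topspace_loop_space continuous_map_def)
next
  fix U assume U: "openin Y U"
  let ?P = "{x \<in> topspace (prod_topology (loop_space Y y0) unit_top). (case x of (l, t) \<Rightarrow> l t) \<in> U}"
  show "openin (prod_topology (loop_space Y y0) unit_top) ?P"
    unfolding openin_prod_topology_alt
  proof (intro allI impI)
    fix l t assume "(l, t) \<in> ?P"
    then have l: "l \<in> topspace (loop_space Y y0)" and t: "t \<in> {0..1}" and lt: "l t \<in> U"
      by auto
    have "openin unit_top {s \<in> topspace unit_top. l s \<in> U}"
      using l U by (intro openin_continuous_map_preimage) (auto simp: topspace_loop_space)
    moreover have "t \<in> {s \<in> topspace unit_top. l s \<in> U}" using t lt by simp
    ultimately obtain e where e: "e > 0" "\<And>s. s \<in> {0..1} \<Longrightarrow> dist s t < e \<Longrightarrow> l s \<in> U"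
      unfolding openin_euclidean_subtopology_iff by (smt (verit) mem_Collect_eq topspace_euclidean_subtopology)
    define K where "K = {0..1} \<inter> cball t (e/2)"
    have "compact K" unfolding K_def by (intro closed_Int_compact) auto
    then have K: "compactin unit_top K" by (auto simp: compactin_subtopology K_def)
    let ?W = "{f. continuous_map unit_top Y f \<and> f \<in> extensional (topspace unit_top) \<and> f ` K \<subseteq> U}"
    have "openin (compact_open_topology unit_top Y) ?W"
      unfolding compact_open_topology_def
      by (rule topology_generated_by_Basis) (use K U in blast)
    then have "openin (loop_space Y y0) (?W \<inter> {l. l 0 = y0 \<and> l 1 = y0})"
      unfolding loop_space_def openin_subtopology by blast
    moreover have "?W \<inter> {l. l 0 = y0 \<and> l 1 = y0} = topspace (loop_space Y y0) \<inter> ?W"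
      unfolding topspace_loop_space topspace_euclidean_subtopology by blast
    ultimately have 1: "openin (loop_space Y y0) (topspace (loop_space Y y0) \<inter> ?W)"
      by (simp only:)
    have 2: "openin unit_top ({0..1} \<inter> ball t (e/2))"
      by (simp add: openin_open_Int)
    have "l ` K \<subseteq> U"
      using e by (auto simp: K_def dist_commute)
    then have "l \<in> topspace (loop_space Y y0) \<inter> ?W"
      using l by (auto simp: topspace_loop_space)
    moreover have "t \<in> {0..1} \<inter> ball t (e/2)" using t e by auto
    moreover have "(topspace (loop_space Y y0) \<inter> ?W) \<times> ({0..1} \<inter> ball t (e/2)) \<subseteq> ?P"
      by (auto simp: K_def)
    ultimately show "\<exists>V W. openin (loop_space Y y0) V \<and> openin unit_top W \<and> l \<in> V \<and> t \<in> W \<and> V \<times> W \<subseteq> ?P"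
      using 1 2 by blast
  qed
qed

lemma continuous_map_uncurry_loop:
  assumes "continuous_map X (loop_space Y y0) f"
  shows "continuous_map (prod_topology X unit_top) Y (\<lambda>(x, t). f x t)"
proof -
  have "continuous_map (prod_topology X unit_top) Y ((\<lambda>(l, t). l t) \<circ> (\<lambda>(x,t). (f x, t)))"
  proof (rule continuous_map_compose[OF _ continuous_map_eval_loop])
    show "continuous_map (prod_topology X unit_top) (prod_topology (loop_space Y y0) unit_top) (\<lambda>(x,t). (f x, t))"
      unfolding continuous_map_pairwise
      using continuous_map_compose[OF continuous_map_fst assms]
      by (auto simp: o_def case_prod_beta continuous_map_snd)
  qed
  then show ?thesis by (simp add: o_def split_def)
qed

lemma loop_map_values:
  assumes "continuous_map X (loop_space Y y0) f" "x \<in> topspace X"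
  shows "f x 0 = y0" "f x 1 = y0" "f x \<in> extensional {0..1}" "continuous_map unit_top Y (f x)"
  using continuous_map_funspace[OF assms(1)] assms(2) by (auto simp: topspace_loop_space)

section \<open>The groups of pointed homotopy classes\<close>

lemma continuous_map_unit_topI:
  assumes "continuous_map X euclideanreal f" and "\<And>x. x \<in> topspace X \<Longrightarrow> 0 \<le> f x \<and> f x \<le> 1"
  shows "continuous_map X unit_top f"
  using assms by (auto simp: continuous_map_in_subtopology)

text \<open>Pointed homotopies of maps into a loop space are written down as functions of three variables: the
  homotopy parameter \<open>s\<close>, the point \<open>a\<close> and the loop parameter \<open>t\<close>. Restricting to the unit interval turns
  them into elements of the loop space, which consists of extensional functions.\<close>

lemma homotopic_loop_mapsI:
  assumes k: "continuous_map (prod_topology (prod_topology unit_top A) unit_top) Y (\<lambda>((s, a), t). k s a t)"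
    and ends: "\<And>s a. s \<in> {0..1} \<Longrightarrow> a \<in> topspace A \<Longrightarrow> k s a 0 = y0 \<and> k s a 1 = y0"
    and pt: "\<And>s t. s \<in> {0..1} \<Longrightarrow> t \<in> {0..1} \<Longrightarrow> k s a0 t = y0"
    and f: "\<And>a. a \<in> topspace A \<Longrightarrow> f a = restrict (k 0 a) {0..1}"
    and g: "\<And>a. a \<in> topspace A \<Longrightarrow> g a = restrict (k 1 a) {0..1}"
    and a0: "a0 \<in> topspace A"
  shows "homotopic_with (\<lambda>h. h a0 = const_loop y0) A (loop_space Y y0) f g"
proof -
  let ?h = "\<lambda>(s, a). restrict (k s a) {0..1}"
  have "continuous_map (prod_topology unit_top A) (loop_space Y y0) ?h"
  proof (rule continuous_map_curry_loop)
    show "continuous_map (prod_topology (prod_topology unit_top A) unit_top) Y (\<lambda>(x, t). (case x of (s, a) \<Rightarrow> restrict (k s a) {0..1}) t)"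
      by (rule continuous_map_eq[OF k]) auto
  qed (use ends in auto)
  moreover have "restrict (k s a0) {0..1} = const_loop y0" if "s \<in> {0..1}" for s
    using pt that by (auto simp: const_loop_def restrict_def)
  ultimately show ?thesis
    by (subst homotopic_with) (use a0 f g in \<open>auto intro!: exI[of _ ?h]\<close>)
qed

lemma htpy_class_eqI:
  "homotopic_with (\<lambda>h. h x0 = y0) X Y f g \<Longrightarrow> htpy_class X x0 Y y0 f = htpy_class X x0 Y y0 g"
  unfolding htpy_class_def by (blast intro: homotopic_with_trans homotopic_with_symD)

lemma htpy_class_eq_iff:
  assumes "continuous_map X Y f" "f x0 = y0"
  shows "htpy_class X x0 Y y0 g = htpy_class X x0 Y y0 f \<longleftrightarrow> homotopic_with (\<lambda>h. h x0 = y0) X Y f g"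
proof
  assume "htpy_class X x0 Y y0 g = htpy_class X x0 Y y0 f"
  moreover have "f \<in> htpy_class X x0 Y y0 f"
    using assms by (simp add: htpy_class_def)
  ultimately show "homotopic_with (\<lambda>h. h x0 = y0) X Y f g"
    by (metis htpy_class_def homotopic_with_symD mem_Collect_eq)
qed (metis htpy_class_eqI)

lemma htpy_push_class:
  assumes f: "continuous_map X Y f" "f x0 = y0" and k: "continuous_map Y Z k" "k y0 = z0"
  shows "htpy_push X x0 Z z0 k (htpy_class X x0 Y y0 f) = htpy_class X x0 Z z0 (k \<circ> f)"
proof -
  have "htpy_class X x0 Z z0 (k \<circ> g) = htpy_class X x0 Z z0 (k \<circ> f)"
    if "g \<in> htpy_class X x0 Y y0 f" for g
  proof (rule htpy_class_eqI)
    have "homotopic_with (\<lambda>h. h x0 = z0) X Z (k \<circ> f) (k \<circ> g)"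
      using that k by (intro homotopic_with_compose_continuous_map_left[where p = "\<lambda>h. h x0 = y0"]) (auto simp: htpy_class_def)
    then show "homotopic_with (\<lambda>h. h x0 = z0) X Z (k \<circ> g) (k \<circ> f)"
      by (rule homotopic_with_symD)
  qed
  moreover have "f \<in> htpy_class X x0 Y y0 f"
    using f by (simp add: htpy_class_def)
  ultimately show ?thesis
    unfolding htpy_push_def by blast
qed

text \<open>Every coherence homotopy of the loop group is an instance of this one: two reparametrisations
  with the same end points in \<open>{0, 1}\<close> are joined by the straight line between them.\<close>

lemma homotopic_reparametrisations:
  assumes f: "continuous_map A (loop_space Y y0) f" "f a0 = const_loop y0" "a0 \<in> topspace A"
    and \<alpha>: "continuous_map unit_top unit_top \<alpha>" and \<beta>: "continuous_map unit_top unit_top \<beta>"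
    and ends: "\<alpha> 0 = \<beta> 0" "\<alpha> 1 = \<beta> 1" "\<alpha> 0 \<in> {0, 1}" "\<alpha> 1 \<in> {0, 1}"
    and g: "\<And>a t. a \<in> topspace A \<Longrightarrow> g a = restrict (\<lambda>t. f a (\<alpha> t)) {0..1}"
    and h: "\<And>a t. a \<in> topspace A \<Longrightarrow> h a = restrict (\<lambda>t. f a (\<beta> t)) {0..1}"
  shows "homotopic_with (\<lambda>h. h a0 = const_loop y0) A (loop_space Y y0) g h"
proof (rule homotopic_loop_mapsI)
  let ?X = "prod_topology (prod_topology unit_top A) unit_top"
  let ?\<gamma> = "\<lambda>s t. (1 - s) * \<alpha> t + s * \<beta> t"
  have \<alpha>01: "\<alpha> t \<in> {0..1}" and \<beta>01: "\<beta> t \<in> {0..1}" if "t \<in> {0..1}" for t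
    using that \<alpha> \<beta> by (auto simp: continuous_map_def)
  have conv: "?\<gamma> s t \<in> {0..1}" if "s \<in> {0..1}" "t \<in> {0..1}" for s t
    using convexD_alt[of "{0..1::real}" "\<alpha> t" "\<beta> t" s] \<alpha>01[OF that(2)] \<beta>01[OF that(2)] that(1) by auto
  have s: "continuous_map ?X euclideanreal (\<lambda>z. fst (fst z))"
    using continuous_map_compose[OF continuous_map_fst, of "prod_topology unit_top A" unit_top, OF continuous_map_fst]
    by (auto simp: o_def continuous_map_in_subtopology)
  have snd: "continuous_map ?X unit_top snd" by (rule continuous_map_snd)
  have a: "continuous_map ?X euclideanreal (\<lambda>z. \<alpha> (snd z))" "continuous_map ?X euclideanreal (\<lambda>z. \<beta> (snd z))"
    using continuous_map_compose[OF snd \<alpha>] continuous_map_compose[OF snd \<beta>]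
    by (auto simp: o_def continuous_map_in_subtopology)
  have "continuous_map ?X unit_top (\<lambda>z. ?\<gamma> (fst (fst z)) (snd z))"
  proof (rule continuous_map_unit_topI)
    show "continuous_map ?X euclideanreal (\<lambda>z. ?\<gamma> (fst (fst z)) (snd z))"
      by (intro continuous_intros s a)
  qed (use conv in auto)
  moreover have "continuous_map ?X A (\<lambda>z. snd (fst z))"
    using continuous_map_compose[OF continuous_map_fst continuous_map_snd, of "unit_top" A unit_top] by (simp add: o_def)
  ultimately have "continuous_map ?X (prod_topology A unit_top) (\<lambda>z. (snd (fst z), ?\<gamma> (fst (fst z)) (snd z)))"
    by (simp add: continuous_map_paired)
  from continuous_map_compose[OF this continuous_map_uncurry_loop[OF f(1)]]
  show "continuous_map ?X Y (\<lambda>((s, a), t). f a (?\<gamma> s t))"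
    by (simp add: o_def split_def)
  show "f a (?\<gamma> s 0) = y0 \<and> f a (?\<gamma> s 1) = y0" if "a \<in> topspace A" for s a
    using ends loop_map_values[OF f(1) that] by (auto simp: algebra_simps)
  show "f a0 (?\<gamma> s t) = y0" if "s \<in> {0..1}" "t \<in> {0..1}" for s t
    using conv[OF that] f(2) by (simp add: const_loop_def)
qed (use g h f in simp_all)

lemma continuous_map_loop_concat:
  assumes "continuous_map A (loop_space Y y0) f" "continuous_map A (loop_space Y y0) g"
  shows "continuous_map A (loop_space Y y0) (\<lambda>a. loop_concat (f a) (g a))"
proof (rule continuous_map_curry_loop)
  let ?X = "prod_topology A unit_top"
  have snd: "continuous_map ?X euclideanreal snd"
    using continuous_map_snd[of A unit_top] by (simp add: continuous_map_in_subtopology)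
  have piece: "continuous_map (subtopology ?X S) Y (\<lambda>x. h (fst x) (\<gamma> (snd x)))"
    if "continuous_map A (loop_space Y y0) h" "continuous_map euclideanreal euclideanreal \<gamma>"
       "\<And>a t. (a, t) \<in> S \<Longrightarrow> 0 \<le> \<gamma> t \<and> \<gamma> t \<le> 1" for h \<gamma> S
  proof -
    have "continuous_map (subtopology ?X S) unit_top (\<lambda>x. \<gamma> (snd x))"
      using continuous_map_compose[OF snd that(2)] that(3)
      by (intro continuous_map_unit_topI continuous_map_from_subtopology) (auto simp: o_def)
    then have "continuous_map (subtopology ?X S) ?X (\<lambda>x. (fst x, \<gamma> (snd x)))"
      by (simp add: continuous_map_paired continuous_map_from_subtopology continuous_map_fst)
    from continuous_map_compose[OF this continuous_map_uncurry_loop[OF that(1)]]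
    show ?thesis by (simp add: o_def split_def)
  qed
  have "continuous_map ?X Y (\<lambda>x. if snd x \<le> 1/2 then f (fst x) (2 * snd x) else g (fst x) (2 * snd x - 1))"
  proof (rule continuous_map_cases_le)
    show "continuous_map (subtopology ?X {x \<in> topspace ?X. snd x \<le> 1/2}) Y (\<lambda>x. f (fst x) (2 * snd x))"
      by (rule piece[OF assms(1)]) (auto intro: continuous_intros)
    show "continuous_map (subtopology ?X {x \<in> topspace ?X. 1/2 \<le> snd x}) Y (\<lambda>x. g (fst x) (2 * snd x - 1))"
      by (rule piece[OF assms(2)]) (auto intro: continuous_intros)
    show "f (fst x) (2 * snd x) = g (fst x) (2 * snd x - 1)" if "x \<in> topspace ?X" "snd x = 1/2" for x
    proof -
      have "2 * snd x = 1" "fst x \<in> topspace A" using that by auto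
      then show ?thesis using loop_map_values[OF assms(1)] loop_map_values[OF assms(2)] by simp
    qed
  qed (auto intro: snd)
  then show "continuous_map ?X Y (\<lambda>(a, t). loop_concat (f a) (g a) t)"
    by (rule continuous_map_eq) (auto simp: loop_concat_def)
qed (use loop_map_values[OF assms(1)] loop_map_values[OF assms(2)] in \<open>auto simp: loop_concat_def\<close>)

lemma loop_concat_const [simp]: "loop_concat (const_loop y) (const_loop y) = const_loop y"
  by (auto simp: loop_concat_def const_loop_def restrict_def)

lemma homotopic_loop_concat:
  assumes f: "homotopic_with (\<lambda>h. h a0 = const_loop y0) A (loop_space Y y0) f f'"
    and g: "homotopic_with (\<lambda>h. h a0 = const_loop y0) A (loop_space Y y0) g g'"
  shows "homotopic_with (\<lambda>h. h a0 = const_loop y0) A (loop_space Y y0)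
           (\<lambda>a. loop_concat (f a) (g a)) (\<lambda>a. loop_concat (f' a) (g' a))"
proof -
  obtain h where h: "continuous_map (prod_topology unit_top A) (loop_space Y y0) h"
    "\<And>x. h (0, x) = f x" "\<And>x. h (1, x) = f' x" "\<And>t. t \<in> {0..1} \<Longrightarrow> h (t, a0) = const_loop y0"
    using f unfolding homotopic_with_def by blast
  obtain k where k: "continuous_map (prod_topology unit_top A) (loop_space Y y0) k"
    "\<And>x. k (0, x) = g x" "\<And>x. k (1, x) = g' x" "\<And>t. t \<in> {0..1} \<Longrightarrow> k (t, a0) = const_loop y0"
    using g unfolding homotopic_with_def by blast
  show ?thesis
    unfolding homotopic_with_def
    by (rule exI[of _ "\<lambda>z. loop_concat (h z) (k z)"])
       (use h k continuous_map_loop_concat[OF h(1) k(1)] in auto)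
qed

locale pointed_pair =
  fixes A :: "'a topology" and a0 :: 'a and Y :: "'b topology" and y0 :: 'b
  assumes a0: "a0 \<in> topspace A" and y0: "y0 \<in> topspace Y"
begin

abbreviation pmap :: "('a \<Rightarrow> real \<Rightarrow> 'b) \<Rightarrow> bool" where
  "pmap f \<equiv> continuous_map A (loop_space Y y0) f \<and> f a0 = const_loop y0"

abbreviation cls :: "('a \<Rightarrow> real \<Rightarrow> 'b) \<Rightarrow> ('a \<Rightarrow> real \<Rightarrow> 'b) set" where
  "cls \<equiv> htpy_class A a0 (loop_space Y y0) (const_loop y0)"

abbreviation hom_eq :: "('a \<Rightarrow> real \<Rightarrow> 'b) \<Rightarrow> ('a \<Rightarrow> real \<Rightarrow> 'b) \<Rightarrow> bool" where
  "hom_eq \<equiv> homotopic_with (\<lambda>h. h a0 = const_loop y0) A (loop_space Y y0)"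

abbreviation "G \<equiv> htpy_loop_group A a0 Y y0"

lemma carrier_eq: "carrier G = {cls f | f. pmap f}"
  by (simp add: htpy_loop_group_def htpy_classes_def)

lemma cls_in_carrier: "pmap f \<Longrightarrow> cls f \<in> carrier G"
  unfolding carrier_eq by blast

lemma carrierE:
  assumes "x \<in> carrier G"
  obtains f where "pmap f" "x = cls f"
  using assms unfolding carrier_eq by blast

lemma one_eq: "\<one>\<^bsub>G\<^esub> = cls (\<lambda>_. const_loop y0)"
  by (simp add: htpy_loop_group_def)

lemma pmap_const: "pmap (\<lambda>_. const_loop y0)"
  using const_loop_in_loop_space[OF y0] by (simp add: continuous_map_const)

lemma pmap_concat: "pmap f \<Longrightarrow> pmap g \<Longrightarrow> pmap (\<lambda>a. loop_concat (f a) (g a))"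
  by (simp add: continuous_map_loop_concat)

lemma mult_eq:
  assumes "pmap f" "pmap g"
  shows "cls f \<otimes>\<^bsub>G\<^esub> cls g = cls (\<lambda>a. loop_concat (f a) (g a))"
proof -
  have "cls (\<lambda>x. loop_concat (f' x) (g' x)) = cls (\<lambda>a. loop_concat (f a) (g a))"
    if "f' \<in> cls f" "g' \<in> cls g" for f' g'
    using that by (intro htpy_class_eqI[symmetric] homotopic_loop_concat) (auto simp: htpy_class_def)
  then have "(\<Union>f'\<in>cls f. \<Union>g'\<in>cls g. cls (\<lambda>x. loop_concat (f' x) (g' x))) =
      (\<Union>f'\<in>cls f. \<Union>g'\<in>cls g. cls (\<lambda>a. loop_concat (f a) (g a)))"
    by (intro SUP_cong refl) blast
  moreover have "f \<in> cls f" "g \<in> cls g"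
    using assms by (auto simp: htpy_class_def)
  ultimately show ?thesis
    unfolding htpy_loop_group_def monoid.simps by blast
qed

lemma reparam:
  assumes "pmap f"
    and "continuous_on {0..1} \<alpha>" "\<And>t. t \<in> {0..1} \<Longrightarrow> 0 \<le> \<alpha> t \<and> \<alpha> t \<le> 1"
    and "continuous_on {0..1} \<beta>" "\<And>t. t \<in> {0..1} \<Longrightarrow> 0 \<le> \<beta> t \<and> \<beta> t \<le> 1"
    and "\<alpha> 0 = \<beta> 0" "\<alpha> 1 = \<beta> 1" "\<alpha> 0 \<in> {0, 1}" "\<alpha> 1 \<in> {0, 1}"
    and "\<And>a t. a \<in> topspace A \<Longrightarrow> g a = restrict (\<lambda>t. f a (\<alpha> t)) {0..1}"
    and "\<And>a t. a \<in> topspace A \<Longrightarrow> h a = restrict (\<lambda>t. f a (\<beta> t)) {0..1}"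
  shows "cls g = cls h"
  by (rule htpy_class_eqI, rule homotopic_reparametrisations[of A Y y0 f a0 \<alpha> \<beta>])
     (use assms a0 in \<open>auto simp: continuous_map_in_subtopology continuous_map_iff_continuous\<close>)

lemma loop_values:
  assumes "pmap f" "a \<in> topspace A"
  shows "f a 0 = y0" "f a 1 = y0" "f a = restrict (f a) {0..1}"
  using loop_map_values[of A Y y0 f a] assms by (auto simp: extensional_restrict)

lemma concat_assoc:
  assumes f: "pmap f" and g: "pmap g" and h: "pmap h"
  shows "cls (\<lambda>a. loop_concat (loop_concat (f a) (g a)) (h a)) = cls (\<lambda>a. loop_concat (f a) (loop_concat (g a) (h a)))"
proof (rule reparam)
  show "pmap (\<lambda>a. loop_concat (f a) (loop_concat (g a) (h a)))"
    by (intro pmap_concat f g h)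
  \<comment> \<open>The reparametrisation has slopes \<open>2\<close>, \<open>1\<close> and \<open>1/2\<close>; being concave, it is a minimum of its three branches.\<close>
  let ?\<alpha> = "\<lambda>t::real. min (2 * t) (min (t + 1/4) ((t + 1)/2))"
  show "loop_concat (loop_concat (f a) (g a)) (h a) =
        restrict (\<lambda>t. loop_concat (f a) (loop_concat (g a) (h a)) (?\<alpha> t)) {0..1}" if a: "a \<in> topspace A" for a
  proof
    fix t :: real
    consider "t \<notin> {0..1}" | "0 \<le> t" "t \<le> 1/4" | "1/4 < t" "t \<le> 1/2" | "1/2 < t" "t \<le> 1"
      by fastforce
    then show "loop_concat (loop_concat (f a) (g a)) (h a) t =
        restrict (\<lambda>t. loop_concat (f a) (loop_concat (g a) (h a)) (?\<alpha> t)) {0..1} t"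
    proof cases
      case 1 then show ?thesis by (auto simp: loop_concat_def)
    next
      case 2
      then have "?\<alpha> t = 2 * t" by (simp add: min_def field_simps)
      with 2 show ?thesis by (simp add: loop_concat_def)
    next
      case 3
      then have "?\<alpha> t = t + 1/4" by (simp add: min_def field_simps)
      with 3 show ?thesis by (simp add: loop_concat_def algebra_simps)
    next
      case 4
      then have "?\<alpha> t = (t + 1)/2" by (simp add: min_def field_simps)
      with 4 show ?thesis by (simp add: loop_concat_def algebra_simps add_divide_distrib)
    qed
  qed
  show "loop_concat (f a) (loop_concat (g a) (h a)) =
        restrict (\<lambda>t. loop_concat (f a) (loop_concat (g a) (h a)) t) {0..1}" for a
    by (simp add: loop_concat_def restrict_def fun_eq_iff)
  show "0 \<le> ?\<alpha> t \<and> ?\<alpha> t \<le> 1" if "t \<in> {0..1}" for t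
    using that by (auto simp: min_def)
qed (auto intro!: continuous_intros)

lemma concat_const_left:
  assumes f: "pmap f"
  shows "cls (\<lambda>a. loop_concat (const_loop y0) (f a)) = cls f"
proof (rule reparam[OF f])
  show "loop_concat (const_loop y0) (f a) = restrict (\<lambda>t. f a (max 0 (2 * t - 1))) {0..1}"
    if a: "a \<in> topspace A" for a
  proof
    fix t
    show "loop_concat (const_loop y0) (f a) t = restrict (\<lambda>t. f a (max 0 (2 * t - 1))) {0..1} t"
      using loop_values(1)[OF f a]
      by (cases "2 * t" "1::real" rule: linorder_cases) (auto simp: loop_concat_def const_loop_def max_def)
  qed
  show "f a = restrict (\<lambda>t. f a t) {0..1}" if a: "a \<in> topspace A" for a
    using loop_values(3)[OF f a] .
qed (auto intro!: continuous_intros)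

lemma pmap_reverse:
  assumes f: "pmap f"
  shows "pmap (\<lambda>a. restrict (\<lambda>t. f a (1 - t)) {0..1})"
proof
  have "continuous_map (prod_topology A unit_top) unit_top (\<lambda>x. 1 - snd x)"
    using continuous_map_snd[of A unit_top]
    by (intro continuous_map_unit_topI continuous_intros) (auto simp: continuous_map_in_subtopology)
  then have "continuous_map (prod_topology A unit_top) (prod_topology A unit_top) (\<lambda>x. (fst x, 1 - snd x))"
    by (simp add: continuous_map_paired continuous_map_fst)
  from continuous_map_compose[OF this continuous_map_uncurry_loop[of A Y y0 f]] f
  have "continuous_map (prod_topology A unit_top) Y (\<lambda>(a, t). f a (1 - t))"
    by (simp add: o_def split_def)
  then show "continuous_map A (loop_space Y y0) (\<lambda>a. restrict (\<lambda>t. f a (1 - t)) {0..1})"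
    by (intro continuous_map_curry_loop) (use loop_values[OF f] in \<open>auto elim: continuous_map_eq\<close>)
  show "restrict (\<lambda>t. f a0 (1 - t)) {0..1} = const_loop y0"
    using f by (auto simp: const_loop_def restrict_def fun_eq_iff)
qed

lemma concat_reverse_left:
  assumes f: "pmap f"
  shows "cls (\<lambda>a. loop_concat (restrict (\<lambda>t. f a (1 - t)) {0..1}) (f a)) = cls (\<lambda>_. const_loop y0)"
proof (rule reparam[OF f])
  show "loop_concat (restrict (\<lambda>t. f a (1 - t)) {0..1}) (f a) = restrict (\<lambda>t. f a \<bar>1 - 2 * t\<bar>) {0..1}"
    if a: "a \<in> topspace A" for a
    by (auto simp: loop_concat_def restrict_def fun_eq_iff)
  show "const_loop y0 = restrict (\<lambda>t. f a 1) {0..1}" if a: "a \<in> topspace A" for a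
    using loop_values(2)[OF f a] by (simp add: const_loop_def)
qed (auto intro!: continuous_intros)

lemma group_htpy_loop_group: "group G"
proof (rule groupI)
  fix x y z assume "x \<in> carrier G" "y \<in> carrier G" "z \<in> carrier G"
  then obtain f g h where f: "pmap f" "x = cls f" and g: "pmap g" "y = cls g" and h: "pmap h" "z = cls h"
    by (elim carrierE)
  show "x \<otimes>\<^bsub>G\<^esub> y \<otimes>\<^bsub>G\<^esub> z = x \<otimes>\<^bsub>G\<^esub> (y \<otimes>\<^bsub>G\<^esub> z)"
    unfolding f g h mult_eq[OF f(1) g(1)] mult_eq[OF g(1) h(1)]
      mult_eq[OF pmap_concat[OF f(1) g(1)] h(1)] mult_eq[OF f(1) pmap_concat[OF g(1) h(1)]]
    by (rule concat_assoc[OF f(1) g(1) h(1)])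
next
  fix x y assume "x \<in> carrier G" "y \<in> carrier G"
  then obtain f g where f: "pmap f" "x = cls f" and g: "pmap g" "y = cls g"
    by (elim carrierE)
  show "x \<otimes>\<^bsub>G\<^esub> y \<in> carrier G"
    unfolding f g mult_eq[OF f(1) g(1)] by (rule cls_in_carrier[OF pmap_concat[OF f(1) g(1)]])
next
  show "\<one>\<^bsub>G\<^esub> \<in> carrier G"
    unfolding one_eq by (rule cls_in_carrier[OF pmap_const])
next
  fix x assume "x \<in> carrier G"
  then obtain f where f: "pmap f" "x = cls f"
    by (elim carrierE)
  show "\<one>\<^bsub>G\<^esub> \<otimes>\<^bsub>G\<^esub> x = x"
    unfolding one_eq f mult_eq[OF pmap_const f(1)] by (rule concat_const_left[OF f(1)])
  show "\<exists>y\<in>carrier G. y \<otimes>\<^bsub>G\<^esub> x = \<one>\<^bsub>G\<^esub>"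
  proof (rule bexI)
    show "cls (\<lambda>a. restrict (\<lambda>t. f a (1 - t)) {0..1}) \<otimes>\<^bsub>G\<^esub> x = \<one>\<^bsub>G\<^esub>"
      unfolding one_eq f mult_eq[OF pmap_reverse[OF f(1)] f(1)] by (rule concat_reverse_left[OF f(1)])
  qed (rule cls_in_carrier[OF pmap_reverse[OF f(1)]])
qed

end

section \<open>Lifting homotopies by short transports\<close>

lemma Inf_attained_compact:
  assumes "continuous_map Y euclideanreal f" "compact_space Y" "Y \<noteq> trivial_topology"
  obtains y where "y \<in> topspace Y" "f y = Inf (f ` topspace Y)" "\<And>z. z \<in> topspace Y \<Longrightarrow> f y \<le> f z"
proof -
  have "compactin euclideanreal (f ` topspace Y)"
    using assms by (metis compact_space_def image_compactin)
  then have "compact (f ` topspace Y)" "f ` topspace Y \<noteq> {}"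
    using assms(3) by auto
  then obtain w where "w \<in> f ` topspace Y" "\<forall>z\<in>f ` topspace Y. w \<le> z"
    using compact_attains_inf by meson
  then obtain y where y: "y \<in> topspace Y" "\<And>z. z \<in> topspace Y \<Longrightarrow> f y \<le> f z"
    by blast
  moreover have "Inf (f ` topspace Y) = f y"
    by (rule cInf_eq_minimum) (use y in auto)
  ultimately show ?thesis using that by simp
qed

lemma continuous_map_section:
  assumes "continuous_map (prod_topology X Y) Z f" "x \<in> topspace X"
  shows "continuous_map Y Z (\<lambda>y. f (x, y))"
proof -
  have "continuous_map Y (prod_topology X Y) (\<lambda>y. (x, y))"
    using assms(2) by (simp add: continuous_map_paired)
  from continuous_map_compose[OF this assms(1)] show ?thesis by (simp add: o_def)
qed

lemma continuous_map_section2: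
  assumes "continuous_map (prod_topology X Y) Z f" "y \<in> topspace Y"
  shows "continuous_map X Z (\<lambda>x. f (x, y))"
proof -
  have "continuous_map X (prod_topology X Y) (\<lambda>x. (x, y))"
    using assms(2) by (simp add: continuous_map_paired)
  from continuous_map_compose[OF this assms(1)] show ?thesis by (simp add: o_def)
qed

text \<open>Super-level sets are open by compactness, sub-level sets because projections are open.\<close>

lemma continuous_map_Inf_compact:
  assumes f: "continuous_map (prod_topology X Y) euclideanreal f"
    and Y: "compact_space Y" "Y \<noteq> trivial_topology"
  shows "continuous_map X euclideanreal (\<lambda>x. Inf ((\<lambda>y. f (x, y)) ` topspace Y))"
proof -
  let ?I = "\<lambda>x. Inf ((\<lambda>y. f (x, y)) ` topspace Y)"
  have att: "\<exists>y. y \<in> topspace Y \<and> f (x, y) = ?I x \<and> (\<forall>z\<in>topspace Y. f (x, y) \<le> f (x, z))"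
    if "x \<in> topspace X" for x
    using Inf_attained_compact[OF continuous_map_section[OF f that] Y] by metis
  have "openin X {x \<in> topspace X. ?I x > c}" for c
  proof -
    have "{x \<in> topspace X. ?I x > c} = {x \<in> topspace X. \<forall>y\<in>topspace Y. f (x, y) \<in> {c<..}}"
      using att by fastforce
    also have "openin X \<dots>"
      by (rule openin_all_compact[OF f]) (use Y in \<open>auto simp: compact_space_def\<close>)
    finally show ?thesis .
  qed
  moreover have "openin X {x \<in> topspace X. ?I x < c}" for c
  proof -
    have "{x \<in> topspace X. ?I x < c} = fst ` {z \<in> topspace (prod_topology X Y). f z \<in> {..<c}}"
    proof (intro equalityI subsetI)
      fix x assume x: "x \<in> {x \<in> topspace X. ?I x < c}"
      then obtain y where "y \<in> topspace Y" "f (x, y) = ?I x" using att[of x] by auto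
      then have "(x, y) \<in> {z \<in> topspace (prod_topology X Y). f z \<in> {..<c}}" using x by auto
      then show "x \<in> fst ` {z \<in> topspace (prod_topology X Y). f z \<in> {..<c}}" by force
    next
      fix x assume "x \<in> fst ` {z \<in> topspace (prod_topology X Y). f z \<in> {..<c}}"
      then obtain y where y: "x \<in> topspace X" "y \<in> topspace Y" "f (x, y) < c" by auto
      then show "x \<in> {x \<in> topspace X. ?I x < c}" using att[OF y(1)] by force
    qed
    also have "openin X \<dots>"
      using open_map_fst[of X Y] openin_continuous_map_preimage[OF f, of "{..<c}"]
      by (simp add: open_map_def)
    finally show ?thesis .
  qed
  ultimately show ?thesis
    by (simp add: continuous_map_upper_lower_semicontinuous_lt)
qed

text \<open>Let \<open>\<tau> (x, b)\<close> move a point \<open>x\<close> of the total space into the fibre over \<open>b\<close> whenever \<open>b\<close> is close to the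
  projection of \<open>x\<close>, where closeness means \<open>N > 0\<close>. A path is lifted by cutting it into steps whose ends
  stay close and transporting along each. The width \<open>h\<close> of the steps is a continuous function on \<open>A\<close>, and
  the lift is continuous although the number of steps jumps, because a step of length zero is the identity.
  For the same reason constant paths lift to constant paths.\<close>

lemma lift_by_short_transports:
  fixes F :: "'a \<times> real \<Rightarrow> 'b" and N :: "'b \<times> 'b \<Rightarrow> real"
  assumes p: "continuous_map E B p"
    and N: "continuous_map (prod_topology B B) euclideanreal N" "\<And>b. b \<in> topspace B \<Longrightarrow> N (b, b) > 0"
    and \<tau>: "continuous_map (subtopology (prod_topology E B) {(x, b). N (p x, b) > 0}) E \<tau>"
    and p\<tau>: "\<And>x b. x \<in> topspace E \<Longrightarrow> b \<in> topspace B \<Longrightarrow> N (p x, b) > 0 \<Longrightarrow> p (\<tau> (x, b)) = b"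
    and \<tau>p: "\<And>x. x \<in> topspace E \<Longrightarrow> \<tau> (x, p x) = x"
    and F: "continuous_map (prod_topology A unit_top) B F"
    and f0: "continuous_map A E f0" "\<And>a. a \<in> topspace A \<Longrightarrow> p (f0 a) = F (a, 0)"
  obtains H where "continuous_map (prod_topology A unit_top) E H"
    "\<And>a t. a \<in> topspace A \<Longrightarrow> t \<in> {0..1} \<Longrightarrow> p (H (a, t)) = F (a, t)"
    "\<And>a. a \<in> topspace A \<Longrightarrow> H (a, 0) = f0 a"
    "\<And>a t. a \<in> topspace A \<Longrightarrow> (\<And>s. s \<in> {0..1} \<Longrightarrow> F (a, s) = F (a, 0)) \<Longrightarrow> t \<in> {0..1} \<Longrightarrow> H (a, t) = f0 a"
proof -
  let ?AI = "prod_topology A unit_top"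
  let ?II = "prod_topology unit_top unit_top"
  \<comment> \<open>If \<open>F (a, s)\<close> and \<open>F (a, t)\<close> are not close then \<open>\<psi> (a, s, t) = \<bar>s - t\<bar>\<close>; so parameters nearer than the minimum \<open>\<phi> a\<close>
      have close values, and \<open>\<phi> a > 0\<close> as the first summand vanishes only where the second does not.\<close>
  define \<psi> where "\<psi> z = \<bar>fst (snd z) - snd (snd z)\<bar> + max 0 (N (F (fst z, fst (snd z)), F (fst z, snd (snd z))))"
    for z :: "'a \<times> real \<times> real"
  define \<phi> where "\<phi> a = Inf ((\<lambda>y. \<psi> (a, y)) ` topspace ?II)" for a
  define h where "h a = \<phi> a / 2" for a
  have cf: "continuous_map (prod_topology A ?II) A fst" by (rule continuous_map_fst)
  have cs: "continuous_map (prod_topology A ?II) unit_top (\<lambda>z. fst (snd z))"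
           "continuous_map (prod_topology A ?II) unit_top (\<lambda>z. snd (snd z))"
    using continuous_map_compose[OF continuous_map_snd[of A ?II] continuous_map_fst]
          continuous_map_compose[OF continuous_map_snd[of A ?II] continuous_map_snd] by (simp_all add: o_def)
  have csr: "continuous_map (prod_topology A ?II) euclideanreal (\<lambda>z. fst (snd z))"
           "continuous_map (prod_topology A ?II) euclideanreal (\<lambda>z. snd (snd z))"
    using cs by (auto simp: continuous_map_in_subtopology)
  have cF: "continuous_map (prod_topology A ?II) B (\<lambda>z. F (fst z, fst (snd z)))"
           "continuous_map (prod_topology A ?II) B (\<lambda>z. F (fst z, snd (snd z)))"
    using continuous_map_compose[OF _ F, of "prod_topology A ?II" "\<lambda>z. (fst z, fst (snd z))"]
          continuous_map_compose[OF _ F, of "prod_topology A ?II" "\<lambda>z. (fst z, snd (snd z))"] cf cs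
    by (simp_all add: o_def continuous_map_paired)
  have cN: "continuous_map (prod_topology A ?II) euclideanreal (\<lambda>z. N (F (fst z, fst (snd z)), F (fst z, snd (snd z))))"
    using continuous_map_compose[OF _ N(1), of "prod_topology A ?II" "\<lambda>z. (F (fst z, fst (snd z)), F (fst z, snd (snd z)))"] cF
    by (simp add: o_def continuous_map_paired)
  have c\<psi>: "continuous_map (prod_topology A ?II) euclideanreal \<psi>"
    unfolding \<psi>_def by (intro continuous_map_add continuous_map_real_abs continuous_map_diff continuous_map_real_max csr cN) auto
  have II: "compact_space ?II" "?II \<noteq> trivial_topology"
    using compact_Times[of "{0..1::real}" "{0..1::real}"]
    by (auto simp: compact_space_subtopology simp flip: null_topspace_iff_trivial)
  have c\<phi>: "continuous_map A euclideanreal \<phi>"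
    unfolding \<phi>_def by (rule continuous_map_Inf_compact[OF c\<psi> II])
  have ch: "continuous_map A euclideanreal h"
    unfolding h_def by (intro continuous_map_real_divide c\<phi>) auto
  have FB: "F (a, t) \<in> topspace B" if "a \<in> topspace A" "t \<in> {0..1}" for a t
    using continuous_map_funspace[OF F] that by auto
  have \<phi>pos: "\<phi> a > 0" if a: "a \<in> topspace A" for a
  proof -
    obtain y where y: "y \<in> topspace ?II" "\<psi> (a, y) = \<phi> a"
      using Inf_attained_compact[OF continuous_map_section[OF c\<psi> a] II] unfolding \<phi>_def by metis
    show ?thesis
    proof (cases "fst y = snd y")
      case True
      then have "N (F (a, fst y), F (a, snd y)) > 0" using N(2) FB[OF a] y(1) by auto
      then show ?thesis using y(2) unfolding \<psi>_def by auto
    next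
      case False
      then have "\<bar>fst y - snd y\<bar> > 0" by simp
      then show ?thesis using y(2) unfolding \<psi>_def by (smt (verit) fst_conv snd_conv)
    qed
  qed
  have hpos: "h a > 0" if "a \<in> topspace A" for a using \<phi>pos[OF that] by (simp add: h_def)
  have close: "N (F (a, s), F (a, t)) > 0"
    if a: "a \<in> topspace A" and st: "s \<in> {0..1}" "t \<in> {0..1}" "\<bar>s - t\<bar> \<le> h a" for a s t
  proof (rule ccontr)
    assume "\<not> N (F (a, s), F (a, t)) > 0"
    then have "\<psi> (a, (s, t)) = \<bar>s - t\<bar>" by (simp add: \<psi>_def)
    moreover have "\<phi> a \<le> \<psi> (a, (s, t))"
      using Inf_attained_compact[OF continuous_map_section[OF c\<psi> a] II] st(1,2) unfolding \<phi>_def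
      by (metis SigmaI topspace_euclidean_subtopology topspace_prod_topology)
    ultimately show False using st(3) \<phi>pos[OF a] by (simp add: h_def)
  qed
  \<comment> \<open>\<open>g k a\<close> is the lift at time \<open>k * h a\<close>, cut off at \<open>1\<close>, and \<open>\<Gamma> k\<close> is the lift up to that time.\<close>
  define g where "g = rec_nat f0 (\<lambda>k gk a. \<tau> (gk a, F (a, min 1 (real (Suc k) * h a))))"
  have g0: "g 0 = f0" and gS: "\<And>k a. g (Suc k) a = \<tau> (g k a, F (a, min 1 (real (Suc k) * h a)))"
    by (simp_all add: g_def)
  have mm: "min 1 (real k * h a) \<in> {0..1}" if "a \<in> topspace A" for k a
    using hpos[OF that] by (auto simp: min_def)
  have pg: "continuous_map A E (g k) \<and> (\<forall>a\<in>topspace A. p (g k a) = F (a, min 1 (real k * h a)))" for k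
  proof (induction k)
    case 0 then show ?case using f0 by (simp add: g0)
  next
    case (Suc k)
    have N': "N (p (g k a), F (a, min 1 (real (Suc k) * h a))) > 0" if a: "a \<in> topspace A" for a
    proof -
      have "p (g k a) = F (a, min 1 (real k * h a))" using Suc a by blast
      moreover have "\<bar>min 1 (real k * h a) - min 1 (real (Suc k) * h a)\<bar> \<le> h a"
        using hpos[OF a] by (auto simp: min_def algebra_simps)
      ultimately show ?thesis using close[OF a mm[OF a, of k] mm[OF a, of "Suc k"]] by simp
    qed
    have "continuous_map A unit_top (\<lambda>a. min 1 (real (Suc k) * h a))"
      by (rule continuous_map_unit_topI) (use mm[of _ "Suc k"] ch in \<open>auto intro!: continuous_map_real_min continuous_map_real_mult\<close>)
    then have "continuous_map A ?AI (\<lambda>a. (a, min 1 (real (Suc k) * h a)))"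
      by (simp add: continuous_map_paired)
    from continuous_map_compose[OF this F]
    have cF': "continuous_map A B (\<lambda>a. F (a, min 1 (real (Suc k) * h a)))" by (simp add: o_def)
    have "continuous_map A (subtopology (prod_topology E B) {(x, b). N (p x, b) > 0})
        (\<lambda>a. (g k a, F (a, min 1 (real (Suc k) * h a))))"
      using Suc N' cF' by (auto simp: continuous_map_in_subtopology continuous_map_paired)
    from continuous_map_compose[OF this \<tau>] have c: "continuous_map A E (g (Suc k))"
      unfolding gS o_def by simp
    have "p (g (Suc k) a) = F (a, min 1 (real (Suc k) * h a))" if a: "a \<in> topspace A" for a
      unfolding gS using Suc a continuous_map_funspace[of A E "g k"] FB[OF a mm[OF a, of "Suc k"]]
      by (intro p\<tau> N') auto
    then show ?case using c by blast
  qed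
  have gE: "g k a \<in> topspace E" if "a \<in> topspace A" for k a
    using pg continuous_map_funspace that by blast
  define \<Gamma> where "\<Gamma> = rec_nat (\<lambda>x. f0 (fst x)) (\<lambda>k \<Gamma>k x. if snd x \<le> real k * h (fst x) then \<Gamma>k x else \<tau> (g k (fst x), F x))"
  have \<Gamma>0: "\<Gamma> 0 x = f0 (fst x)"
    and \<Gamma>S: "\<Gamma> (Suc k) x = (if snd x \<le> real k * h (fst x) then \<Gamma> k x else \<tau> (g k (fst x), F x))" for k x
    by (simp_all add: \<Gamma>_def)
  have \<Gamma>g: "\<Gamma> k (a, t) = g k a" if a: "a \<in> topspace A" and t: "t \<in> {0..1}" "t = real k * h a" for k a t
  proof (cases k)
    case 0 then show ?thesis by (simp add: \<Gamma>0 g0)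
  next
    case (Suc j)
    then have "\<not> t \<le> real j * h a" using t(2) hpos[OF a] by (simp add: algebra_simps)
    moreover have "min 1 (real (Suc j) * h a) = t" using t Suc by auto
    ultimately show ?thesis by (simp only: Suc \<Gamma>S gS fst_conv snd_conv if_False)
  qed
  have ct: "continuous_map ?AI euclideanreal snd"
    using continuous_map_snd[of A unit_top] by (simp add: continuous_map_in_subtopology)
  have chf: "continuous_map ?AI euclideanreal (\<lambda>x. real k * h (fst x))" for k
    using continuous_map_compose[OF continuous_map_fst[of A unit_top] ch]
    by (intro continuous_map_real_mult) (auto simp: o_def)
  have step: "N (p (g k (fst x)), F x) > 0"
    if x: "x \<in> topspace ?AI" "real k * h (fst x) \<le> snd x" "snd x \<le> real (Suc k) * h (fst x)" for k x
  proof -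
    have a: "fst x \<in> topspace A" "snd x \<in> {0..1}" using x(1) by auto
    then have "min 1 (real k * h (fst x)) = real k * h (fst x)" using x(2) by auto
    then have "p (g k (fst x)) = F (fst x, real k * h (fst x))" using pg[of k] a by auto
    moreover have "real k * h (fst x) \<in> {0..1}" using a x(2) hpos[OF a(1)] by auto
    ultimately show ?thesis using close[OF a(1) _ a(2)] x(2,3) by (simp add: algebra_simps)
  qed
  have c\<Gamma>: "continuous_map (subtopology ?AI {x. snd x \<le> real k * h (fst x)}) E (\<Gamma> k) \<and>
       (\<forall>x\<in>topspace ?AI. snd x \<le> real k * h (fst x) \<longrightarrow> p (\<Gamma> k x) = F x)" for k
  proof (induction k)
    case 0
    have "continuous_map ?AI E (\<lambda>x. f0 (fst x))"
      using continuous_map_compose[OF continuous_map_fst f0(1)] by (simp add: o_def)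
    moreover have "\<Gamma> 0 = (\<lambda>x. f0 (fst x))" by (simp add: \<Gamma>0 fun_eq_iff)
    ultimately show ?case
      using f0(2) by (auto intro: continuous_map_from_subtopology)
  next
    case (Suc k)
    let ?X = "subtopology ?AI {x. snd x \<le> real (Suc k) * h (fst x)}"
    have "continuous_map ?X E (\<lambda>x. if snd x \<le> real k * h (fst x) then \<Gamma> k x else \<tau> (g k (fst x), F x))"
    proof (rule continuous_map_cases_le)
      show "continuous_map (subtopology ?X {x \<in> topspace ?X. snd x \<le> real k * h (fst x)}) E (\<Gamma> k)"
        unfolding subtopology_subtopology
        by (rule continuous_map_from_subtopology_mono[OF conjunct1[OF Suc]]) auto
      let ?X' = "subtopology ?X {x \<in> topspace ?X. real k * h (fst x) \<le> snd x}"
      have "continuous_map ?X' (subtopology (prod_topology E B) {(x, b). N (p x, b) > 0}) (\<lambda>x. (g k (fst x), F x))"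
        unfolding continuous_map_in_subtopology continuous_map_paired
      proof (intro conjI)
        show "continuous_map ?X' E (\<lambda>x. g k (fst x))"
          using continuous_map_compose[OF continuous_map_fst conjunct1[OF pg[of k]], of unit_top]
          by (intro continuous_map_from_subtopology) (simp add: o_def)
        show "continuous_map ?X' B F" by (intro continuous_map_from_subtopology F)
        show "(\<lambda>x. (g k (fst x), F x)) \<in> topspace ?X' \<rightarrow> {(x, b). N (p x, b) > 0}"
          using step[of _ k] by auto
      qed
      from continuous_map_compose[OF this \<tau>] show "continuous_map ?X' E (\<lambda>x. \<tau> (g k (fst x), F x))"
        by (simp add: o_def)
      show "\<Gamma> k x = \<tau> (g k (fst x), F x)" if x: "x \<in> topspace ?X" "snd x = real k * h (fst x)" for x
      proof -
        have a: "fst x \<in> topspace A" "snd x \<in> {0..1}" using x(1) by auto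
        have "\<Gamma> k x = g k (fst x)" using \<Gamma>g[OF a(1,2) x(2)] by simp
        moreover have "F x = p (g k (fst x))" using pg[of k] a x(2) by (cases x) (auto simp: min_def)
        ultimately show ?thesis using \<tau>p[OF gE[OF a(1)]] by simp
      qed
    qed (intro continuous_map_from_subtopology ct chf)+
    moreover have "p (\<Gamma> (Suc k) x) = F x" if x: "x \<in> topspace ?AI" "snd x \<le> real (Suc k) * h (fst x)" for x
    proof (cases "snd x \<le> real k * h (fst x)")
      case True then show ?thesis using Suc x by (cases x) (auto simp: \<Gamma>S)
    next
      case False
      have a: "fst x \<in> topspace A" "snd x \<in> {0..1}" using x(1) by auto
      have "p (\<tau> (g k (fst x), F x)) = F x"
        using step[OF x(1) _ x(2)] False FB[OF a] by (intro p\<tau> gE a) auto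
      then show ?thesis using False by (simp add: \<Gamma>S)
    qed
    ultimately show ?case by (simp add: \<Gamma>S [abs_def])
  qed
  have \<Gamma>const: "\<Gamma> k (a, t) = \<Gamma> j (a, t)" if "a \<in> topspace A" "t \<le> real j * h a" "j \<le> k" for k j a t
    using that(3)
  proof (induction k rule: dec_induct)
    case (step i)
    have "real j * h a \<le> real i * h a" using step(1) hpos[OF that(1)] by (intro mult_right_mono) auto
    then show ?case using step(3) that(2) by (simp add: \<Gamma>S)
  qed simp
  define H where "H x = \<Gamma> (LEAST k. snd x \<le> real k * h (fst x)) x" for x
  have ex: "\<exists>k. t < real k * h a" if "a \<in> topspace A" for a t
    using reals_Archimedean3[OF hpos[OF that]] by auto
  have H\<Gamma>: "H (a, t) = \<Gamma> k (a, t)" if "a \<in> topspace A" "t \<le> real k * h a" for a t k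
  proof -
    have "t \<le> real (LEAST k. t \<le> real k * h a) * h a" "(LEAST k. t \<le> real k * h a) \<le> k"
      using that(2) by (rule LeastI, rule Least_le)
    then show ?thesis
      unfolding H_def using \<Gamma>const[OF that(1), of t "LEAST k. t \<le> real k * h a" k] by simp
  qed
  show ?thesis
  proof (rule that)
    show "continuous_map ?AI E H"
    proof (rule pasting_lemma[of UNIV ?AI "\<lambda>k. {x \<in> topspace ?AI. snd x < real k * h (fst x)}" E \<Gamma>])
      show "openin ?AI {x \<in> topspace ?AI. snd x < real k * h (fst x)}" for k
        using openin_continuous_map_preimage[OF continuous_map_diff[OF chf[of k] ct], of "{0<..}"] by simp
      show "continuous_map (subtopology ?AI {x \<in> topspace ?AI. snd x < real k * h (fst x)}) E (\<Gamma> k)" for k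
        by (rule continuous_map_from_subtopology_mono[OF conjunct1[OF c\<Gamma>]]) auto
      show "\<Gamma> i x = \<Gamma> j x" if "x \<in> topspace ?AI \<inter> {x \<in> topspace ?AI. snd x < real i * h (fst x)} \<inter>
           {x \<in> topspace ?AI. snd x < real j * h (fst x)}" for i j x
      proof -
        have "H x = \<Gamma> i x" "H x = \<Gamma> j x"
          using that H\<Gamma>[of "fst x" "snd x" i] H\<Gamma>[of "fst x" "snd x" j] by auto
        then show ?thesis by simp
      qed
      show "\<exists>j. j \<in> UNIV \<and> x \<in> {x \<in> topspace ?AI. snd x < real j * h (fst x)} \<and> H x = \<Gamma> j x"
        if "x \<in> topspace ?AI" for x
        using that ex[of "fst x" "snd x"] H\<Gamma>[of "fst x" "snd x"] by fastforce
    qed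
    show "p (H (a, t)) = F (a, t)" if "a \<in> topspace A" "t \<in> {0..1}" for a t
    proof -
      obtain k where k: "t < real k * h a" using ex[OF \<open>a \<in> topspace A\<close>] by blast
      then show ?thesis using c\<Gamma>[of k] that H\<Gamma>[of a t k] by auto
    qed
    show "H (a, 0) = f0 a" if "a \<in> topspace A" for a
      using H\<Gamma>[OF that, of 0 0] by (simp add: \<Gamma>0)
    show "H (a, t) = f0 a" if a: "a \<in> topspace A" and c: "\<And>s. s \<in> {0..1} \<Longrightarrow> F (a, s) = F (a, 0)" and t: "t \<in> {0..1}" for a t
    proof -
      have g: "g k a = f0 a" for k
      proof (induction k)
        case (Suc k)
        have "F (a, min 1 (real (Suc k) * h a)) = p (f0 a)" using c[OF mm[OF a, of "Suc k"]] f0(2)[OF a] by simp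
        then show ?case using Suc \<tau>p[OF gE[OF a, of 0]] by (simp only: gS g0)
      qed (simp add: g0)
      have "\<Gamma> k (a, t) = f0 a" for k
      proof (induction k)
        case (Suc k)
        have "F (a, t) = p (f0 a)" using c[OF t] f0(2)[OF a] by simp
        then show ?case using Suc \<tau>p[OF gE[OF a, of 0]] by (simp add: \<Gamma>S g g0)
      qed (simp add: \<Gamma>0)
      then show ?thesis by (simp add: H_def)
    qed
  qed
qed

section \<open>Angles of paths in the circle\<close>

abbreviation circle_top :: "complex topology" where
  "circle_top \<equiv> top_of_set (sphere 0 1)"

text \<open>The line covers the circle; a real number is transported to a nearby point of the circle by adding the
  principal argument of the quotient.\<close>

lemma lift_circle:
  assumes F: "continuous_map (prod_topology A unit_top) circle_top F"
    and f0: "continuous_map A euclideanreal f0" "\<And>a. a \<in> topspace A \<Longrightarrow> F (a, 0) = cis (f0 a)"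
  shows "\<exists>\<theta>. continuous_map (prod_topology A unit_top) euclideanreal \<theta> \<and>
    (\<forall>a\<in>topspace A. \<forall>t\<in>{0..1}. F (a, t) = cis (\<theta> (a, t))) \<and>
    (\<forall>a\<in>topspace A. \<theta> (a, 0) = f0 a) \<and>
    (\<forall>a\<in>topspace A. (\<forall>s\<in>{0..1}. F (a, s) = F (a, 0)) \<longrightarrow> (\<forall>t\<in>{0..1}. \<theta> (a, t) = f0 a))"
proof -
  let ?N = "\<lambda>(b, b'). Re (b' * cnj b)"
  let ?\<tau> = "\<lambda>(x, b). x + Arg (b * cis (- x))"
  have Re: "Re (b * cis (- x)) = ?N (cis x, b)" for x b
    by (simp add: cis_cnj)
  show ?thesis
  proof (rule lift_by_short_transports[of euclideanreal circle_top cis ?N ?\<tau> A F f0])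
    show "continuous_map euclideanreal circle_top cis"
      by (auto simp: continuous_map_in_subtopology intro!: continuous_intros)
    have "continuous_on (sphere 0 1 \<times> sphere 0 1) ?N"
      unfolding split_def by (intro continuous_intros)
    then show "continuous_map (prod_topology circle_top circle_top) euclideanreal ?N"
      by simp
    show "0 < ?N (b, b)" if "b \<in> topspace circle_top" for b
    proof -
      have "b * cnj b = of_real ((norm b)\<^sup>2)" by (rule complex_norm_square[symmetric])
      then have "?N (b, b) = (norm b)\<^sup>2" by (simp only: split_conv Re_complex_of_real)
      moreover have "norm b = 1" using that by simp
      ultimately show ?thesis by (simp only: power_one)
    qed
    have "continuous_on {(x, b). Re (b * cis (- x)) > 0} ?\<tau>"
      unfolding split_def
      by (intro continuous_intros continuous_on_compose2[OF continuous_on_Arg])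
         (auto simp: complex_nonpos_Reals_iff)
    then have "continuous_on ((UNIV \<times> sphere 0 1) \<inter> {(x, b). Re (b * cis (- x)) > 0}) ?\<tau>"
      by (rule continuous_on_subset) auto
    then have *: "continuous_on ((UNIV \<times> sphere 0 1) \<inter> {(x, b). ?N (cis x, b) > 0}) ?\<tau>"
      by (simp only: Re)
    show "continuous_map (subtopology (prod_topology euclideanreal circle_top) {(x, b). 0 < ?N (cis x, b)}) euclideanreal ?\<tau>"
    proof -
      have "prod_topology euclideanreal circle_top = top_of_set (UNIV \<times> sphere 0 1)"
        by (metis prod_topology_subtopology_eu subtopology_UNIV)
      with * show ?thesis by (simp only: subtopology_subtopology continuous_map_iff_continuous)
    qed
  next
    fix x b
    assume "b \<in> topspace circle_top"
    then have b: "norm b = 1" by simp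
    show "cis (?\<tau> (x, b)) = b"
    proof -
      have n: "norm (b * cis (- x)) = 1" using b by (simp add: norm_mult)
      then have "b * cis (- x) \<noteq> 0" by force
      then have "cis (Arg (b * cis (- x))) = b * cis (- x)"
        using n by (simp add: cis_Arg sgn_div_norm)
      then have "cis (?\<tau> (x, b)) = cis x * (b * cis (- x))"
        by (simp only: split_conv cis_mult[symmetric])
      also have "\<dots> = b * cis (x + - x)" by (simp only: cis_mult[symmetric] mult_ac)
      finally show ?thesis by simp
    qed
  next
    show "?\<tau> (x, cis x) = x" for x by (simp add: cis_mult)
  next
    fix H assume H: "continuous_map (prod_topology A unit_top) euclideanreal H"
      "\<And>a t. a \<in> topspace A \<Longrightarrow> t \<in> {0..1} \<Longrightarrow> cis (H (a, t)) = F (a, t)"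
      "\<And>a. a \<in> topspace A \<Longrightarrow> H (a, 0) = f0 a"
      "\<And>a t. a \<in> topspace A \<Longrightarrow> (\<And>s. s \<in> {0..1} \<Longrightarrow> F (a, s) = F (a, 0)) \<Longrightarrow> t \<in> {0..1} \<Longrightarrow> H (a, t) = f0 a"
    show ?thesis
      using H(2,3,4) by (intro exI[of _ H] conjI H(1) ballI impI) (simp_all only:)
  next
    show "cis (f0 a) = F (a, 0)" if "a \<in> topspace A" for a using f0(2)[OF that] by (rule sym)
  qed (fact F f0(1))+
qed

text \<open>The net change of the argument along a path. The lift exists for paths in the circle and is unique up to
  a constant, so that the description determines a number; for a closed path it is \<open>2 * pi\<close> times the winding
  number.\<close>

definition angle :: "(real \<Rightarrow> complex) \<Rightarrow> real" where
  "angle c = (THE a. \<exists>\<theta>. continuous_on {0..1} \<theta> \<and> (\<forall>t\<in>{0..1}. c t = cis (\<theta> t)) \<and> a = \<theta> 1 - \<theta> 0)"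

lemma cis_eq_1_imp: "cis x = 1 \<Longrightarrow> \<exists>k::int. x = 2 * pi * k"
  by (metis Re_complex_of_real cis.sel(1) cos_one_2pi_int mult.assoc mult.commute one_complex.sel(1))

text \<open>The values are integer multiples of \<open>2 * pi\<close>, hence a discrete set.\<close>

lemma continuous_on_cis_eq_1:
  assumes "continuous_on {0..1} d" "\<And>t. t \<in> {0..1::real} \<Longrightarrow> cis (d t) = 1"
  shows "d 1 = d 0"
proof -
  have "d constant_on {0..1}"
  proof (rule continuous_discrete_range_constant[OF _ assms(1)])
    fix x :: real assume x: "x \<in> {0..1}"
    show "\<exists>e>0. \<forall>y. y \<in> {0..1} \<and> d y \<noteq> d x \<longrightarrow> e \<le> norm (d y - d x)"
    proof (intro exI[of _ "2 * pi"] conjI allI impI)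
      fix y :: real assume y: "y \<in> {0..1} \<and> d y \<noteq> d x"
      obtain j k :: int where jk: "d x = 2 * pi * j" "d y = 2 * pi * k"
        using cis_eq_1_imp[OF assms(2)[OF x]] cis_eq_1_imp[OF assms(2), of y] y by blast
      then have "k \<noteq> j" using y by metis
      then have "\<bar>k - j\<bar> \<ge> 1" by linarith
      then have "\<bar>real_of_int k - real_of_int j\<bar> \<ge> 1" by linarith
      moreover have "norm (d y - d x) = 2 * pi * \<bar>real_of_int k - real_of_int j\<bar>"
      proof -
        have "d y - d x = 2 * pi * (real_of_int k - real_of_int j)"
          unfolding jk by (rule right_diff_distrib[symmetric])
        then show ?thesis by (simp only: real_norm_def abs_mult) simp
      qed
      ultimately show "2 * pi \<le> norm (d y - d x)" by simp
    qed simp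
  qed simp
  then show ?thesis by (metis atLeastAtMost_iff constant_on_def order_refl zero_le_one)
qed

lemma angle_eqI:
  assumes "continuous_on {0..1} \<theta>" "\<And>t. t \<in> {0..1} \<Longrightarrow> c t = cis (\<theta> t)"
  shows "angle c = \<theta> 1 - \<theta> 0"
  unfolding angle_def
proof (rule the_equality)
  show "\<exists>\<theta>'. continuous_on {0..1} \<theta>' \<and> (\<forall>t\<in>{0..1}. c t = cis (\<theta>' t)) \<and> \<theta> 1 - \<theta> 0 = \<theta>' 1 - \<theta>' 0"
    using assms by blast
  fix a assume "\<exists>\<theta>'. continuous_on {0..1} \<theta>' \<and> (\<forall>t\<in>{0..1}. c t = cis (\<theta>' t)) \<and> a = \<theta>' 1 - \<theta>' 0"
  then obtain \<theta>' where \<theta>': "continuous_on {0..1} \<theta>'" "\<And>t. t \<in> {0..1} \<Longrightarrow> c t = cis (\<theta>' t)" "a = \<theta>' 1 - \<theta>' 0"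
    by blast
  have "(\<lambda>t. \<theta> t - \<theta>' t) 1 = (\<lambda>t. \<theta> t - \<theta>' t) 0"
  proof (rule continuous_on_cis_eq_1)
    show "continuous_on {0..1} (\<lambda>t. \<theta> t - \<theta>' t)" by (intro continuous_intros assms \<theta>')
    show "cis (\<theta> t - \<theta>' t) = 1" if "t \<in> {0..1}" for t
      using assms(2)[OF that] \<theta>'(2)[OF that] by (metis cis_divide cis_neq_zero divide_self)
  qed
  then show "a = \<theta> 1 - \<theta> 0" using \<theta>'(3) by simp
qed

lemma lift_path_circle:
  assumes c: "continuous_map unit_top circle_top c" and x: "c 0 = cis x"
  shows "\<exists>\<theta>. continuous_on {0..1} \<theta> \<and> (\<forall>t\<in>{0..1}. c t = cis (\<theta> t)) \<and> \<theta> 0 = x \<and> angle c = \<theta> 1 - x"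
proof -
  let ?A = "top_of_set {0::real}"
  have cs: "continuous_map (prod_topology ?A unit_top) circle_top (\<lambda>z. c (snd z))"
    using continuous_map_compose[OF continuous_map_snd c] unfolding o_def .
  have cx: "continuous_map ?A euclideanreal (\<lambda>_. x)" by simp
  have "c (snd (a, 0)) = cis x" for a :: real using x by simp
  then obtain \<theta> where \<theta>: "continuous_map (prod_topology ?A unit_top) euclideanreal \<theta>"
     "\<forall>a\<in>topspace ?A. \<forall>t\<in>{0..1}. c (snd (a, t)) = cis (\<theta> (a, t))" "\<forall>a\<in>topspace ?A. \<theta> (a, 0) = x"
    using lift_circle[OF cs cx] by blast
  define \<eta> where "\<eta> t = \<theta> (0, t)" for t
  have \<eta>: "continuous_on {0..1} \<eta>" "\<forall>t\<in>{0..1}. c t = cis (\<eta> t)" "\<eta> 0 = x"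
    using continuous_map_section[OF \<theta>(1), of 0] \<theta>(2,3) unfolding \<eta>_def by simp_all
  then show ?thesis
    using angle_eqI[OF \<eta>(1), of c] by blast
qed

lemma lift_path_circle':
  assumes c: "continuous_map unit_top circle_top c"
  shows "\<exists>\<theta>. continuous_on {0..1} \<theta> \<and> (\<forall>t\<in>{0..1}. c t = cis (\<theta> t)) \<and> angle c = \<theta> 1 - \<theta> 0"
proof -
  have "norm (c 0) = 1" using continuous_map_funspace[OF c] by auto
  then have "c 0 = cis (Arg (c 0))"
    by (metis cis_Arg div_by_1 norm_zero of_real_1 scaleR_one sgn_div_norm inverse_1 zero_neq_one)
  from lift_path_circle[OF c this] show ?thesis by metis
qed

lemma angle_cong: "(\<And>t. t \<in> {0..1} \<Longrightarrow> c t = d t) \<Longrightarrow> angle c = angle d"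
proof -
  assume cd: "\<And>t. t \<in> {0..1} \<Longrightarrow> c t = d t"
  have "(\<forall>t\<in>{0..1}. c t = cis (\<theta> t)) \<longleftrightarrow> (\<forall>t\<in>{0..1}. d t = cis (\<theta> t))" for \<theta>
    by (intro ball_cong refl) (simp only: cd)
  then show ?thesis unfolding angle_def by (simp only:)
qed

lemma angle_const_one: "angle (\<lambda>_. 1) = 0"
proof -
  have "angle (\<lambda>_. 1) = (\<lambda>_. 0) 1 - (\<lambda>_. 0) 0" by (rule angle_eqI) simp_all
  then show ?thesis by simp
qed

lemma angle_mult:
  assumes "continuous_map unit_top circle_top c" "continuous_map unit_top circle_top d"
  shows "angle (\<lambda>t. c t * d t) = angle c + angle d"
proof -
  obtain \<theta> where \<theta>: "continuous_on {0..1} \<theta>" "\<forall>t\<in>{0..1}. c t = cis (\<theta> t)" "angle c = \<theta> 1 - \<theta> 0"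
    using lift_path_circle'[OF assms(1)] by blast
  obtain \<eta> where \<eta>: "continuous_on {0..1} \<eta>" "\<forall>t\<in>{0..1}. d t = cis (\<eta> t)" "angle d = \<eta> 1 - \<eta> 0"
    using lift_path_circle'[OF assms(2)] by blast
  have "angle (\<lambda>t. c t * d t) = (\<lambda>t. \<theta> t + \<eta> t) 1 - (\<lambda>t. \<theta> t + \<eta> t) 0"
    by (rule angle_eqI) (use \<theta> \<eta> in \<open>auto simp: cis_mult intro!: continuous_intros\<close>)
  then show ?thesis using \<theta>(3) \<eta>(3) by simp
qed

lemma angle_reverse:
  assumes "continuous_map unit_top circle_top c"
  shows "angle (\<lambda>t. c (1 - t)) = - angle c"
proof -
  obtain \<theta> where \<theta>: "continuous_on {0..1} \<theta>" "\<forall>t\<in>{0..1}. c t = cis (\<theta> t)" "angle c = \<theta> 1 - \<theta> 0"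
    using lift_path_circle'[OF assms] by blast
  have "angle (\<lambda>t. c (1 - t)) = (\<lambda>t. \<theta> (1 - t)) 1 - (\<lambda>t. \<theta> (1 - t)) 0"
    by (rule angle_eqI) (use \<theta>(2) in \<open>auto intro!: continuous_intros continuous_on_compose2[OF \<theta>(1)]\<close>)
  then show ?thesis using \<theta>(3) by simp
qed

lemma angle_loop_concat:
  assumes "continuous_map unit_top circle_top c" "continuous_map unit_top circle_top d" "c 1 = d 0"
  shows "angle (loop_concat c d) = angle c + angle d"
proof -
  obtain \<theta> where \<theta>: "continuous_on {0..1} \<theta>" "\<forall>t\<in>{0..1}. c t = cis (\<theta> t)" "angle c = \<theta> 1 - \<theta> 0"
    using lift_path_circle'[OF assms(1)] by blast
  have "d 0 = cis (\<theta> 1)" using assms(3) bspec[OF \<theta>(2), of 1] by simp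
  then obtain \<eta> where \<eta>: "continuous_on {0..1} \<eta>" "\<forall>t\<in>{0..1}. d t = cis (\<eta> t)" "\<eta> 0 = \<theta> 1" "angle d = \<eta> 1 - \<theta> 1"
    using lift_path_circle[OF assms(2)] by blast
  let ?\<zeta> = "\<lambda>t. if t \<le> 1/2 then \<theta> (2 * t) else \<eta> (2 * t - 1)"
  have "continuous_on ({0..1/2} \<union> {1/2..1}) ?\<zeta>"
  proof (rule continuous_on_cases)
    show "continuous_on {0..1/2} (\<lambda>t. \<theta> (2 * t))" "continuous_on {1/2..1} (\<lambda>t. \<eta> (2 * t - 1))"
      by (auto intro!: continuous_intros continuous_on_compose2[OF \<theta>(1)] continuous_on_compose2[OF \<eta>(1)])
    show "\<forall>t. t \<in> {0..1/2} \<and> \<not> t \<le> 1/2 \<or> t \<in> {1/2..1} \<and> t \<le> 1/2 \<longrightarrow> \<theta> (2 * t) = \<eta> (2 * t - 1)"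
    proof (intro allI impI)
      fix t :: real
      assume "t \<in> {0..1/2} \<and> \<not> t \<le> 1/2 \<or> t \<in> {1/2..1} \<and> t \<le> 1/2"
      then have "2 * t = 1" by auto
      then show "\<theta> (2 * t) = \<eta> (2 * t - 1)" using \<eta>(3) by simp
    qed
  qed auto
  moreover have "{0..1/2} \<union> {1/2..1} = {0..1::real}" by auto
  ultimately have "continuous_on {0..1} ?\<zeta>" by simp
  then have "angle (loop_concat c d) = ?\<zeta> 1 - ?\<zeta> 0"
    by (rule angle_eqI) (use \<theta>(2) \<eta>(2) in \<open>auto simp: loop_concat_def\<close>)
  then show ?thesis using \<theta>(3) \<eta>(4) by simp
qed

text \<open>The end points of the paths \<open>u (s, _)\<close> form a loop that contracts along those paths.\<close>

lemma angle_nullhomotopic: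
  assumes u: "continuous_map (prod_topology unit_top unit_top) circle_top u"
    and "\<And>s. s \<in> {0..1} \<Longrightarrow> u (s, 0) = 1"
    and "\<And>t. t \<in> {0..1} \<Longrightarrow> u (0, t) = 1" "\<And>t. t \<in> {0..1} \<Longrightarrow> u (1, t) = 1"
  shows "angle (\<lambda>s. u (s, 1)) = 0"
proof -
  have "\<exists>\<theta>. continuous_map (prod_topology unit_top unit_top) euclideanreal \<theta> \<and>
    (\<forall>a\<in>topspace unit_top. \<forall>t\<in>{0..1}. u (a, t) = cis (\<theta> (a, t))) \<and>
    (\<forall>a\<in>topspace unit_top. \<theta> (a, 0) = 0) \<and>
    (\<forall>a\<in>topspace unit_top. (\<forall>s\<in>{0..1}. u (a, s) = u (a, 0)) \<longrightarrow> (\<forall>t\<in>{0..1}. \<theta> (a, t) = 0))"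
    by (rule lift_circle[OF u, of "\<lambda>_. 0"]) (use assms(2) in simp_all)
  then obtain \<theta> where \<theta>: "continuous_map (prod_topology unit_top unit_top) euclideanreal \<theta>"
    "\<forall>a\<in>topspace unit_top. \<forall>t\<in>{0..1}. u (a, t) = cis (\<theta> (a, t))"
    "\<forall>a\<in>topspace unit_top. (\<forall>s\<in>{0..1}. u (a, s) = u (a, 0)) \<longrightarrow> (\<forall>t\<in>{0..1}. \<theta> (a, t) = 0)"
    by blast
  have "continuous_on {0..1} (\<lambda>s. \<theta> (s, 1))"
    using continuous_map_section2[OF \<theta>(1), of 1] by simp
  then have "angle (\<lambda>s. u (s, 1)) = \<theta> (1, 1) - \<theta> (0, 1)"
    by (rule angle_eqI) (use \<theta>(2) in simp)
  also have "\<dots> = 0" using \<theta>(3) assms(3,4) by simp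
  finally show ?thesis .
qed

lemma angle_closed:
  assumes "continuous_map unit_top circle_top c" "c 0 = c 1"
  obtains k :: int where "angle c = 2 * pi * k"
proof -
  obtain \<theta> where \<theta>: "continuous_on {0..1} \<theta>" "\<forall>t\<in>{0..1}. c t = cis (\<theta> t)" "angle c = \<theta> 1 - \<theta> 0"
    using lift_path_circle'[OF assms(1)] by blast
  have "cis (\<theta> 1 - \<theta> 0) = 1"
    using bspec[OF \<theta>(2), of 0] bspec[OF \<theta>(2), of 1] assms(2) by (simp flip: cis_divide)
  then show ?thesis using cis_eq_1_imp \<theta>(3) that by metis
qed

section \<open>Low-dimensional maps into spheres\<close>

lemma topspace_nsphere_iff: "x \<in> topspace (nsphere m) \<longleftrightarrow> (\<Sum>i\<le>m. x i ^ 2) = 1 \<and> (\<forall>i>m. x i = 0)"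
  unfolding nsphere topspace_subtopology topspace_product_topology topspace_euclidean PiE_UNIV_domain
  by (simp only: Pi_UNIV Int_UNIV_left mem_Collect_eq)

lemma continuous_map_nsphereI:
  assumes "\<And>i. i \<le> m \<Longrightarrow> continuous_map X euclideanreal (\<lambda>x. f x i)" "\<And>x. x \<in> topspace X \<Longrightarrow> f x \<in> topspace (nsphere m)"
  shows "continuous_map X (nsphere m) f"
proof -
  have "continuous_map X euclideanreal (\<lambda>x. f x i)" for i
  proof (cases "i \<le> m")
    case False
    then have "0 = f x i" if "x \<in> topspace X" for x
      using assms(2)[OF that] by (simp add: topspace_nsphere_iff)
    moreover have "continuous_map X euclideanreal (\<lambda>_. 0)" by (rule continuous_map_const[THEN iffD2]) simp
    ultimately show ?thesis using continuous_map_eq[of X euclideanreal "\<lambda>_. 0" "\<lambda>x. f x i"] by blast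
  qed (rule assms(1))
  moreover have "f x \<in> {x. (\<Sum>i\<le>m. (x i)\<^sup>2) = 1 \<and> (\<forall>i>m. x i = 0)}" if "x \<in> topspace X" for x
    using assms(2)[OF that] unfolding topspace_nsphere_iff by simp
  ultimately show ?thesis
    unfolding nsphere continuous_map_in_subtopology continuous_map_componentwise_UNIV by blast
qed

lemma continuous_map_nsphere_component:
  assumes "continuous_map X (nsphere m) f"
  shows "continuous_map X euclideanreal (\<lambda>x. f x i)"
  using continuous_map_compose[OF assms continuous_map_nsphere_projection[of m i]] unfolding o_def .

definition dot :: "nat \<Rightarrow> (nat \<Rightarrow> real) \<Rightarrow> (nat \<Rightarrow> real) \<Rightarrow> real" where
  "dot m x y = (\<Sum>i\<le>m. x i * y i)"

definition normalise :: "nat \<Rightarrow> (nat \<Rightarrow> real) \<Rightarrow> nat \<Rightarrow> real" where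
  "normalise m v = (\<lambda>i. if i \<le> m then v i / sqrt (\<Sum>j\<le>m. v j ^ 2) else 0)"

lemma normalise_in_nsphere:
  assumes "(\<Sum>j\<le>m. v j ^ 2) > 0"
  shows "normalise m v \<in> topspace (nsphere m)"
proof -
  have "(\<Sum>i\<le>m. normalise m v i ^ 2) = (\<Sum>i\<le>m. v i ^ 2 / (\<Sum>j\<le>m. v j ^ 2))"
    using assms by (intro sum.cong) (auto simp: normalise_def power_divide)
  also have "\<dots> = 1" using assms by (simp flip: sum_divide_distrib)
  finally show ?thesis by (simp add: topspace_nsphere_iff normalise_def)
qed

lemma normalise_nsphere: "x \<in> topspace (nsphere m) \<Longrightarrow> normalise m x = x"
proof
  assume x: "x \<in> topspace (nsphere m)"
  show "normalise m x i = x i" for i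
    using x unfolding topspace_nsphere_iff normalise_def by (cases "i \<le> m") simp_all
qed

lemma continuous_map_normalise:
  assumes v: "\<And>i. i \<le> m \<Longrightarrow> continuous_map X euclideanreal (\<lambda>x. v x i)"
    and pos: "\<And>x. x \<in> topspace X \<Longrightarrow> (\<Sum>j\<le>m. v x j ^ 2) > 0"
  shows "continuous_map X (nsphere m) (\<lambda>x. normalise m (v x))"
proof (rule continuous_map_nsphereI)
  fix i assume i: "i \<le> m"
  have "continuous_map X euclideanreal (\<lambda>x. v x i / sqrt (\<Sum>j\<le>m. v x j ^ 2))"
    using pos by (intro continuous_map_real_divide continuous_map_sqrt continuous_map_sum continuous_map_real_pow v i)
      fastforce+
  then show "continuous_map X euclideanreal (\<lambda>x. normalise m (v x) i)"
    using i by (simp add: normalise_def)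
qed (use pos normalise_in_nsphere in blast)

lemma lipschitz_at_polynomial:
  fixes g :: "'a::euclidean_space \<Rightarrow> real"
  assumes "real_polynomial_function g"
  shows "\<exists>d>0. \<exists>B\<ge>0. \<forall>y. norm (y - x) < d \<longrightarrow> \<bar>g y - g x\<bar> \<le> B * norm (y - x)"
proof -
  obtain g' where g': "(g has_derivative g') (at x)"
    using differentiable_at_real_polynomial_function[OF assms, of x UNIV] unfolding differentiable_def by blast
  then have "bounded_linear g'" by (rule has_derivative_bounded_linear)
  then obtain C where C: "C > 0" "\<And>h. norm (g' h) \<le> norm h * C"
    using bounded_linear.pos_bounded by blast
  have "\<forall>e>0. \<exists>d>0. \<forall>y. norm (y - x) < d \<longrightarrow> norm (g y - g x - g' (y - x)) \<le> e * norm (y - x)"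
    using g' unfolding has_derivative_at_alt by blast
  from this[rule_format, OF zero_less_one]
  obtain d where d: "d > 0" "\<And>y. norm (y - x) < d \<Longrightarrow> norm (g y - g x - g' (y - x)) \<le> 1 * norm (y - x)"
    by blast
  have "\<bar>g y - g x\<bar> \<le> (C + 1) * norm (y - x)" if "norm (y - x) < d" for y
    using d(2)[OF that] C(2)[of "y - x"] by (simp add: algebra_simps)
  then show ?thesis using d(1) C(1) by (intro exI[of _ d] conjI exI[of _ "C + 1"]) auto
qed

text \<open>Cutting a polynomial approximation back by the soft threshold \<open>\<lambda>y. y - max (-e) (min e y)\<close> makes it
  vanish where the given function does, while it stays locally Lipschitz.\<close>

lemma lipschitz_approximation:
  fixes f :: "'a::euclidean_space \<Rightarrow> real"
  assumes "compact K" "continuous_on K f" "0 < e"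
  shows "\<exists>g. continuous_on UNIV g \<and> (\<forall>x\<in>K. \<bar>f x - g x\<bar> < 2 * e) \<and> (\<forall>x\<in>K. f x = 0 \<longrightarrow> g x = 0) \<and>
     (\<forall>x. \<exists>d>0. \<exists>B\<ge>0. \<forall>y. norm (y - x) < d \<longrightarrow> \<bar>g y - g x\<bar> \<le> B * norm (y - x))"
proof -
  obtain p where p: "real_polynomial_function p" and fp: "\<And>x. x \<in> K \<Longrightarrow> \<bar>f x - p x\<bar> < e"
    using Stone_Weierstrass_real_polynomial_function[OF assms] by blast
  define g where "g x = p x - max (- e) (min e (p x))" for x
  have "continuous_on UNIV p"
    using p by (simp add: continuous_on_polymonial_function real_polynomial_function_eq)
  then have "continuous_on UNIV g" unfolding g_def by (intro continuous_intros)
  moreover have "\<bar>f x - g x\<bar> < 2 * e" if "x \<in> K" for x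
    using fp[OF that] assms(3) unfolding g_def by (simp add: max_def min_def abs_if split: if_splits)
  moreover have "g x = 0" if "x \<in> K" "f x = 0" for x
    using fp[OF that(1)] that(2) unfolding g_def by (simp add: max_def min_def abs_if split: if_splits)
  moreover have "\<bar>g y - g x\<bar> \<le> \<bar>p y - p x\<bar>" for x y
    using assms(3) unfolding g_def by (simp add: max_def min_def abs_if split: if_splits)
  then have "\<exists>d>0. \<exists>B\<ge>0. \<forall>y. norm (y - x) < d \<longrightarrow> \<bar>g y - g x\<bar> \<le> B * norm (y - x)" for x
    using lipschitz_at_polynomial[OF p, of x] by (meson order_trans)
  ultimately show ?thesis by blast
qed

lemma sqrt_sum_squares_lipschitz:
  fixes v w :: "nat \<Rightarrow> real"
  shows "\<bar>sqrt (\<Sum>j\<le>m. v j ^ 2) - sqrt (\<Sum>j\<le>m. w j ^ 2)\<bar> \<le> (\<Sum>j\<le>m. \<bar>v j - w j\<bar>)"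
proof -
  have tri: "L2_set a {..m} \<le> L2_set b {..m} + (\<Sum>j\<le>m. \<bar>a j - b j\<bar>)" for a b :: "nat \<Rightarrow> real"
  proof -
    have "L2_set a {..m} = L2_set (\<lambda>j. b j + (a j - b j)) {..m}" by simp
    also have "\<dots> \<le> L2_set b {..m} + L2_set (\<lambda>j. a j - b j) {..m}" by (rule L2_set_triangle_ineq)
    also have "L2_set (\<lambda>j. a j - b j) {..m} \<le> (\<Sum>j\<le>m. \<bar>a j - b j\<bar>)" by (rule L2_set_le_sum_abs)
    finally show ?thesis by simp
  qed
  have "(\<Sum>j\<le>m. \<bar>w j - v j\<bar>) = (\<Sum>j\<le>m. \<bar>v j - w j\<bar>)" by (simp add: abs_minus_commute)
  then show ?thesis
    using tri[of v w] tri[of w v] unfolding L2_set_def by linarith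
qed

text \<open>Normalisation is Lipschitz away from the origin; the constant \<open>4\<close> is twice the inverse of the bound \<open>1/2\<close>.\<close>

lemma normalise_lipschitz:
  fixes v w :: "nat \<Rightarrow> real"
  assumes "sqrt (\<Sum>j\<le>m. v j ^ 2) \<ge> 1/2" "sqrt (\<Sum>j\<le>m. w j ^ 2) \<ge> 1/2"
  shows "\<bar>normalise m v i - normalise m w i\<bar> \<le> 4 * (\<Sum>j\<le>m. \<bar>v j - w j\<bar>)"
proof (cases "i \<le> m")
  case False then show ?thesis by (simp add: normalise_def sum_nonneg)
next
  case True
  define a where "a = sqrt (\<Sum>j\<le>m. v j ^ 2)"
  define b where "b = sqrt (\<Sum>j\<le>m. w j ^ 2)"
  define S where "S = (\<Sum>j\<le>m. \<bar>v j - w j\<bar>)"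
  have a: "a \<ge> 1/2" and b: "b \<ge> 1/2" using assms unfolding a_def b_def by this
  then have a0: "a > 0" and b0: "b > 0" by linarith+
  have ab: "\<bar>a - b\<bar> \<le> S" unfolding a_def b_def S_def by (rule sqrt_sum_squares_lipschitz)
  have S0: "S \<ge> 0" unfolding S_def by (simp add: sum_nonneg)
  have vw: "\<bar>v i - w i\<bar> \<le> S"
    unfolding S_def by (rule member_le_sum[of i "{..m}" "\<lambda>j. \<bar>v j - w j\<bar>"]) (use True in auto)
  have "\<bar>w i\<bar> = sqrt (w i ^ 2)" by simp
  also have "\<dots> \<le> b"
    unfolding b_def by (intro real_sqrt_le_mono member_le_sum) (use True in auto)
  finally have wb: "\<bar>w i / b\<bar> \<le> 1" using b0 by (simp add: abs_divide)
  have "normalise m v i - normalise m w i = v i / a - w i / b"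
    using True by (simp add: normalise_def a_def b_def)
  also have "\<dots> = (v i - w i) / a + (w i / b) * ((b - a) / a)"
    using a0 b0 by (simp add: field_simps)
  also have "\<bar>\<dots>\<bar> \<le> \<bar>(v i - w i) / a\<bar> + \<bar>w i / b\<bar> * \<bar>(b - a) / a\<bar>"
    by (metis abs_mult abs_triangle_ineq)
  also have "\<dots> \<le> \<bar>(v i - w i) / a\<bar> + \<bar>(b - a) / a\<bar>"
    using mult_right_mono[OF wb, of "\<bar>(b - a) / a\<bar>"] by simp
  also have "\<dots> \<le> 2 * S + 2 * S"
  proof (rule add_mono)
    have q: "\<bar>t / a\<bar> \<le> 2 * S" if "\<bar>t\<bar> \<le> S" for t
    proof -
      have "\<bar>t / a\<bar> = \<bar>t\<bar> / a" using a0 by (simp add: abs_divide)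
      also have "\<dots> \<le> S / (1/2)" using that a S0 by (intro frac_le) auto
      finally show ?thesis by simp
    qed
    show "\<bar>(v i - w i) / a\<bar> \<le> 2 * S" by (rule q[OF vw])
    show "\<bar>(b - a) / a\<bar> \<le> 2 * S" by (rule q) (use ab in linarith)
  qed
  finally show ?thesis by (simp add: S_def)
qed

text \<open>In its first \<open>DIM('a) + 1\<close> coordinates the image of a locally Lipschitz map is a null set, while the
  sphere projects onto a ball.\<close>

lemma lipschitz_misses_point:
  fixes h :: "'a::euclidean_space \<Rightarrow> nat \<Rightarrow> real"
  assumes dim: "DIM('a) < m"
    and lip: "\<And>x. x \<in> K \<Longrightarrow> \<exists>d>0. \<exists>B\<ge>0. \<forall>y\<in>K. \<forall>i. norm (y - x) < d \<longrightarrow> \<bar>h y i - h x i\<bar> \<le> B * norm (y - x)"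
  shows "\<exists>z\<in>topspace (nsphere m). z \<noteq> e \<and> z \<notin> h ` K"
proof (rule ccontr)
  assume "\<not> ?thesis"
  then have sub: "topspace (nsphere m) \<subseteq> insert e (h ` K)" by blast
  let ?d = "DIM('a \<times> real)"
  have dm: "?d \<le> m" using dim by simp
  obtain b where b: "bij_betw b {..<?d} (Basis :: ('a \<times> real) set)"
    using ex_bij_betw_nat_finite[of "Basis :: ('a \<times> real) set"] by (auto simp: atLeast0LessThan)
  have bB: "b i \<in> Basis" if "i < ?d" for i using b that by (auto simp: bij_betw_def)
  define \<phi> where "\<phi> x = (\<Sum>i<?d. x i *\<^sub>R b i)" for x :: "nat \<Rightarrow> real"
  let ?S = "K \<times> {0::real}"
  \<comment> \<open>Adding a zero coordinate makes the domain a null set of the same dimension as the target.\<close>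
  have "negligible {x :: 'a \<times> real. (0, 1) \<bullet> x = 0}" by (rule negligible_hyperplane) (simp add: zero_prod_def)
  then have negS: "negligible ?S" by (rule negligible_subset) auto
  have "negligible ((\<lambda>x. \<phi> (h (fst x))) ` ?S)"
  proof (rule negligible_locally_Lipschitz_image[OF order_refl negS])
    fix x :: "'a \<times> real" assume x: "x \<in> ?S"
    then obtain d B where d: "d > 0" "B \<ge> 0" and B: "\<And>y i. y \<in> K \<Longrightarrow> norm (y - fst x) < d \<Longrightarrow> \<bar>h y i - h (fst x) i\<bar> \<le> B * norm (y - fst x)"
      using lip[of "fst x"] by (metis mem_Times_iff)
    have "norm (\<phi> (h (fst y)) - \<phi> (h (fst x))) \<le> (?d * B) * norm (y - x)" if y: "y \<in> ?S \<inter> ball x d" for y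
    proof -
      have ny: "norm (fst y - fst x) \<le> norm (y - x)"
        using norm_fst_le[of "fst (y - x)" "snd (y - x)"] by (metis fst_diff prod.collapse)
      then have "norm (fst y - fst x) < d" using y by (auto simp: dist_norm norm_minus_commute)
      then have *: "\<bar>h (fst y) i - h (fst x) i\<bar> \<le> B * norm (y - x)" for i
      proof -
        have "fst y \<in> K" using y by (auto simp: mem_Times_iff)
        from B[OF this \<open>norm (fst y - fst x) < d\<close>, of i] mult_left_mono[OF ny d(2)]
        show ?thesis by (rule order_trans)
      qed
      have "norm (\<phi> (h (fst y)) - \<phi> (h (fst x))) = norm (\<Sum>i<?d. (h (fst y) i - h (fst x) i) *\<^sub>R b i)"
        by (simp add: \<phi>_def scaleR_diff_left sum_subtractf)
      also have "\<dots> \<le> (\<Sum>i<?d. norm ((h (fst y) i - h (fst x) i) *\<^sub>R b i))" by (rule norm_sum)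
      also have "\<dots> \<le> (\<Sum>i<?d. B * norm (y - x))"
        by (rule sum_mono) (use * bB in \<open>simp add: lessThan_iff\<close>)
      finally show ?thesis by simp
    qed
    then show "\<exists>T B. open T \<and> x \<in> T \<and> (\<forall>y\<in>?S \<inter> T. norm (\<phi> (h (fst y)) - \<phi> (h (fst x))) \<le> B * norm (y - x))"
      using d(1) by (intro exI[of _ "ball x d"] exI[of _ "?d * B"]) auto
  qed
  then have neg: "negligible (insert (\<phi> e) ((\<lambda>x. \<phi> (h (fst x))) ` ?S))" by simp
  have "ball 0 1 \<subseteq> insert (\<phi> e) ((\<lambda>x. \<phi> (h (fst x))) ` ?S)"
  proof
    fix y :: "'a \<times> real" assume "y \<in> ball 0 1"
    then have y: "norm y < 1" by simp
    define z where "z i = (if i < ?d then y \<bullet> b i else if i = m then sqrt (1 - norm y ^ 2) else 0)" for i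
    have "y = (\<Sum>u\<in>Basis. (y \<bullet> u) *\<^sub>R u)" by (simp add: euclidean_representation)
    also have "\<dots> = (\<Sum>i<?d. (y \<bullet> b i) *\<^sub>R b i)" by (rule sum.reindex_bij_betw[OF b, symmetric])
    also have "\<dots> = \<phi> z" unfolding \<phi>_def by (rule sum.cong) (auto simp: z_def)
    finally have yz: "y = \<phi> z" .
    have "(\<Sum>i<?d. (y \<bullet> b i)\<^sup>2) = (\<Sum>u\<in>Basis. (y \<bullet> u)\<^sup>2)" by (rule sum.reindex_bij_betw[OF b])
    also have "\<dots> = y \<bullet> y" unfolding power2_eq_square by (rule euclidean_inner[symmetric])
    also have "\<dots> = norm y ^ 2" by (rule power2_norm_eq_inner[symmetric])
    finally have ny: "(\<Sum>i<?d. (y \<bullet> b i)\<^sup>2) = norm y ^ 2" .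
    have "norm y ^ 2 \<le> 1" using y by (simp add: power_le_one)
    have "(\<Sum>i\<le>m. z i ^ 2) = (\<Sum>i<m. z i ^ 2) + z m ^ 2"
      by (simp add: lessThan_Suc_atMost[symmetric])
    also have "(\<Sum>i<m. z i ^ 2) = (\<Sum>i<?d. z i ^ 2)"
      by (rule sum.mono_neutral_right) (use dm in \<open>auto simp: z_def\<close>)
    also have "\<dots> = norm y ^ 2" unfolding ny[symmetric] by (rule sum.cong) (auto simp: z_def)
    also have "z m ^ 2 = 1 - norm y ^ 2" using dm \<open>norm y ^ 2 \<le> 1\<close> by (simp add: z_def)
    finally have "(\<Sum>i\<le>m. z i ^ 2) = 1" by simp
    moreover have "z i = 0" if "i > m" for i using that dm by (simp add: z_def)
    ultimately have "z \<in> topspace (nsphere m)" by (simp add: topspace_nsphere_iff)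
    then have "z \<in> insert e (h ` K)" using sub by blast
    then show "y \<in> insert (\<phi> e) ((\<lambda>x. \<phi> (h (fst x))) ` ?S)"
      unfolding yz by force
  qed
  then have "negligible (ball (0 :: 'a \<times> real) 1)" using neg negligible_subset by blast
  then show False using open_not_negligible[of "ball (0 :: 'a \<times> real) 1"] by simp
qed

lemma dot_self: "x \<in> topspace (nsphere m) \<Longrightarrow> dot m x x = 1"
  unfolding dot_def topspace_nsphere_iff by (simp flip: power2_eq_square)

lemma dot_commute: "dot m x y = dot m y x"
  by (simp add: dot_def mult.commute)

lemma dot_lincomb_left: "dot m (\<lambda>i. a * x i + b * y i) z = a * dot m x z + b * dot m y z"
  by (simp add: dot_def sum.distrib sum_distrib_left algebra_simps)

lemma dot_lincomb_right: "dot m z (\<lambda>i. a * x i + b * y i) = a * dot m z x + b * dot m z y"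
  by (simp add: dot_def sum.distrib sum_distrib_left algebra_simps)

lemma dot_less_1:
  assumes x: "x \<in> topspace (nsphere m)" and y: "y \<in> topspace (nsphere m)" and ne: "x \<noteq> y"
  shows "dot m x y < 1"
proof -
  let ?d = "\<lambda>i. 1 * x i + (- 1) * y i"
  obtain i where i: "x i \<noteq> y i" using ne by blast
  then have "i \<le> m" using x y unfolding topspace_nsphere_iff by (metis not_le)
  have "0 < (\<Sum>i\<le>m. ?d i * ?d i)"
    by (rule sum_pos2[of _ i]) (use i \<open>i \<le> m\<close> in \<open>auto simp: zero_less_mult_iff\<close>)
  also have "\<dots> = dot m ?d ?d" by (simp add: dot_def)
  also have "\<dots> = 2 - 2 * dot m x y"
    unfolding dot_lincomb_left dot_lincomb_right dot_self[OF x] dot_self[OF y] dot_commute[of m y x] by simp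
  finally show ?thesis by simp
qed

text \<open>Stereographic projection from \<open>z\<close>, with values in the hyperplane orthogonal to \<open>z\<close>, and its inverse.\<close>

definition stereo :: "nat \<Rightarrow> (nat \<Rightarrow> real) \<Rightarrow> (nat \<Rightarrow> real) \<Rightarrow> nat \<Rightarrow> real" where
  "stereo m z x = (\<lambda>i. (x i - dot m x z * z i) / (1 - dot m x z))"

definition stereo_inv :: "nat \<Rightarrow> (nat \<Rightarrow> real) \<Rightarrow> (nat \<Rightarrow> real) \<Rightarrow> nat \<Rightarrow> real" where
  "stereo_inv m z y = (\<lambda>i. (2 * y i + (dot m y y - 1) * z i) / (dot m y y + 1))"

lemma stereo_lincomb: "stereo m z x = (\<lambda>i. (1 / (1 - dot m x z)) * x i + (- dot m x z / (1 - dot m x z)) * z i)"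
  by (simp add: stereo_def fun_eq_iff diff_divide_distrib)

lemma stereo_inv_lincomb: "stereo_inv m z y = (\<lambda>i. (2 / (dot m y y + 1)) * y i + ((dot m y y - 1) / (dot m y y + 1)) * z i)"
  by (simp add: stereo_inv_def fun_eq_iff add_divide_distrib)

lemma dot_nonneg: "dot m y y \<ge> 0"
  by (simp add: dot_def sum_nonneg)

lemma stereo_orthogonal:
  assumes "z \<in> topspace (nsphere m)" "dot m x z \<noteq> 1"
  shows "dot m (stereo m z x) z = 0"
  unfolding stereo_lincomb dot_lincomb_left dot_self[OF assms(1)] using assms(2) by (simp add: field_simps)

lemma stereo_inv_in_nsphere:
  assumes z: "z \<in> topspace (nsphere m)" and yz: "dot m y z = 0" and y: "\<And>i. i > m \<Longrightarrow> y i = 0"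
  shows "stereo_inv m z y \<in> topspace (nsphere m)"
proof -
  define q where "q = dot m y y"
  have q: "q + 1 > 0" using dot_nonneg[of m y] by (simp add: q_def)
  have "dot m (stereo_inv m z y) (stereo_inv m z y) = (2 / (q + 1))^2 * q + ((q - 1) / (q + 1))^2"
    unfolding stereo_inv_lincomb dot_lincomb_left dot_lincomb_right dot_self[OF z] dot_commute[of m z y] yz
    by (simp add: q_def power2_eq_square)
  also have "\<dots> = (4 * q + (q - 1)^2) / (q + 1)^2"
    by (simp add: power_divide add_divide_distrib)
  also have "4 * q + (q - 1)^2 = (q + 1)^2" by (simp add: power2_eq_square algebra_simps)
  finally have "dot m (stereo_inv m z y) (stereo_inv m z y) = 1" using q by simp
  then show ?thesis
    using z y unfolding topspace_nsphere_iff by (simp add: dot_def stereo_inv_def power2_eq_square)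
qed

lemma stereo_inv_stereo:
  assumes x: "x \<in> topspace (nsphere m)" and z: "z \<in> topspace (nsphere m)" and "x \<noteq> z"
  shows "stereo_inv m z (stereo m z x) = x"
proof
  fix i
  define c where "c = dot m x z"
  define y where "y = stereo m z x"
  have c: "c < 1" unfolding c_def by (rule dot_less_1[OF assms])
  have c2: "c ^ 2 \<le> 1 * 1"
  proof -
    have "0 \<le> dot m (\<lambda>i. 1 * x i + (- c) * z i) (\<lambda>i. 1 * x i + (- c) * z i)" by (rule dot_nonneg)
    also have "\<dots> = 1 - c^2"
      unfolding dot_lincomb_left dot_lincomb_right dot_self[OF x] dot_self[OF z] dot_commute[of m z x]
      by (simp add: c_def power2_eq_square algebra_simps)
    finally show ?thesis by simp
  qed
  have "dot m y y = (1 / (1 - c))^2 * (1 - c^2)"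
    unfolding y_def stereo_lincomb dot_lincomb_left dot_lincomb_right dot_self[OF x] dot_self[OF z] dot_commute[of m z x]
      c_def[symmetric] using c by (simp add: power2_eq_square field_simps)
  also have "1 - c^2 = (1 - c) * (1 + c)" by (simp add: power2_eq_square algebra_simps)
  also have "(1 / (1 - c))^2 * ((1 - c) * (1 + c)) = (1 + c) / (1 - c)" using c by (simp add: power2_eq_square)
  finally have q: "dot m y y = (1 + c) / (1 - c)" .
  have "dot m y y + 1 = 2 / (1 - c)" "dot m y y - 1 = 2 * c / (1 - c)"
    using c unfolding q by (simp_all add: field_simps)
  then have "stereo_inv m z y i = (2 * y i + 2 * c / (1 - c) * z i) / (2 / (1 - c))"
    unfolding stereo_inv_def by simp
  also have "y i = (x i - c * z i) / (1 - c)" by (simp add: y_def stereo_def c_def)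
  also have "(2 * ((x i - c * z i) / (1 - c)) + 2 * c / (1 - c) * z i) / (2 / (1 - c)) = x i"
  proof -
    define d where "d = 1 - c"
    have d: "d \<noteq> 0" using c by (simp add: d_def)
    have "2 * ((x i - c * z i) / d) + 2 * c / d * z i = 2 * x i / d" by (simp add: diff_divide_distrib)
    then show ?thesis using d unfolding d_def[symmetric] by simp
  qed
  finally show "stereo_inv m z (stereo m z x) i = x i" by (simp add: y_def)
qed

lemma continuous_map_dot:
  assumes "\<And>i. continuous_map X euclideanreal (\<lambda>x. f x i)" "\<And>i. continuous_map X euclideanreal (\<lambda>x. g x i)"
  shows "continuous_map X euclideanreal (\<lambda>x. dot m (f x) (g x))"
  unfolding dot_def by (intro continuous_map_sum continuous_map_real_mult assms) auto

text \<open>In stereographic coordinates from the missing point \<open>z\<close>, move along straight lines to the image of \<open>e\<close>. Points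
  that start at \<open>e\<close> stay there, which makes the homotopy relative to \<open>D\<close>.\<close>

lemma contract_punctured_sphere:
  assumes c: "continuous_map X (nsphere m) c" and z: "z \<in> topspace (nsphere m)" "\<And>x. x \<in> topspace X \<Longrightarrow> c x \<noteq> z"
    and e: "e \<in> topspace (nsphere m)" "e \<noteq> z" and D: "D \<subseteq> topspace X" "\<And>x. x \<in> D \<Longrightarrow> c x = e"
  shows "homotopic_with (\<lambda>f. \<forall>x\<in>D. f x = e) X (nsphere m) c (\<lambda>_. e)"
proof -
  define y where "y s x = (\<lambda>i. (1 - s) * stereo m z (c x) i + s * stereo m z e i)" for s x
  have cS: "c x \<in> topspace (nsphere m)" if "x \<in> topspace X" for x
    using continuous_map_funspace[OF c] that by blast
  have ds: "dot m (c x) z < 1" if "x \<in> topspace X" for x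
    using dot_less_1[OF cS[OF that] z(1) z(2)[OF that]] .
  have de: "dot m e z < 1" using dot_less_1[OF e(1) z(1) e(2)] .
  let ?U = "prod_topology unit_top X"
  have cc: "continuous_map ?U euclideanreal (\<lambda>u. c (snd u) i)" for i
    using continuous_map_compose[OF continuous_map_snd continuous_map_nsphere_component[OF c]] unfolding o_def .
  have cd: "continuous_map ?U euclideanreal (\<lambda>u. dot m (c (snd u)) z)"
    by (intro continuous_map_dot cc) auto
  have cst: "continuous_map ?U euclideanreal (\<lambda>u. stereo m z (c (snd u)) i)" for i
    unfolding stereo_def
    by (intro continuous_map_real_divide continuous_map_diff continuous_map_real_mult cc cd) (use ds in fastforce)+
  have cs: "continuous_map ?U euclideanreal fst"
    using continuous_map_fst[of unit_top X] by (simp add: continuous_map_in_subtopology)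
  have cy: "continuous_map ?U euclideanreal (\<lambda>u. y (fst u) (snd u) i)" for i
    unfolding y_def by (intro continuous_map_add continuous_map_real_mult continuous_map_diff cs cst) auto
  have H: "continuous_map ?U (nsphere m) (\<lambda>u. stereo_inv m z (y (fst u) (snd u)))"
  proof (rule continuous_map_nsphereI)
    show "continuous_map ?U euclideanreal (\<lambda>u. stereo_inv m z (y (fst u) (snd u)) i)" for i
    proof -
      have "dot m w w + 1 \<noteq> 0" for w using dot_nonneg[of m w] by linarith
      then show ?thesis
        unfolding stereo_inv_def
        by (intro continuous_map_real_divide continuous_map_diff continuous_map_add continuous_map_real_mult continuous_map_dot cy)
          auto
    qed
    fix u assume u: "u \<in> topspace ?U"
    then have x: "snd u \<in> topspace X" by auto
    have "dot m (y (fst u) (snd u)) z = 0"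
      unfolding y_def dot_lincomb_left using ds[OF x] de by (simp add: stereo_orthogonal[OF z(1)])
    moreover have "y (fst u) (snd u) i = 0" if "i > m" for i
      using that cS[OF x] z(1) e(1) unfolding y_def stereo_def topspace_nsphere_iff by simp
    ultimately show "stereo_inv m z (y (fst u) (snd u)) \<in> topspace (nsphere m)"
      by (intro stereo_inv_in_nsphere z(1))
  qed
  have y0: "y 0 x = stereo m z (c x)" and y1: "y 1 x = stereo m z e" for x by (simp_all add: y_def)
  have yD: "y s x = stereo m z e" if "x \<in> D" for s x
    unfolding y_def D(2)[OF that] by (simp add: fun_eq_iff algebra_simps)
  have inv_e: "stereo_inv m z (stereo m z e) = e" by (rule stereo_inv_stereo[OF e(1) z(1) e(2)])
  have inv_c: "stereo_inv m z (stereo m z (c x)) = c x" if "x \<in> topspace X" for x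
    by (rule stereo_inv_stereo[OF cS[OF that] z(1) z(2)[OF that]])
  show ?thesis
  proof (subst homotopic_with, goal_cases)
    case 1 then show ?case using D(1) by (auto simp: subset_iff)
  next
    case 2
    show ?case
    proof (intro exI[of _ "\<lambda>u. stereo_inv m z (y (fst u) (snd u))"] conjI H ballI)
      fix x assume "x \<in> topspace X"
      then show "stereo_inv m z (y (fst (0, x)) (snd (0, x))) = c x"
        by (simp only: fst_conv snd_conv y0 inv_c)
    next
      fix x assume "x \<in> topspace X"
      show "stereo_inv m z (y (fst (1, x)) (snd (1, x))) = e"
        by (simp only: fst_conv snd_conv y1 inv_e)
    next
      fix t :: real and x assume "x \<in> D"
      then show "stereo_inv m z (y (fst (t, x)) (snd (t, x))) = e"
        by (simp only: fst_conv snd_conv yD inv_e)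
    qed
  qed
qed

text \<open>A map from a set of dimension below \<open>m\<close> is first moved to a nearby locally Lipschitz map, coordinate by
  coordinate and along straight lines that avoid the origin. That map misses a point of the sphere, so it
  contracts in the complement. Both homotopies are constant on \<open>D\<close>.\<close>

lemma nullhomotopic_low_dimension:
  fixes c :: "'a::euclidean_space \<Rightarrow> nat \<Rightarrow> real"
  assumes dim: "DIM('a) < m" and K: "compact K" and c: "continuous_map (top_of_set K) (nsphere m) c"
    and D: "D \<subseteq> K" "\<And>x. x \<in> D \<Longrightarrow> c x = e" and e: "e \<in> topspace (nsphere m)"
  shows "homotopic_with (\<lambda>f. \<forall>x\<in>D. f x = e) (top_of_set K) (nsphere m) c (\<lambda>_. e)"
proof -
  \<comment> \<open>Small enough for the \<open>m + 1\<close> coordinate errors \<open>2 * \<epsilon>\<close> to add up to at most \<open>1/2\<close>, which keeps the straight line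
      homotopy away from the origin.\<close>
  define \<epsilon> where "\<epsilon> = 1 / (4 * (real m + 1))"
  have \<epsilon>: "\<epsilon> > 0" by (simp add: \<epsilon>_def)
  have cS: "c x \<in> topspace (nsphere m)" if "x \<in> K" for x
    using continuous_map_funspace[OF c] that by auto
  have "continuous_on K (\<lambda>x. c x i - e i)" for i
    using continuous_map_nsphere_component[OF c, of i] by (intro continuous_intros) simp
  from lipschitz_approximation[OF K this \<epsilon>]
  have "\<exists>g. continuous_on UNIV g \<and> (\<forall>x\<in>K. \<bar>c x i - e i - g x\<bar> < 2 * \<epsilon>) \<and> (\<forall>x\<in>K. c x i - e i = 0 \<longrightarrow> g x = 0) \<and>
     (\<forall>x. \<exists>d>0. \<exists>B\<ge>0. \<forall>y. norm (y - x) < d \<longrightarrow> \<bar>g y - g x\<bar> \<le> B * norm (y - x))" for i .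
  then obtain g where g: "\<And>i. continuous_on UNIV (g i)" "\<And>i x. x \<in> K \<Longrightarrow> \<bar>c x i - e i - g i x\<bar> < 2 * \<epsilon>"
    "\<And>i x. x \<in> K \<Longrightarrow> c x i - e i = 0 \<Longrightarrow> g i x = 0"
    "\<And>i x. \<exists>d>0. \<exists>B\<ge>0. \<forall>y. norm (y - x) < d \<longrightarrow> \<bar>g i y - g i x\<bar> \<le> B * norm (y - x)"
    by metis
  define w where "w x = (\<lambda>i. e i + g i x)" for x
  have wc: "(\<Sum>j\<le>m. \<bar>c x j - w x j\<bar>) \<le> 1/2" if x: "x \<in> K" for x
  proof -
    have "(\<Sum>j\<le>m. \<bar>c x j - w x j\<bar>) \<le> (\<Sum>j\<le>m. 2 * \<epsilon>)"
      using g(2)[OF x] by (intro sum_mono) (simp add: w_def less_imp_le diff_diff_eq)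
    also have "\<dots> = 1/2" by (simp add: \<epsilon>_def field_simps)
    finally show ?thesis .
  qed
  have wD: "normalise m (w x) = e" if x: "x \<in> D" for x
  proof -
    have "w x = e" using g(3)[of x] D x by (auto simp: w_def fun_eq_iff)
    then show ?thesis using normalise_nsphere[OF e] by simp
  qed
  have line: "sqrt (\<Sum>j\<le>m. ((1 - s) * c x j + s * w x j) ^ 2) \<ge> 1/2" if x: "x \<in> K" and s: "s \<in> {0..1}" for s x
  proof -
    have "\<bar>sqrt (\<Sum>j\<le>m. (c x j) ^ 2) - sqrt (\<Sum>j\<le>m. ((1 - s) * c x j + s * w x j) ^ 2)\<bar>
        \<le> (\<Sum>j\<le>m. \<bar>c x j - ((1 - s) * c x j + s * w x j)\<bar>)" by (rule sqrt_sum_squares_lipschitz)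
    also have "\<dots> = (\<Sum>j\<le>m. s * \<bar>c x j - w x j\<bar>)"
    proof (rule sum.cong)
      fix j
      have "c x j - ((1 - s) * c x j + s * w x j) = s * (c x j - w x j)" by (simp add: algebra_simps)
      then show "\<bar>c x j - ((1 - s) * c x j + s * w x j)\<bar> = s * \<bar>c x j - w x j\<bar>"
        using s by (simp only: abs_mult) simp
    qed simp
    also have "\<dots> \<le> (\<Sum>j\<le>m. \<bar>c x j - w x j\<bar>)"
      using s by (intro sum_mono) (simp add: mult_left_le_one_le)
    also have "\<dots> \<le> 1/2" by (rule wc[OF x])
    finally have "\<bar>sqrt (\<Sum>j\<le>m. (c x j) ^ 2) - sqrt (\<Sum>j\<le>m. ((1 - s) * c x j + s * w x j) ^ 2)\<bar> \<le> 1/2" .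
    moreover have "sqrt (\<Sum>j\<le>m. (c x j) ^ 2) = 1" using cS[OF x] unfolding topspace_nsphere_iff by simp
    ultimately show ?thesis by linarith
  qed
  have pos: "(\<Sum>j\<le>m. ((1 - s) * c x j + s * w x j) ^ 2) > 0" if "x \<in> K" "s \<in> {0..1}" for s x
  proof -
    have "sqrt (\<Sum>j\<le>m. ((1 - s) * c x j + s * w x j) ^ 2) > 0" using line[OF that] by linarith
    then show ?thesis by simp
  qed
  let ?U = "prod_topology unit_top (top_of_set K)"
  let ?H = "\<lambda>u. normalise m (\<lambda>i. (1 - fst u) * c (snd u) i + fst u * w (snd u) i)"
  have H: "continuous_map ?U (nsphere m) ?H"
  proof (rule continuous_map_normalise)
    fix i
    have cc: "continuous_map ?U euclideanreal (\<lambda>u. c (snd u) i)"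
      using continuous_map_compose[OF continuous_map_snd continuous_map_nsphere_component[OF c]] unfolding o_def .
    have cg: "continuous_map (top_of_set K) euclideanreal (\<lambda>x. w x i)"
      unfolding w_def using continuous_on_subset[OF g(1)[of i], of K] by (simp add: continuous_on_add)
    have cw: "continuous_map ?U euclideanreal (\<lambda>u. w (snd u) i)"
      using continuous_map_compose[OF continuous_map_snd cg] unfolding o_def .
    have cs: "continuous_map ?U euclideanreal fst"
      using continuous_map_fst[of unit_top "top_of_set K"] unfolding continuous_map_in_subtopology by blast
    show "continuous_map ?U euclideanreal (\<lambda>u. (1 - fst u) * c (snd u) i + fst u * w (snd u) i)"
      by (intro continuous_map_add continuous_map_real_mult continuous_map_diff cs cc cw)
         (rule continuous_map_const[THEN iffD2], simp)
  qed (use pos in auto)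
  have 1: "homotopic_with (\<lambda>f. \<forall>x\<in>D. f x = e) (top_of_set K) (nsphere m) c (\<lambda>x. normalise m (w x))"
  proof (subst homotopic_with, goal_cases)
    case 1 then show ?case using D(1) by (auto simp: subset_iff)
  next
    case 2
    show ?case
    proof (intro exI[of _ ?H] conjI H ballI)
      fix x assume "x \<in> topspace (top_of_set K)"
      then show "?H (0, x) = c x" using normalise_nsphere[OF cS] by simp
    next
      fix x show "?H (1, x) = normalise m (w x)" by simp
    next
      fix t :: real and x assume t: "t \<in> {0..1}" and x: "x \<in> D"
      have "w x = e" using g(3)[of x] D x by (auto simp: w_def fun_eq_iff)
      then have "(\<lambda>i. (1 - t) * c x i + t * w x i) = e"
        using D(2)[OF x] by (simp add: fun_eq_iff algebra_simps)
      then show "?H (t, x) = e" using normalise_nsphere[OF e] by simp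
    qed
  qed
  have lipw: "\<exists>d>0. \<exists>B\<ge>0. \<forall>y. norm (y - x) < d \<longrightarrow> (\<Sum>j\<le>n. \<bar>w y j - w x j\<bar>) \<le> B * norm (y - x)" for x n
  proof (induction n)
    case 0 then show ?case using g(4)[where i = 0 and x = x] by (simp add: w_def)
  next
    case (Suc n)
    then obtain d B where d: "d > 0" "B \<ge> 0" "\<And>y. norm (y - x) < d \<Longrightarrow> (\<Sum>j\<le>n. \<bar>w y j - w x j\<bar>) \<le> B * norm (y - x)"
      by blast
    obtain d' B' where d': "d' > 0" "B' \<ge> 0" "\<And>y. norm (y - x) < d' \<Longrightarrow> \<bar>g (Suc n) y - g (Suc n) x\<bar> \<le> B' * norm (y - x)"
      using g(4)[where i = "Suc n" and x = x] by blast
    have "(\<Sum>j\<le>Suc n. \<bar>w y j - w x j\<bar>) \<le> (B + B') * norm (y - x)" if "norm (y - x) < min d d'" for y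
      using d(3)[of y] d'(3)[of y] that by (simp add: w_def algebra_simps)
    then show ?case using d(1,2) d'(1,2)
      by (intro exI[of _ "min d d'"] conjI exI[of _ "B + B'"]) auto
  qed
  have "\<exists>z\<in>topspace (nsphere m). z \<noteq> e \<and> z \<notin> (\<lambda>x. normalise m (w x)) ` K"
  proof (rule lipschitz_misses_point[OF dim])
    fix x assume x: "x \<in> K"
    obtain d B where d: "d > 0" "B \<ge> 0" "\<And>y. norm (y - x) < d \<Longrightarrow> (\<Sum>j\<le>m. \<bar>w y j - w x j\<bar>) \<le> B * norm (y - x)"
      using lipw[of x m] by blast
    have "\<bar>normalise m (w y) i - normalise m (w x) i\<bar> \<le> (4 * B) * norm (y - x)"
      if "y \<in> K" "norm (y - x) < d" for y i
      using normalise_lipschitz[where m = m and v = "w y" and w = "w x" and i = i] line[OF x, of 1] line[OF that(1), of 1] d(3)[OF that(2)] by simp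
    then show "\<exists>d>0. \<exists>B\<ge>0. \<forall>y\<in>K. \<forall>i. norm (y - x) < d \<longrightarrow> \<bar>normalise m (w y) i - normalise m (w x) i\<bar> \<le> B * norm (y - x)"
      using d(1,2) by (intro exI[of _ d] conjI exI[of _ "4 * B"]) auto
  qed
  then obtain z where z: "z \<in> topspace (nsphere m)" "z \<noteq> e" "\<And>x. x \<in> K \<Longrightarrow> normalise m (w x) \<noteq> z"
    by blast
  have "continuous_map (top_of_set K) (nsphere m) (\<lambda>x. normalise m (w x))"
    using homotopic_with_imp_continuous_maps[OF 1] by blast
  then have 2: "homotopic_with (\<lambda>f. \<forall>x\<in>D. f x = e) (top_of_set K) (nsphere m) (\<lambda>x. normalise m (w x)) (\<lambda>_. e)"
  proof (rule contract_punctured_sphere[OF _ z(1) _ e z(2)[symmetric]])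
    show "normalise m (w x) \<noteq> z" if "x \<in> topspace (top_of_set K)" for x
      using z(3)[of x] that by simp
    show "D \<subseteq> topspace (top_of_set K)" using D(1) by simp
  qed (rule wD)
  show ?thesis by (rule homotopic_with_trans[OF 1 2])
qed

section \<open>Circle-valued maps on loop spaces of spheres\<close>

lemma continuous_map_path_concat:
  assumes P: "continuous_map unit_top X P" and Q: "continuous_map unit_top X Q" and PQ: "P 1 = Q 0"
  shows "continuous_map unit_top X (loop_concat P Q)"
proof -
  have id: "continuous_map unit_top euclideanreal (\<lambda>t. t)" by simp
  have half: "continuous_map unit_top euclideanreal (\<lambda>t. 1/2)" by simp
  have "continuous_map unit_top X (\<lambda>t. if t \<le> 1/2 then P (2 * t) else Q (2 * t - 1))"
  proof (rule continuous_map_cases_le[OF id half])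
    have "continuous_map (subtopology unit_top {t \<in> topspace unit_top. t \<le> 1/2}) unit_top (\<lambda>t. 2 * t)"
      by (rule continuous_map_unit_topI) (auto intro!: continuous_map_from_subtopology continuous_intros)
    from continuous_map_compose[OF this P]
    show "continuous_map (subtopology unit_top {t \<in> topspace unit_top. t \<le> 1/2}) X (\<lambda>t. P (2 * t))"
      unfolding o_def .
    have "continuous_map (subtopology unit_top {t \<in> topspace unit_top. 1/2 \<le> t}) unit_top (\<lambda>t. 2 * t - 1)"
      by (rule continuous_map_unit_topI) (auto intro!: continuous_map_from_subtopology continuous_intros)
    from continuous_map_compose[OF this Q]
    show "continuous_map (subtopology unit_top {t \<in> topspace unit_top. 1/2 \<le> t}) X (\<lambda>t. Q (2 * t - 1))"
      unfolding o_def .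
    show "P (2 * t) = Q (2 * t - 1)" if "t = 1/2" for t :: real using PQ by (simp add: that)
  qed
  then show ?thesis
    by (rule continuous_map_eq) (simp add: loop_concat_def)
qed

lemma loop_concat_ends:
  "loop_concat P Q 0 = P 0" "loop_concat P Q 1 = Q 1"
  by (simp_all add: loop_concat_def)

lemma continuous_map_path_reverse:
  assumes "continuous_map unit_top X P"
  shows "continuous_map unit_top X (\<lambda>t. P (1 - t))"
proof -
  have "continuous_map unit_top unit_top (\<lambda>t. 1 - t)"
    by (rule continuous_map_unit_topI) (auto intro!: continuous_intros)
  from continuous_map_compose[OF this assms] show ?thesis unfolding o_def .
qed

lemma angle_comp_concat:
  assumes g: "continuous_map X circle_top g" and P: "continuous_map unit_top X P" and Q: "continuous_map unit_top X Q"
    and PQ: "P 1 = Q 0"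
  shows "angle (\<lambda>s. g (loop_concat P Q s)) = angle (\<lambda>s. g (P s)) + angle (\<lambda>s. g (Q s))"
proof -
  have "angle (\<lambda>s. g (loop_concat P Q s)) = angle (loop_concat (\<lambda>s. g (P s)) (\<lambda>s. g (Q s)))"
    by (rule angle_cong) (simp add: loop_concat_def)
  also have "\<dots> = angle (\<lambda>s. g (P s)) + angle (\<lambda>s. g (Q s))"
    using continuous_map_compose[OF P g] continuous_map_compose[OF Q g] PQ
    by (intro angle_loop_concat) (simp_all add: o_def)
  finally show ?thesis .
qed

abbreviation sphere_loops :: "nat \<Rightarrow> (real \<Rightarrow> nat \<Rightarrow> real) topology" where
  "sphere_loops m \<equiv> loop_space (nsphere m) sphere_pt"

abbreviation base_loop :: "real \<Rightarrow> nat \<Rightarrow> real" where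
  "base_loop \<equiv> const_loop sphere_pt"

lemma base_loop_in: "base_loop \<in> topspace (sphere_loops m)"
  by (rule const_loop_in_loop_space[OF sphere_pt_in_nsphere])

text \<open>A null-homotopy of the loop relative to its end points, read backwards, is a path in the loop space.\<close>

lemma path_connected_sphere_loops:
  assumes m: "m \<ge> 2" and l: "l \<in> topspace (sphere_loops m)"
  shows "\<exists>P. continuous_map unit_top (sphere_loops m) P \<and> P 0 = base_loop \<and> P 1 = l"
proof -
  have lc: "continuous_map unit_top (nsphere m) l" and l01: "l 0 = sphere_pt" "l 1 = sphere_pt"
    and le: "l \<in> extensional {0..1}"
    using l unfolding topspace_loop_space by blast+
  have "homotopic_with (\<lambda>f. \<forall>x\<in>{0, 1}. f x = sphere_pt) unit_top (nsphere m) l (\<lambda>_. sphere_pt)"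
    by (rule nullhomotopic_low_dimension) (use m lc l01 sphere_pt_in_nsphere in auto)
  from homotopic_with_symD[OF this] obtain h where h: "continuous_map (prod_topology unit_top unit_top) (nsphere m) h"
    "\<forall>x. h (0, x) = sphere_pt" "\<forall>x. h (1, x) = l x" "\<forall>s\<in>{0..1}. \<forall>x\<in>{0, 1}. h (s, x) = sphere_pt"
    unfolding homotopic_with_def by blast
  let ?P = "\<lambda>s. restrict (\<lambda>t. h (s, t)) {0..1}"
  have "continuous_map unit_top (sphere_loops m) ?P"
  proof (rule continuous_map_curry_loop)
    show "continuous_map (prod_topology unit_top unit_top) (nsphere m) (\<lambda>(s, t). ?P s t)"
      by (rule continuous_map_eq[OF h(1)]) (auto simp: restrict_def)
    show "?P s \<in> extensional {0..1} \<and> ?P s 0 = sphere_pt \<and> ?P s 1 = sphere_pt" if "s \<in> topspace unit_top" for s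
      using h(4) that by simp
  qed
  moreover have "?P 0 = base_loop" using h(2) by (simp add: const_loop_def)
  moreover have "?P 1 = l" using h(3) le by (simp add: extensional_restrict)
  ultimately show ?thesis by blast
qed

text \<open>A closed path in the loop space is a map of the square that sends the boundary to the base point, and
  \<open>2 < m\<close>.\<close>

lemma simply_connected_sphere_loops:
  assumes m: "m \<ge> 3" and C: "continuous_map unit_top (sphere_loops m) C" "C 0 = base_loop" "C 1 = base_loop"
  shows "\<exists>H. continuous_map (prod_topology unit_top unit_top) (sphere_loops m) H \<and>
     (\<forall>s\<in>{0..1}. H (s, 0) = base_loop \<and> H (s, 1) = C s) \<and> (\<forall>r\<in>{0..1}. H (0, r) = base_loop \<and> H (1, r) = base_loop)"
proof -
  let ?K = "{0..1} \<times> {0..1} :: (real \<times> real) set"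
  let ?D = "{x \<in> ?K. fst x \<in> {0, 1} \<or> snd x \<in> {0, 1}}"
  let ?c = "\<lambda>(s, t). C s t"
  have Kt: "prod_topology unit_top unit_top = top_of_set ?K" by simp
  have c: "continuous_map (top_of_set ?K) (nsphere m) ?c"
    using continuous_map_uncurry_loop[OF C(1)] unfolding Kt .
  have cD: "?c x = sphere_pt" if "x \<in> ?D" for x
    using that C(2,3) loop_map_values(1,2)[OF C(1)] by (cases x) (auto simp: const_loop_def)
  have "homotopic_with (\<lambda>f. \<forall>x\<in>?D. f x = sphere_pt) (top_of_set ?K) (nsphere m) ?c (\<lambda>_. sphere_pt)"
    using m by (intro nullhomotopic_low_dimension compact_Times c cD sphere_pt_in_nsphere) auto
  from homotopic_with_symD[OF this] obtain h where h: "continuous_map (prod_topology unit_top (top_of_set ?K)) (nsphere m) h"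
    "\<forall>x. h (0, x) = sphere_pt" "\<forall>x. h (1, x) = ?c x" "\<forall>s\<in>{0..1}. \<forall>x\<in>?D. h (s, x) = sphere_pt"
    unfolding homotopic_with_def by blast
  let ?H = "\<lambda>(s, r). restrict (\<lambda>t. h (r, (s, t))) {0..1}"
  have "continuous_map (prod_topology unit_top unit_top) (sphere_loops m) ?H"
  proof (rule continuous_map_curry_loop)
    let ?X = "prod_topology (prod_topology unit_top unit_top) unit_top"
    have 1: "continuous_map ?X unit_top (\<lambda>x. snd (fst x))"
      using continuous_map_compose[OF continuous_map_fst continuous_map_snd, of unit_top unit_top unit_top]
      unfolding o_def .
    have 2: "continuous_map ?X unit_top (\<lambda>x. fst (fst x))"
      using continuous_map_compose[OF continuous_map_fst continuous_map_fst, of unit_top unit_top unit_top]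
      unfolding o_def .
    have "continuous_map ?X (prod_topology unit_top (prod_topology unit_top unit_top)) (\<lambda>x. (snd (fst x), (fst (fst x), snd x)))"
      by (intro continuous_map_paired[THEN iffD2] conjI 1 2 continuous_map_snd)
    from continuous_map_compose[OF this h(1)[folded Kt]]
    show "continuous_map ?X (nsphere m) (\<lambda>(x, t). ?H x t)"
      by (rule continuous_map_eq) auto
    show "?H x \<in> extensional {0..1} \<and> ?H x 0 = sphere_pt \<and> ?H x 1 = sphere_pt"
      if "x \<in> topspace (prod_topology unit_top unit_top)" for x
      using h(4) that by (cases x) simp
  qed
  moreover have "?H (s, 0) = base_loop \<and> ?H (s, 1) = C s" if "s \<in> {0..1}" for s
    using h(2,3) loop_map_values(3)[OF C(1)] that by (simp add: const_loop_def extensional_restrict)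
  moreover have "?H (0, r) = base_loop \<and> ?H (1, r) = base_loop" if "r \<in> {0..1}" for r
    using h(4) that by (auto simp: const_loop_def restrict_def fun_eq_iff)
  ultimately show ?thesis by blast
qed

text \<open>Loops whose points stay less than a right angle away from those of \<open>l\<close> form an open set that contracts to
  \<open>l\<close> along great circles. These sets are the contractible neighbourhoods that the lifting criterion for
  covering spaces calls for.\<close>

definition near_loops :: "nat \<Rightarrow> (real \<Rightarrow> nat \<Rightarrow> real) \<Rightarrow> (real \<Rightarrow> nat \<Rightarrow> real) set" where
  "near_loops m l = {l' \<in> topspace (sphere_loops m). \<forall>t\<in>{0..1}. dot m (l t) (l' t) > 0}"

lemma openin_near_loops:
  assumes l: "l \<in> topspace (sphere_loops m)"
  shows "openin (sphere_loops m) (near_loops m l)"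
proof -
  let ?X = "prod_topology (sphere_loops m) unit_top"
  have lc: "continuous_map unit_top (nsphere m) l" using l unfolding topspace_loop_space by blast
  have 1: "continuous_map ?X (nsphere m) (\<lambda>z. l (snd z))"
    using continuous_map_compose[OF continuous_map_snd lc] unfolding o_def .
  have 2: "continuous_map ?X (nsphere m) (\<lambda>z. fst z (snd z))"
    using continuous_map_eval_loop unfolding split_def .
  have f: "continuous_map ?X euclideanreal (\<lambda>z. dot m (l (snd z)) (fst z (snd z)))"
    by (rule continuous_map_dot[OF continuous_map_nsphere_component[OF 1] continuous_map_nsphere_component[OF 2]])
  have "compactin unit_top {0..1}" by (simp add: compactin_subtopology)
  from openin_all_compact[OF f this, of "{0<..}"] show ?thesis
    by (simp add: near_loops_def)
qed

lemma sphere_loops_value: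
  assumes "l \<in> topspace (sphere_loops m)" "t \<in> {0..1}"
  shows "l t \<in> topspace (nsphere m)"
proof -
  have "continuous_map unit_top (nsphere m) l" using assms(1) unfolding topspace_loop_space by blast
  then show ?thesis using assms(2) continuous_map_funspace by fastforce
qed

lemma near_loops_self: "l \<in> topspace (sphere_loops m) \<Longrightarrow> l \<in> near_loops m l"
  unfolding near_loops_def using dot_self[OF sphere_loops_value] by simp

lemma near_loops_contraction:
  assumes l: "l \<in> topspace (sphere_loops m)"
  shows "\<exists>H. continuous_map (prod_topology (subtopology (sphere_loops m) (near_loops m l)) unit_top) (sphere_loops m) H \<and>
     (\<forall>l'\<in>near_loops m l. H (l', 0) = l \<and> H (l', 1) = l')"
proof -
  let ?W = "subtopology (sphere_loops m) (near_loops m l)"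
  let ?v = "\<lambda>l' s t i. (1 - s) * l t i + s * l' t i"
  let ?H = "\<lambda>(l', s). restrict (\<lambda>t. normalise m (?v l' s t)) {0..1}"
  let ?X = "prod_topology (prod_topology ?W unit_top) unit_top"
  have lc: "continuous_map unit_top (nsphere m) l" and l01: "l 0 = sphere_pt" "l 1 = sphere_pt"
    using l unfolding topspace_loop_space by blast+
  have sph: "l t \<in> topspace (nsphere m)" if "t \<in> {0..1}" for t
    by (rule sphere_loops_value[OF l that])
  have near: "l' \<in> topspace (sphere_loops m)" "l' \<in> extensional {0..1}" "l' 0 = sphere_pt" "l' 1 = sphere_pt"
    if "l' \<in> near_loops m l" for l'
    using that unfolding near_loops_def topspace_loop_space by blast+
  have sph': "l' t \<in> topspace (nsphere m)" if "l' \<in> near_loops m l" "t \<in> {0..1}" for l' t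
    by (rule sphere_loops_value[OF near(1)[OF that(1)] that(2)])
  have topW: "topspace ?W = near_loops m l" using near(1) by auto
  have pos: "(\<Sum>j\<le>m. (?v l' s t j)\<^sup>2) > 0" if l': "l' \<in> near_loops m l" and s: "s \<in> {0..1}" and t: "t \<in> {0..1}" for l' s t
  proof -
    have "(\<Sum>j\<le>m. (?v l' s t j)\<^sup>2) = dot m (?v l' s t) (?v l' s t)" by (simp add: dot_def power2_eq_square)
    also have "\<dots> = (1 - s)\<^sup>2 + s\<^sup>2 + 2 * (s * (1 - s) * dot m (l t) (l' t))"
      unfolding dot_lincomb_left dot_lincomb_right dot_self[OF sph[OF t]] dot_self[OF sph'[OF l' t]] dot_commute[of m "l' t" "l t"]
      by (simp add: power2_eq_square algebra_simps)
    also have "\<dots> > 0"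
    proof -
      have "s * (1 - s) * dot m (l t) (l' t) \<ge> 0"
        using s t l' unfolding near_loops_def by (simp add: less_imp_le)
      moreover have "(1 - s)\<^sup>2 + s\<^sup>2 > 0" by (cases "s = 0") (simp_all add: add_nonneg_pos)
      ultimately show ?thesis by linarith
    qed
    finally show ?thesis .
  qed
  have "continuous_map (prod_topology ?W unit_top) (sphere_loops m) ?H"
  proof (rule continuous_map_curry_loop)
    have s: "continuous_map ?X euclideanreal (\<lambda>z. snd (fst z))"
      using continuous_map_compose[OF continuous_map_fst continuous_map_snd, of "?W" unit_top unit_top]
      unfolding o_def continuous_map_in_subtopology by blast
    have 1: "continuous_map ?X (nsphere m) (\<lambda>z. l (snd z))"
      using continuous_map_compose[OF continuous_map_snd lc] unfolding o_def .
    have f: "continuous_map ?X ?W (\<lambda>z. fst (fst z))"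
      using continuous_map_compose[OF continuous_map_fst continuous_map_fst, of "?W" unit_top unit_top] unfolding o_def .
    then have "continuous_map ?X (sphere_loops m) (\<lambda>z. fst (fst z))"
      unfolding continuous_map_in_subtopology by blast
    then have "continuous_map ?X (prod_topology (sphere_loops m) unit_top) (\<lambda>z. (fst (fst z), snd z))"
      by (intro continuous_map_paired[THEN iffD2] conjI continuous_map_snd)
    from continuous_map_compose[OF this continuous_map_eval_loop]
    have 2: "continuous_map ?X (nsphere m) (\<lambda>z. fst (fst z) (snd z))" unfolding o_def split_def fst_conv snd_conv .
    have "continuous_map ?X (nsphere m) (\<lambda>z. normalise m (?v (fst (fst z)) (snd (fst z)) (snd z)))"
    proof (rule continuous_map_normalise)
      show "continuous_map ?X euclideanreal (\<lambda>z. ?v (fst (fst z)) (snd (fst z)) (snd z) i)" for i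
        by (intro continuous_map_add continuous_map_real_mult continuous_map_diff s
            continuous_map_nsphere_component[OF 1] continuous_map_nsphere_component[OF 2]) 
           (rule continuous_map_const[THEN iffD2], simp)
      show "(\<Sum>j\<le>m. (?v (fst (fst z)) (snd (fst z)) (snd z) j)\<^sup>2) > 0" if z: "z \<in> topspace ?X" for z
      proof (rule pos)
        show "fst (fst z) \<in> near_loops m l" "snd (fst z) \<in> {0..1}" "snd z \<in> {0..1}"
          using z unfolding topspace_prod_topology topW mem_Times_iff by simp_all
      qed
    qed
    then show "continuous_map ?X (nsphere m) (\<lambda>(x, t). ?H x t)"
      by (rule continuous_map_eq) (auto simp: split_def)
    fix x assume "x \<in> topspace (prod_topology ?W unit_top)"
    then have x: "fst x \<in> near_loops m l" "snd x \<in> {0..1}"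
      unfolding topspace_prod_topology topW mem_Times_iff by simp_all
    have "normalise m (?v (fst x) (snd x) t) = sphere_pt" if "t \<in> {0, 1}" for t
    proof -
      have "?v (fst x) (snd x) t = sphere_pt"
      proof -
        have "l t = sphere_pt" "fst x t = sphere_pt" using that l01 near(3,4)[OF x(1)] by auto
        then show ?thesis by (simp add: fun_eq_iff algebra_simps)
      qed
      then show ?thesis using normalise_nsphere[OF sphere_pt_in_nsphere] by simp
    qed
    then show "?H x \<in> extensional {0..1} \<and> ?H x 0 = sphere_pt \<and> ?H x 1 = sphere_pt"
      by (simp add: split_def)
  qed
  moreover have "?H (l', 0) = l \<and> ?H (l', 1) = l'" if l': "l' \<in> near_loops m l" for l'
  proof -
    have "l \<in> extensional {0..1}" using l unfolding topspace_loop_space by blast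
    then have "restrict l {0..1} = l" "restrict l' {0..1} = l'" using near(2)[OF l'] by (simp_all add: extensional_restrict)
    moreover have "restrict (\<lambda>t. normalise m (l t)) {0..1} = restrict l {0..1}"
      by (rule restrict_ext) (rule normalise_nsphere[OF sph])
    moreover have "restrict (\<lambda>t. normalise m (l' t)) {0..1} = restrict l' {0..1}"
      by (rule restrict_ext) (rule normalise_nsphere[OF sph'[OF l']])
    ultimately show ?thesis by simp
  qed
  ultimately show ?thesis by blast
qed

text \<open>The value of the lift at \<open>l\<close> is the change of the argument of \<open>g\<close> along a path from the base loop to \<open>l\<close>.
  It does not depend on the path because the angles of closed paths vanish, and it is continuous because
  near \<open>l\<close> the path can be prolonged by the contractions above.\<close>

lemma lift_sphere_loops:
  assumes m: "m \<ge> 2" and g: "continuous_map (sphere_loops m) circle_top g" "g base_loop = 1"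
    and closed: "\<And>C. continuous_map unit_top (sphere_loops m) C \<Longrightarrow> C 0 = base_loop \<Longrightarrow> C 1 = base_loop \<Longrightarrow>
       angle (\<lambda>s. g (C s)) = 0"
  shows "\<exists>\<theta>. continuous_map (sphere_loops m) euclideanreal \<theta> \<and> (\<forall>l\<in>topspace (sphere_loops m). g l = cis (\<theta> l)) \<and>
    \<theta> base_loop = 0"
proof -
  let ?A = "sphere_loops m"
  have gp: "continuous_map unit_top circle_top (\<lambda>s. g (P s))" if "continuous_map unit_top ?A P" for P
    using continuous_map_compose[OF that g(1)] unfolding o_def .
  have indep: "angle (\<lambda>s. g (P s)) = angle (\<lambda>s. g (Q s))"
    if P: "continuous_map unit_top ?A P" "P 0 = base_loop" and Q: "continuous_map unit_top ?A Q" "Q 0 = base_loop"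
      and PQ: "P 1 = Q 1" for P Q
  proof -
    have R: "continuous_map unit_top ?A (\<lambda>s. Q (1 - s))" by (rule continuous_map_path_reverse[OF Q(1)])
    have PR: "P 1 = Q (1 - 0)" using PQ by simp
    have "angle (\<lambda>s. g (loop_concat P (\<lambda>s. Q (1 - s)) s)) = 0"
      using continuous_map_path_concat[OF P(1) R PR] P(2) Q(2) by (intro closed) (simp_all add: loop_concat_ends)
    then show ?thesis
      using angle_comp_concat[OF g(1) P(1) R PR] angle_reverse[OF gp[OF Q(1)]] by linarith
  qed
  obtain P where P: "\<And>l. l \<in> topspace ?A \<Longrightarrow> continuous_map unit_top ?A (P l) \<and> P l 0 = base_loop \<and> P l 1 = l"
    using path_connected_sphere_loops[OF m] by metis
  define G where "G l = angle (\<lambda>s. g (P l s))" for l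
  have Geq: "G l = angle (\<lambda>s. g (Q s))"
    if "l \<in> topspace ?A" "continuous_map unit_top ?A Q" "Q 0 = base_loop" "Q 1 = l" for l Q
    unfolding G_def using P[OF that(1)] that by (intro indep) auto
  have Gcis: "g l = cis (G l)" if l: "l \<in> topspace ?A" for l
  proof -
    have "\<exists>\<theta>. continuous_on {0..1} \<theta> \<and> (\<forall>t\<in>{0..1}. g (P l t) = cis (\<theta> t)) \<and> \<theta> 0 = 0 \<and> G l = \<theta> 1 - 0"
      unfolding G_def using P[OF l] g(2) by (intro lift_path_circle gp) simp_all
    then obtain \<theta> where "\<forall>t\<in>{0..1}. g (P l t) = cis (\<theta> t)" "G l = \<theta> 1" by auto
    then have "g (P l 1) = cis (G l)" by simp
    then show ?thesis using P[OF l] by simp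
  qed
  have loc: "continuous_map (subtopology ?A (near_loops m l)) euclideanreal G" if l: "l \<in> topspace ?A" for l
  proof -
    let ?W = "subtopology ?A (near_loops m l)"
    have topW: "topspace ?W = near_loops m l" by (auto simp: near_loops_def)
    obtain H where H: "continuous_map (prod_topology ?W unit_top) ?A H"
      "\<And>l'. l' \<in> near_loops m l \<Longrightarrow> H (l', 0) = l \<and> H (l', 1) = l'"
      using near_loops_contraction[OF l] by blast
    have gH: "continuous_map (prod_topology ?W unit_top) circle_top (\<lambda>z. g (H z))"
      using continuous_map_compose[OF H(1) g(1)] unfolding o_def .
    have cG: "continuous_map ?W euclideanreal (\<lambda>_. G l)" by (rule continuous_map_const[THEN iffD2]) simp
    have start: "g (H (l', 0)) = cis (G l)" if "l' \<in> topspace ?W" for l'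
      using H(2)[of l'] that Gcis[OF l] topW by simp
    obtain \<theta> where \<theta>: "continuous_map (prod_topology ?W unit_top) euclideanreal \<theta>"
      "\<forall>a\<in>topspace ?W. \<forall>t\<in>{0..1}. g (H (a, t)) = cis (\<theta> (a, t))" "\<forall>a\<in>topspace ?W. \<theta> (a, 0) = G l"
      using lift_circle[OF gH cG start] by blast
    have "\<theta> (l', 1) = G l'" if "l' \<in> topspace ?W" for l'
    proof -
      have l': "l' \<in> near_loops m l" "l' \<in> topspace ?A" using that topW by auto
      have Hc: "continuous_map unit_top ?A (\<lambda>s. H (l', s))" by (rule continuous_map_section[OF H(1) that])
      have PH: "P l 1 = H (l', 0)" using P[OF l] H(2)[OF l'(1)] by simp
      have Pl: "continuous_map unit_top ?A (P l)" "P l 0 = base_loop" using P[OF l] by blast+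
      have Hl: "H (l', 1) = l'" using H(2)[OF l'(1)] by blast
      have "G l' = angle (\<lambda>s. g (loop_concat (P l) (\<lambda>s. H (l', s)) s))"
        by (rule Geq[OF l'(2) continuous_map_path_concat[OF Pl(1) Hc PH]]) (simp_all only: loop_concat_ends Pl(2) Hl)
      also have "\<dots> = G l + angle (\<lambda>s. g (H (l', s)))"
        unfolding G_def by (rule angle_comp_concat[OF g(1) Pl(1) Hc PH])
      also have "angle (\<lambda>s. g (H (l', s))) = \<theta> (l', 1) - \<theta> (l', 0)"
      proof (rule angle_eqI)
        show "continuous_on {0..1} (\<lambda>s. \<theta> (l', s))" using continuous_map_section[OF \<theta>(1) that] by simp
        show "g (H (l', t)) = cis (\<theta> (l', t))" if "t \<in> {0..1}" for t using \<theta>(2) \<open>l' \<in> topspace ?W\<close> that by blast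
      qed
      also have "\<theta> (l', 0) = G l" using \<theta>(3) that by blast
      finally show ?thesis by simp
    qed
    then show ?thesis
      using continuous_map_eq[OF continuous_map_section2[OF \<theta>(1), of 1], of G] by simp
  qed
  have "continuous_map ?A euclideanreal G"
  proof (rule pasting_lemma[of "topspace ?A" ?A "near_loops m" euclideanreal "\<lambda>_. G"])
    show "\<exists>j. j \<in> topspace ?A \<and> x \<in> near_loops m j \<and> G x = G x" if "x \<in> topspace ?A" for x
      using near_loops_self[OF that] that by blast
  qed (use openin_near_loops loc in auto)
  moreover have "G base_loop = 0"
  proof -
    have "continuous_map unit_top ?A (\<lambda>_. base_loop)" by (rule continuous_map_const[THEN iffD2]) (simp add: base_loop_in)
    then have "G base_loop = angle (\<lambda>s. g base_loop)" by (intro Geq base_loop_in) simp_all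
    also have "\<dots> = (\<lambda>_. 0) 1 - (\<lambda>_. 0) 0" by (rule angle_eqI) (simp_all add: g(2))
    finally show ?thesis by simp
  qed
  ultimately show ?thesis using Gcis by blast
qed

lemma lift_sphere_loops_3:
  assumes m: "m \<ge> 3" and g: "continuous_map (sphere_loops m) circle_top g" "g base_loop = 1"
  shows "\<exists>\<theta>. continuous_map (sphere_loops m) euclideanreal \<theta> \<and> (\<forall>l\<in>topspace (sphere_loops m). g l = cis (\<theta> l)) \<and>
    \<theta> base_loop = 0"
proof (rule lift_sphere_loops[OF _ g])
  fix C assume C: "continuous_map unit_top (sphere_loops m) C" "C 0 = base_loop" "C 1 = base_loop"
  obtain H where H: "continuous_map (prod_topology unit_top unit_top) (sphere_loops m) H"
    "\<forall>s\<in>{0..1}. H (s, 0) = base_loop \<and> H (s, 1) = C s" "\<forall>r\<in>{0..1}. H (0, r) = base_loop \<and> H (1, r) = base_loop"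
    using simply_connected_sphere_loops[OF m C] by blast
  have "angle (\<lambda>s. g (H (s, 1))) = 0"
    using continuous_map_compose[OF H(1) g(1)] H(2,3) g(2)
    by (intro angle_nullhomotopic[of "\<lambda>z. g (H z)"]) (simp_all add: o_def)
  moreover have "angle (\<lambda>s. g (C s)) = angle (\<lambda>s. g (H (s, 1)))"
    using H(2) by (intro angle_cong) simp
  ultimately show "angle (\<lambda>s. g (C s)) = 0" by simp
qed (use m in simp)

section \<open>Circle bundles with total space an odd sphere\<close>

lemma continuous_map_comp1:
  assumes "continuous_map X euclidean f" "continuous_on UNIV h"
  shows "continuous_map X euclidean (\<lambda>x. h (f x))"
  using continuous_map_compose[OF assms(1), of euclidean h] assms(2) unfolding o_def by simp

lemma continuous_map_comp2:
  assumes "continuous_map X euclidean f" "continuous_map X euclidean g" "continuous_on UNIV (\<lambda>z. h (fst z) (snd z))"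
  shows "continuous_map X euclidean (\<lambda>x. h (f x) (g x))"
proof -
  have "continuous_map X (prod_topology euclidean euclidean) (\<lambda>x. (f x, g x))"
    using assms(1,2) by (intro continuous_map_paired[THEN iffD2] conjI)
  then have "continuous_map X euclidean (\<lambda>x. (f x, g x))" unfolding prod_topology_euclidean .
  from continuous_map_comp1[OF this assms(3)] show ?thesis by simp
qed

lemma continuous_map_into_circle:
  "continuous_map X circle_top f \<longleftrightarrow> continuous_map X euclidean f \<and> (\<forall>x\<in>topspace X. cmod (f x) = 1)"
  by (auto simp: continuous_map_in_subtopology Pi_iff)

lemma continuous_map_circle_mult:
  assumes "continuous_map X circle_top f" "continuous_map X circle_top g"
  shows "continuous_map X circle_top (\<lambda>x. f x * g x)"
  using assms unfolding continuous_map_into_circle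
  by (auto simp: norm_mult intro!: continuous_map_comp2[where h = "(*)"] continuous_intros)

lemma continuous_map_circle_cnj:
  assumes "continuous_map X circle_top f"
  shows "continuous_map X circle_top (\<lambda>x. cnj (f x))"
  using assms unfolding continuous_map_into_circle
  by (auto intro!: continuous_map_comp1[where h = cnj] continuous_intros)

lemma continuous_map_circle_cis:
  assumes "continuous_map X euclideanreal f"
  shows "continuous_map X circle_top (\<lambda>x. cis (f x))"
  using assms unfolding continuous_map_into_circle
  by (auto intro!: continuous_map_comp1[where h = cis] continuous_intros)

lemma circle_cnj: "cmod u = 1 \<Longrightarrow> u * cnj u = 1" "cmod u = 1 \<Longrightarrow> cnj u * u = 1"
  using complex_norm_square[of u] by (simp_all only: mult.commute[of "cnj u" u]) simp_all

lemma angle_cnj: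
  assumes "continuous_map unit_top circle_top c"
  shows "angle (\<lambda>t. cnj (c t)) = - angle c"
proof -
  have "angle (\<lambda>t. c t * cnj (c t)) = angle c + angle (\<lambda>t. cnj (c t))"
    by (rule angle_mult[OF assms continuous_map_circle_cnj[OF assms]])
  moreover have "angle (\<lambda>t. c t * cnj (c t)) = (\<lambda>_. 0) 1 - (\<lambda>_. 0) 0"
    by (rule angle_eqI) (use assms circle_cnj(1) in \<open>auto simp: continuous_map_into_circle\<close>)
  ultimately show ?thesis by simp
qed

lemma complex_coord_eqI:
  assumes "\<And>k. complex_coord x k = complex_coord y k"
  shows "x = y"
proof
  fix i
  have "x (2 * (i div 2)) = y (2 * (i div 2))" "x (2 * (i div 2) + 1) = y (2 * (i div 2) + 1)"
    using assms[of "i div 2"] by (simp_all add: complex_coord_def)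
  moreover have "i = 2 * (i div 2) \<or> i = 2 * (i div 2) + 1" by presburger
  ultimately show "x i = y i" by metis
qed

lemma circle_act_1 [simp]: "circle_act 1 x = x"
  by (rule complex_coord_eqI) (simp add: complex_coord_circle_act)

lemma circle_act_mult: "circle_act u (circle_act v x) = circle_act (u * v) x"
  by (rule complex_coord_eqI) (simp add: complex_coord_circle_act)

definition herm :: "nat \<Rightarrow> (nat \<Rightarrow> real) \<Rightarrow> (nat \<Rightarrow> real) \<Rightarrow> complex" where
  "herm n x y = (\<Sum>k\<le>n. complex_coord x k * cnj (complex_coord y k))"

lemma herm_act_left: "herm n (circle_act u x) y = u * herm n x y"
  by (simp add: herm_def complex_coord_circle_act sum_distrib_left mult.assoc)

lemma herm_act_right: "herm n x (circle_act u y) = cnj u * herm n x y"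
  by (simp add: herm_def complex_coord_circle_act sum_distrib_left mult_ac)

lemma herm_self:
  assumes "x \<in> topspace (nsphere (2 * n + 1))"
  shows "herm n x x = 1"
proof -
  have "herm n x x = of_real (\<Sum>k\<le>n. cmod (complex_coord x k) ^ 2)"
    unfolding herm_def of_real_sum by (rule sum.cong) (simp_all only: complex_norm_square)
  also have "(\<Sum>k\<le>n. cmod (complex_coord x k) ^ 2) = 1"
    using assms unfolding topspace_nsphere_iff sum_squares_complex_coord by blast
  finally show ?thesis by simp
qed

lemma continuous_map_complex_coord:
  assumes "continuous_map X (nsphere m) f"
  shows "continuous_map X euclidean (\<lambda>x. complex_coord (f x) k)"
  unfolding complex_coord_def
  by (rule continuous_map_comp2[where h = Complex, OF continuous_map_nsphere_component[OF assms] continuous_map_nsphere_component[OF assms]])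
     (intro continuous_intros)

lemma continuous_map_herm:
  assumes "continuous_map X (nsphere m) f" "continuous_map X (nsphere m) g"
  shows "continuous_map X euclidean (\<lambda>x. herm n (f x) (g x))"
  unfolding herm_def
proof (rule continuous_map_sum)
  show "continuous_map X euclidean (\<lambda>x. complex_coord (f x) k * cnj (complex_coord (g x) k))" for k
    by (rule continuous_map_comp2[where h = "\<lambda>a b. a * cnj b", OF continuous_map_complex_coord[OF assms(1)] continuous_map_complex_coord[OF assms(2)]])
       (intro continuous_intros)
qed simp

lemma continuous_map_circle_act:
  assumes u: "continuous_map X circle_top u" and f: "continuous_map X (nsphere (2 * n + 1)) f"
  shows "continuous_map X (nsphere (2 * n + 1)) (\<lambda>x. circle_act (u x) (f x))"
proof (rule continuous_map_nsphereI)
  have u': "continuous_map X euclidean u" "\<And>x. x \<in> topspace X \<Longrightarrow> cmod (u x) = 1"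
    using u unfolding continuous_map_into_circle by blast+
  have c: "continuous_map X euclidean (\<lambda>x. u x * complex_coord (f x) k)" for k
    by (rule continuous_map_comp2[where h = "(*)", OF u'(1) continuous_map_complex_coord[OF f]]) (intro continuous_intros)
  have "continuous_map X euclideanreal (\<lambda>x. Re (u x * complex_coord (f x) k))"
    "continuous_map X euclideanreal (\<lambda>x. Im (u x * complex_coord (f x) k))" for k
    by (rule continuous_map_comp1[OF c], intro continuous_intros)+
  then show "continuous_map X euclideanreal (\<lambda>x. circle_act (u x) (f x) i)" for i
    unfolding circle_act_def by (cases "even i") (simp_all only: if_True if_False)
  show "circle_act (u x) (f x) \<in> topspace (nsphere (2 * n + 1))" if "x \<in> topspace X" for x
    using u'(2)[OF that] continuous_map_funspace[OF f] that by (intro circle_act_in_nsphere) auto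
qed

lemma open_map_prod:
  assumes f: "open_map X X' f" and g: "open_map Y Y' g"
  shows "open_map (prod_topology X Y) (prod_topology X' Y') (\<lambda>z. (f (fst z), g (snd z)))"
  unfolding open_map_def
proof (intro allI impI)
  fix U assume U: "openin (prod_topology X Y) U"
  show "openin (prod_topology X' Y') ((\<lambda>z. (f (fst z), g (snd z))) ` U)"
    unfolding openin_prod_topology_alt
  proof (intro allI impI)
    fix a b assume "(a, b) \<in> (\<lambda>z. (f (fst z), g (snd z))) ` U"
    then obtain x y where xy: "(x, y) \<in> U" "a = f x" "b = g y" by auto
    from U xy(1) have "\<exists>V W. openin X V \<and> openin Y W \<and> x \<in> V \<and> y \<in> W \<and> V \<times> W \<subseteq> U"
      unfolding openin_prod_topology_alt by simp
    then obtain V W where VW: "openin X V" "openin Y W" "x \<in> V" "y \<in> W" "V \<times> W \<subseteq> U"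
      by (elim exE conjE)
    have "openin X' (f ` V)" using f VW(1) unfolding open_map_def by simp
    moreover have "openin Y' (g ` W)" using g VW(2) unfolding open_map_def by simp
    moreover have "f ` V \<times> g ` W \<subseteq> (\<lambda>z. (f (fst z), g (snd z))) ` U" using VW(5) by force
    ultimately show "\<exists>V W. openin X' V \<and> openin Y' W \<and> a \<in> V \<and> b \<in> W \<and> V \<times> W \<subseteq> (\<lambda>z. (f (fst z), g (snd z))) ` U"
      unfolding xy(2,3) using VW(3,4) by (intro exI[of _ "f ` V"] exI[of _ "g ` W"] conjI imageI)
  qed
qed

text \<open>The condition \<open>n \<ge> 1\<close> excludes the circle itself, in which the fibre would not be null-homotopic.\<close>

locale circle_bundle =
  fixes n :: nat and B :: "'b topology" and p :: "(nat \<Rightarrow> real) \<Rightarrow> 'b"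
  assumes n: "n \<ge> 1"
    and quotient: "quotient_map (nsphere (2 * n + 1)) B p"
    and fibres: "\<And>x y. x \<in> topspace (nsphere (2 * n + 1)) \<Longrightarrow> y \<in> topspace (nsphere (2 * n + 1)) \<Longrightarrow>
       p x = p y \<longleftrightarrow> (\<exists>u. cmod u = 1 \<and> y = circle_act u x)"
begin

abbreviation "E \<equiv> nsphere (2 * n + 1)"
abbreviation "b0 \<equiv> p sphere_pt"

lemma continuous_p: "continuous_map E B p"
  using quotient by (rule quotient_imp_continuous_map)

lemma p_surj: "p ` topspace E = topspace B"
  using quotient by (rule quotient_imp_surjective_map)

lemma b0: "b0 \<in> topspace B"
  using p_surj sphere_pt_in_nsphere by blast

lemma p_act: "x \<in> topspace E \<Longrightarrow> cmod u = 1 \<Longrightarrow> p (circle_act u x) = p x"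
  using fibres[of x "circle_act u x"] circle_act_in_nsphere[of u x n] by auto

text \<open>The preimage of the image of \<open>U\<close> is the union of the translates of \<open>U\<close> under the circle. Openness, unlike being
  a quotient map, passes to products, so that functions of pairs of fibres can be tested on the total space.\<close>

lemma open_map_p: "open_map E B p"
  unfolding open_map_def
proof (intro allI impI)
  fix U assume U: "openin E U"
  have UE: "U \<subseteq> topspace E" using U by (rule openin_subset)
  have "{x \<in> topspace E. p x \<in> p ` U} = (\<Union>u\<in>sphere 0 1. {x \<in> topspace E. circle_act u x \<in> U})"
  proof (intro equalityI subsetI)
    fix x assume "x \<in> {x \<in> topspace E. p x \<in> p ` U}"
    then obtain y where x: "x \<in> topspace E" and y: "y \<in> U" "p x = p y" by blast
    then obtain u where "cmod u = 1" "y = circle_act u x" using fibres[of x y] UE by blast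
    then show "x \<in> (\<Union>u\<in>sphere 0 1. {x \<in> topspace E. circle_act u x \<in> U})" using x y by auto
  next
    fix x assume "x \<in> (\<Union>u\<in>sphere 0 1. {x \<in> topspace E. circle_act u x \<in> U})"
    then obtain u where "cmod u = 1" "x \<in> topspace E" "circle_act u x \<in> U" by auto
    then show "x \<in> {x \<in> topspace E. p x \<in> p ` U}" using p_act[of x u] by (auto simp: image_iff intro!: bexI[of _ "circle_act u x"])
  qed
  moreover have "openin E {x \<in> topspace E. circle_act u x \<in> U}" if "u \<in> sphere 0 1" for u
  proof -
    have "continuous_map E circle_top (\<lambda>_. u)" using that by (intro continuous_map_const[THEN iffD2]) simp
    from continuous_map_circle_act[OF this continuous_map_id[unfolded id_def]]
    show ?thesis using U by (rule openin_continuous_map_preimage)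
  qed
  ultimately have "openin E {x \<in> topspace E. p x \<in> p ` U}" by (simp only: openin_Union) blast
  moreover have "p ` U \<subseteq> topspace B" using UE p_surj by (metis image_mono)
  ultimately show "openin B (p ` U)"
    using quotient[unfolded quotient_map_def, THEN conjunct2] by simp
qed

text \<open>Since \<open>herm\<close> is continuous, it reads off continuously by which element of the circle two points of one
  fibre differ.\<close>

lemma herm_unit:
  assumes "x \<in> topspace E" "y \<in> topspace E" "p x = p y"
  shows "cmod (herm n x y) = 1" "x = circle_act (herm n x y) y"
proof -
  obtain u where u: "cmod u = 1" "x = circle_act u y"
    using iffD1[OF fibres[OF assms(2,1)] assms(3)[symmetric]] by blast
  have "herm n x y = u" unfolding u(2) herm_act_left herm_self[OF assms(2)] by simp
  then show "cmod (herm n x y) = 1" "x = circle_act (herm n x y) y" using u by simp_all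
qed

text \<open>Short transport moves a point \<open>x\<close> to the nearest point of a fibre that is not orthogonal to \<open>x\<close>.
  A representative \<open>rep b\<close> of the fibre enters its formula, but not its value.\<close>

definition rep :: "'b \<Rightarrow> nat \<Rightarrow> real" where
  "rep b = (SOME x. x \<in> topspace E \<and> p x = b)"

lemma rep:
  assumes "b \<in> topspace B"
  shows "rep b \<in> topspace E \<and> p (rep b) = b"
proof -
  have "b \<in> p ` topspace E" unfolding p_surj by (rule assms)
  then have "\<exists>x. x \<in> topspace E \<and> p x = b" by (metis imageE)
  then show ?thesis unfolding rep_def by (rule someI_ex)
qed

definition closeness :: "'b \<times> 'b \<Rightarrow> real" where
  "closeness z = cmod (herm n (rep (fst z)) (rep (snd z)))"

definition transport :: "(nat \<Rightarrow> real) \<times> 'b \<Rightarrow> nat \<Rightarrow> real" where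
  "transport z = circle_act (sgn (herm n (fst z) (rep (snd z)))) (rep (snd z))"

lemma rep_orbit:
  assumes x: "x \<in> topspace E"
  shows "\<exists>u. cmod u = 1 \<and> rep (p x) = circle_act u x"
proof -
  have "p x \<in> topspace B" using p_surj x by blast
  then have r: "rep (p x) \<in> topspace E" "p (rep (p x)) = p x" using rep by blast+
  show ?thesis using iffD1[OF fibres[OF x r(1)] r(2)[symmetric]] .
qed

lemma closeness_p:
  assumes "x \<in> topspace E" "y \<in> topspace E"
  shows "closeness (p x, p y) = cmod (herm n x y)"
proof -
  obtain u where u: "cmod u = 1" "rep (p x) = circle_act u x" using rep_orbit[OF assms(1)] by blast
  obtain v where v: "cmod v = 1" "rep (p y) = circle_act v y" using rep_orbit[OF assms(2)] by blast
  show ?thesis unfolding closeness_def fst_conv snd_conv u(2) v(2) herm_act_left herm_act_right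
    by (simp only: norm_mult complex_mod_cnj u(1) v(1) mult_1_left)
qed

lemma transport_p:
  assumes "y \<in> topspace E"
  shows "transport (x, p y) = circle_act (sgn (herm n x y)) y"
proof -
  obtain v where v: "cmod v = 1" "rep (p y) = circle_act v y" using rep_orbit[OF assms] by blast
  have "sgn (cnj v) = cnj v" using v(1) by (simp add: sgn_div_norm)
  then have "sgn (cnj v * herm n x y) = cnj v * sgn (herm n x y)"
    using sgn_mult[of "cnj v" "herm n x y"] by (simp only:)
  then have eq: "sgn (cnj v * herm n x y) * v = sgn (herm n x y) * (cnj v * v)"
    by (simp only: mult.assoc mult.left_commute)
  show ?thesis
    unfolding transport_def fst_conv snd_conv v(2) herm_act_right circle_act_mult eq circle_cnj(2)[OF v(1)] mult_1_right ..
qed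

lemma continuous_closeness: "continuous_map (prod_topology B B) euclideanreal closeness"
proof -
  let ?pp = "\<lambda>z. (p (fst z), p (snd z))"
  have cp1: "continuous_map (prod_topology E E) B (\<lambda>z. p (fst z))"
    using continuous_map_compose[OF continuous_map_fst continuous_p] unfolding o_def .
  have cp2: "continuous_map (prod_topology E E) B (\<lambda>z. p (snd z))"
    using continuous_map_compose[OF continuous_map_snd continuous_p] unfolding o_def .
  have q: "quotient_map (prod_topology E E) (prod_topology B B) ?pp"
  proof (rule continuous_open_imp_quotient_map[OF _ open_map_prod[OF open_map_p open_map_p]])
    show "continuous_map (prod_topology E E) (prod_topology B B) ?pp"
      by (intro continuous_map_paired[THEN iffD2] conjI cp1 cp2)
    show "?pp ` topspace (prod_topology E E) = topspace (prod_topology B B)"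
      unfolding topspace_prod_topology p_surj[symmetric] by (force simp: image_iff)
  qed
  have "continuous_map (prod_topology E E) euclideanreal (\<lambda>z. cmod (herm n (fst z) (snd z)))"
    by (rule continuous_map_comp1[OF continuous_map_herm[OF continuous_map_fst continuous_map_snd]]) (intro continuous_intros)
  then have "continuous_map (prod_topology E E) euclideanreal (closeness \<circ> ?pp)"
    by (rule continuous_map_eq) (auto simp: closeness_p)
  with q show ?thesis by (rule continuous_compose_quotient_map)
qed

lemma continuous_transport:
  "continuous_map (subtopology (prod_topology E B) {(x, b). closeness (p x, b) > 0}) E transport"
proof -
  let ?V = "{(x, b). closeness (p x, b) > 0} \<inter> topspace (prod_topology E B)"
  let ?U = "{z \<in> topspace (prod_topology E E). (\<lambda>z. (fst z, p (snd z))) z \<in> ?V}"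
  let ?ip = "\<lambda>z. (fst z, p (snd z))"
  have cp: "continuous_map (prod_topology E E) B (\<lambda>z. p (snd z))"
    using continuous_map_compose[OF continuous_map_snd continuous_p] unfolding o_def .
  have "open_map E E (\<lambda>x. x)" by (simp add: open_map_def)
  from open_map_prod[OF this open_map_p]
  have q: "quotient_map (prod_topology E E) (prod_topology E B) ?ip"
  proof (rule continuous_open_imp_quotient_map[rotated])
    show "continuous_map (prod_topology E E) (prod_topology E B) ?ip"
      by (intro continuous_map_paired[THEN iffD2] conjI continuous_map_fst cp)
    show "?ip ` topspace (prod_topology E E) = topspace (prod_topology E B)"
      unfolding topspace_prod_topology p_surj[symmetric] by (force simp: image_iff)
  qed
  have "continuous_map (prod_topology E B) B (\<lambda>z. p (fst z))"
    using continuous_map_compose[OF continuous_map_fst continuous_p] unfolding o_def .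
  then have "continuous_map (prod_topology E B) (prod_topology B B) (\<lambda>z. (p (fst z), snd z))"
    by (intro continuous_map_paired[THEN iffD2] conjI continuous_map_snd)
  from continuous_map_compose[OF this continuous_closeness]
  have "continuous_map (prod_topology E B) euclideanreal (\<lambda>z. closeness (p (fst z), snd z))" unfolding o_def .
  from openin_continuous_map_preimage[OF this, of "{0<..}"]
  have "openin (prod_topology E B) {z \<in> topspace (prod_topology E B). closeness (p (fst z), snd z) \<in> {0<..}}"
    by simp
  also have "{z \<in> topspace (prod_topology E B). closeness (p (fst z), snd z) \<in> {0<..}} = ?V" by auto
  finally have V: "openin (prod_topology E B) ?V" .
  have qr: "quotient_map (subtopology (prod_topology E E) ?U) (subtopology (prod_topology E B) ?V) ?ip"
    by (rule quotient_map_restriction[OF q refl]) (use V in blast)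
  have U0: "herm n (fst z) (snd z) \<noteq> 0" if "z \<in> ?U" for z
    using that closeness_p[of "fst z" "snd z"] by auto
  let ?X = "subtopology (prod_topology E E) ?U"
  have f: "continuous_map ?X E fst" and s: "continuous_map ?X E snd"
    by (rule continuous_map_from_subtopology[OF continuous_map_fst], rule continuous_map_from_subtopology[OF continuous_map_snd])
  have h: "continuous_map ?X (top_of_set (- {0})) (\<lambda>z. herm n (fst z) (snd z))"
    unfolding continuous_map_in_subtopology using continuous_map_herm[OF f s] U0 by auto
  have "continuous_on (- {0}) (\<lambda>z::complex. sgn z)" by (intro continuous_intros) auto
  then have "continuous_map (top_of_set (- {0})) circle_top (\<lambda>z::complex. sgn z)"
    unfolding continuous_map_into_circle by (auto simp: norm_sgn)
  from continuous_map_compose[OF h this]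
  have "continuous_map ?X circle_top (\<lambda>z. sgn (herm n (fst z) (snd z)))" unfolding o_def .
  from continuous_map_circle_act[OF this s]
  have "continuous_map ?X E (transport \<circ> ?ip)"
    by (rule continuous_map_eq) (auto simp: transport_p)
  from continuous_compose_quotient_map[OF qr this]
  have "continuous_map (subtopology (prod_topology E B) ?V) E transport" .
  then show ?thesis by (metis inf_commute subtopology_restrict)
qed

lemma lift_homotopy:
  fixes F :: "'a \<times> real \<Rightarrow> 'b"
  assumes F: "continuous_map (prod_topology A unit_top) B F"
    and f0: "continuous_map A E f0" "\<And>a. a \<in> topspace A \<Longrightarrow> p (f0 a) = F (a, 0)"
  shows "\<exists>H. continuous_map (prod_topology A unit_top) E H \<and>
    (\<forall>a\<in>topspace A. \<forall>t\<in>{0..1}. p (H (a, t)) = F (a, t)) \<and> (\<forall>a\<in>topspace A. H (a, 0) = f0 a) \<and>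
    (\<forall>a\<in>topspace A. (\<forall>s\<in>{0..1}. F (a, s) = F (a, 0)) \<longrightarrow> (\<forall>t\<in>{0..1}. H (a, t) = f0 a))"
proof (rule lift_by_short_transports[of E B p closeness transport A F f0])
  show "closeness (b, b) > 0" if "b \<in> topspace B" for b
    using rep[OF that] herm_self[of "rep b" n] by (simp add: closeness_def)
  show "p (transport (x, b)) = b" if x: "x \<in> topspace E" and b: "b \<in> topspace B" and pos: "closeness (p x, b) > 0" for x b
  proof -
    have r: "rep b \<in> topspace E" "p (rep b) = b" using rep[OF b] by blast+
    have "herm n x (rep b) \<noteq> 0" using closeness_p[OF x r(1)] pos r(2) by auto
    then have "cmod (sgn (herm n x (rep b))) = 1" by (simp add: norm_sgn)
    from p_act[OF r(1) this] show ?thesis using r(2) unfolding transport_def by simp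
  qed
  show "transport (x, p x) = x" if "x \<in> topspace E" for x
    unfolding transport_p[OF that] herm_self[OF that] by simp
next
  fix H assume H: "continuous_map (prod_topology A unit_top) E H"
    "\<And>a t. a \<in> topspace A \<Longrightarrow> t \<in> {0..1} \<Longrightarrow> p (H (a, t)) = F (a, t)"
    "\<And>a. a \<in> topspace A \<Longrightarrow> H (a, 0) = f0 a"
    "\<And>a t. a \<in> topspace A \<Longrightarrow> (\<And>s. s \<in> {0..1} \<Longrightarrow> F (a, s) = F (a, 0)) \<Longrightarrow> t \<in> {0..1} \<Longrightarrow> H (a, t) = f0 a"
  show ?thesis
    using H(2,3,4) by (intro exI[of _ H] conjI H(1) ballI impI) (simp_all only:)
qed (fact continuous_p continuous_closeness continuous_transport F f0)+

end

section \<open>Holonomy of loops in the base\<close>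

lemma continuous_map_endpoint:
  assumes "continuous_map (prod_topology X unit_top) Z f"
  shows "continuous_map X Z (\<lambda>x. f (x, 0))" "continuous_map X Z (\<lambda>x. f (x, 1))"
  using continuous_map_section2[OF assms, of 0] continuous_map_section2[OF assms, of 1] by simp_all

lemma complex_coord_sphere_pt: "complex_coord sphere_pt k = (if k = 0 then 1 else 0)"
  by (simp add: complex_coord_def sphere_pt_def complex_eq_iff)

lemma herm_sphere_pt: "herm n sphere_pt sphere_pt = 1"
  using herm_self[OF sphere_pt_in_nsphere] .

context circle_bundle
begin

abbreviation "OB \<equiv> loop_space B b0"
abbreviation "OE \<equiv> sphere_loops (2 * n + 1)"

lemma const_loop_OB: "const_loop b0 \<in> topspace OB"
  by (rule const_loop_in_loop_space[OF b0])

lemma lift_ratio: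
  assumes f: "continuous_map X E f" and g: "continuous_map X E g"
    and pfg: "\<And>x. x \<in> topspace X \<Longrightarrow> p (f x) = p (g x)"
  shows "continuous_map X circle_top (\<lambda>x. herm n (f x) (g x))"
    "\<And>x. x \<in> topspace X \<Longrightarrow> f x = circle_act (herm n (f x) (g x)) (g x)"
proof -
  have fE: "f x \<in> topspace E" and gE: "g x \<in> topspace E" if "x \<in> topspace X" for x
    using continuous_map_funspace[OF f] continuous_map_funspace[OF g] that by blast+
  show "continuous_map X circle_top (\<lambda>x. herm n (f x) (g x))"
    unfolding continuous_map_into_circle
    using continuous_map_herm[OF f g] herm_unit(1)[OF fE gE pfg] by blast
  show "f x = circle_act (herm n (f x) (g x)) (g x)" if "x \<in> topspace X" for x
    by (rule herm_unit(2)[OF fE gE pfg]) (fact that)+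
qed

definition is_horizontal :: "((real \<Rightarrow> 'b) \<times> real \<Rightarrow> nat \<Rightarrow> real) \<Rightarrow> bool" where
  "is_horizontal L \<longleftrightarrow> continuous_map (prod_topology OB unit_top) E L \<and>
     (\<forall>l\<in>topspace OB. \<forall>t\<in>{0..1}. p (L (l, t)) = l t) \<and> (\<forall>l\<in>topspace OB. L (l, 0) = sphere_pt) \<and>
     (\<forall>t\<in>{0..1}. L (const_loop b0, t) = sphere_pt)"

text \<open>All loops of the base are lifted at once: the evaluation map is itself a family of paths, parametrised by
  the loop space. That the lifts depend continuously on the loop is what makes the holonomy continuous.\<close>

definition horizontal :: "(real \<Rightarrow> 'b) \<times> real \<Rightarrow> nat \<Rightarrow> real" where
  "horizontal = (SOME L. is_horizontal L)"

lemma is_horizontal: "is_horizontal horizontal"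
proof -
  have e: "continuous_map OB E (\<lambda>_. sphere_pt)"
    by (rule continuous_map_const[THEN iffD2]) (simp add: sphere_pt_in_nsphere)
  have "b0 = (\<lambda>(l, t). l t) (l, 0)" if "l \<in> topspace OB" for l
    using that unfolding topspace_loop_space by simp
  from lift_homotopy[OF continuous_map_eval_loop e this]
  obtain L where L: "continuous_map (prod_topology OB unit_top) E L"
    "\<forall>l\<in>topspace OB. \<forall>t\<in>{0..1}. p (L (l, t)) = (\<lambda>(l, t). l t) (l, t)" "\<forall>l\<in>topspace OB. L (l, 0) = sphere_pt"
    "\<forall>l\<in>topspace OB. (\<forall>s\<in>{0..1}. (\<lambda>(l, t). l t) (l, s) = (\<lambda>(l, t). l t) (l, 0)) \<longrightarrow> (\<forall>t\<in>{0..1}. L (l, t) = sphere_pt)"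
    by blast
  have "\<forall>t\<in>{0..1}. L (const_loop b0, t) = sphere_pt"
    using L(4)[rule_format, OF const_loop_OB] by (simp add: const_loop_def)
  then have "is_horizontal L" unfolding is_horizontal_def using L(1,2,3) by simp
  then show ?thesis unfolding horizontal_def by (rule someI[of is_horizontal])
qed

lemma horizontal:
  "continuous_map (prod_topology OB unit_top) E horizontal"
  "\<And>l t. l \<in> topspace OB \<Longrightarrow> t \<in> {0..1} \<Longrightarrow> p (horizontal (l, t)) = l t"
  "\<And>l. l \<in> topspace OB \<Longrightarrow> horizontal (l, 0) = sphere_pt"
  "\<And>t. t \<in> {0..1} \<Longrightarrow> horizontal (const_loop b0, t) = sphere_pt"
  using is_horizontal unfolding is_horizontal_def by simp_all

lemma horizontal_in: "l \<in> topspace OB \<Longrightarrow> t \<in> {0..1} \<Longrightarrow> horizontal (l, t) \<in> topspace E"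
  using continuous_map_funspace[OF horizontal(1)] by auto

lemma continuous_map_horizontal:
  assumes "continuous_map X OB f" "continuous_map X unit_top \<tau>"
  shows "continuous_map X E (\<lambda>x. horizontal (f x, \<tau> x))"
proof -
  have "continuous_map X (prod_topology OB unit_top) (\<lambda>x. (f x, \<tau> x))"
    using assms by (intro continuous_map_paired[THEN iffD2] conjI)
  from continuous_map_compose[OF this horizontal(1)] show ?thesis unfolding o_def .
qed

text \<open>The element of the circle that takes the base point to the end of the lift.\<close>

definition holonomy :: "(real \<Rightarrow> 'b) \<Rightarrow> complex" where
  "holonomy l = herm n (horizontal (l, 1)) sphere_pt"

lemma horizontal_1:
  assumes "l \<in> topspace OB"
  shows "horizontal (l, 1) = circle_act (holonomy l) sphere_pt" "cmod (holonomy l) = 1"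
proof -
  have "p (horizontal (l, 1)) = p sphere_pt"
    using horizontal(2)[OF assms, of 1] assms unfolding topspace_loop_space by simp
  from herm_unit[OF horizontal_in[OF assms] sphere_pt_in_nsphere this]
  show "horizontal (l, 1) = circle_act (holonomy l) sphere_pt" "cmod (holonomy l) = 1"
    unfolding holonomy_def by simp_all
qed

lemma continuous_holonomy: "continuous_map OB circle_top holonomy"
proof -
  have "continuous_map OB E (\<lambda>l. horizontal (l, 1))"
    by (rule continuous_map_endpoint(2)[OF horizontal(1)])
  moreover have "continuous_map OB E (\<lambda>_. sphere_pt)"
    by (rule continuous_map_const[THEN iffD2]) (simp add: sphere_pt_in_nsphere)
  ultimately have "continuous_map OB euclidean holonomy"
    unfolding holonomy_def by (rule continuous_map_herm)
  then show ?thesis unfolding continuous_map_into_circle using horizontal_1(2) by blast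
qed

lemma holonomy_const: "holonomy (const_loop b0) = 1"
  unfolding holonomy_def by (simp add: horizontal(4) herm_sphere_pt)

lemma holonomy_comp:
  "continuous_map X OB f \<Longrightarrow> continuous_map X circle_top (\<lambda>x. holonomy (f x))"
  using continuous_map_compose[OF _ continuous_holonomy] unfolding o_def .

text \<open>Any other family of lifts with the same starting point differs from the chosen one by a factor in
  the circle that starts at \<open>1\<close>, so its end points give a map homotopic to the holonomy.\<close>

lemma compare_lift:
  assumes F: "continuous_map (prod_topology X unit_top) E F" and f: "continuous_map X OB f"
    and start: "\<And>x. x \<in> topspace X \<Longrightarrow> F (x, 0) = sphere_pt"
    and pF: "\<And>x t. x \<in> topspace X \<Longrightarrow> t \<in> {0..1} \<Longrightarrow> p (F (x, t)) = f x t"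
  defines "u \<equiv> \<lambda>z. herm n (F z) (horizontal (f (fst z), snd z))"
  shows "continuous_map (prod_topology X unit_top) circle_top u"
    "\<And>x. x \<in> topspace X \<Longrightarrow> u (x, 0) = 1"
    "\<And>x t. x \<in> topspace X \<Longrightarrow> t \<in> {0..1} \<Longrightarrow> F (x, t) = circle_act (u (x, t)) (horizontal (f x, t))"
    "\<And>x. x \<in> topspace X \<Longrightarrow> herm n (F (x, 1)) sphere_pt = u (x, 1) * holonomy (f x)"
    "\<And>x t. f x = const_loop b0 \<Longrightarrow> F (x, t) = sphere_pt \<Longrightarrow> t \<in> {0..1} \<Longrightarrow> u (x, t) = 1"
proof -
  let ?X = "prod_topology X unit_top"
  have ff: "continuous_map ?X OB (\<lambda>z. f (fst z))"
    using continuous_map_compose[OF continuous_map_fst f] unfolding o_def .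
  have h: "continuous_map ?X E (\<lambda>z. horizontal (f (fst z), snd z))"
    by (rule continuous_map_horizontal[OF ff continuous_map_snd])
  have fin: "f x \<in> topspace OB" if "x \<in> topspace X" for x
    using continuous_map_funspace[OF f] that by blast
  have eq: "p (F z) = p (horizontal (f (fst z), snd z))" if "z \<in> topspace ?X" for z
  proof -
    have z: "fst z \<in> topspace X" "snd z \<in> {0..1}" using that by auto
    show ?thesis using pF[OF z] horizontal(2)[OF fin[OF z(1)] z(2)] by simp
  qed
  note r = lift_ratio[OF F h eq]
  show "continuous_map ?X circle_top u" unfolding u_def by (rule r(1))
  show "u (x, 0) = 1" if "x \<in> topspace X" for x
    unfolding u_def using start[OF that] horizontal(3)[OF fin[OF that]] by (simp add: herm_sphere_pt)
  show 1: "F (x, t) = circle_act (u (x, t)) (horizontal (f x, t))" if "x \<in> topspace X" "t \<in> {0..1}" for x t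
    using r(2)[of "(x, t)"] that unfolding u_def by simp
  show "herm n (F (x, 1)) sphere_pt = u (x, 1) * holonomy (f x)" if "x \<in> topspace X" for x
  proof -
    have "F (x, 1) = circle_act (u (x, 1)) (horizontal (f x, 1))" by (rule 1[OF that]) simp
    then show ?thesis by (simp only: herm_act_left holonomy_def)
  qed
  show "u (x, t) = 1" if "f x = const_loop b0" "F (x, t) = sphere_pt" "t \<in> {0..1}" for x t
    unfolding u_def fst_conv snd_conv that(1,2) horizontal(4)[OF that(3)] by (rule herm_sphere_pt)
qed

text \<open>The ratio of the two families of end points contracts along the lifts, so it has angle zero.\<close>

lemma angle_holonomy_of_lift:
  assumes F: "continuous_map (prod_topology unit_top unit_top) E F" and f: "continuous_map unit_top OB f"
    and start: "\<And>s. s \<in> {0..1} \<Longrightarrow> F (s, 0) = sphere_pt"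
    and pF: "\<And>s t. s \<in> {0..1} \<Longrightarrow> t \<in> {0..1} \<Longrightarrow> p (F (s, t)) = f s t"
    and f01: "f 0 = const_loop b0" "f 1 = const_loop b0"
    and F01: "\<And>t. t \<in> {0..1} \<Longrightarrow> F (0, t) = sphere_pt" "\<And>t. t \<in> {0..1} \<Longrightarrow> F (1, t) = sphere_pt"
  shows "angle (\<lambda>s. holonomy (f s)) = angle (\<lambda>s. herm n (F (s, 1)) sphere_pt)"
proof -
  define u where "u z = herm n (F z) (horizontal (f (fst z), snd z))" for z
  have st: "F (s, 0) = sphere_pt" if "s \<in> topspace unit_top" for s using start that by simp
  have pf: "p (F (s, t)) = f s t" if "s \<in> topspace unit_top" "t \<in> {0..1}" for s t using pF that by simp
  note c = compare_lift[OF F f st pf, folded u_def]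
  have u0: "angle (\<lambda>s. u (s, 1)) = 0"
    using c(2,5) f01 F01 by (intro angle_nullhomotopic c(1)) simp_all
  have uc: "continuous_map unit_top circle_top (\<lambda>s. u (s, 1))"
    by (rule continuous_map_endpoint(2)[OF c(1)])
  have "angle (\<lambda>s. herm n (F (s, 1)) sphere_pt) = angle (\<lambda>s. u (s, 1) * holonomy (f s))"
    by (rule angle_cong) (use c(4) in simp)
  also have "\<dots> = angle (\<lambda>s. u (s, 1)) + angle (\<lambda>s. holonomy (f s))"
    by (rule angle_mult[OF uc holonomy_comp[OF f]])
  finally show ?thesis using u0 by simp
qed

lemma continuous_loop_map_p: "continuous_map OE OB (loop_map p)"
proof (rule continuous_map_curry_loop)
  have "continuous_map (prod_topology OE unit_top) B (\<lambda>z. p (fst z (snd z)))"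
    using continuous_map_compose[OF continuous_map_eval_loop[unfolded split_def] continuous_p] unfolding o_def .
  then show "continuous_map (prod_topology OE unit_top) B (\<lambda>(l, t). loop_map p l t)"
    by (rule continuous_map_eq) (auto simp: loop_map_def)
  show "loop_map p l \<in> extensional {0..1} \<and> loop_map p l 0 = b0 \<and> loop_map p l 1 = b0" if "l \<in> topspace OE" for l
    using that unfolding topspace_loop_space by (simp add: loop_map_def)
qed

lemma loop_map_const: "loop_map p base_loop = const_loop b0"
  by (auto simp: loop_map_def const_loop_def restrict_def fun_eq_iff)

text \<open>Loops that come from the sphere have closed lifts.\<close>

lemma angle_holonomy_loop_map:
  assumes C: "continuous_map unit_top OE C" "C 0 = base_loop" "C 1 = base_loop"
  shows "angle (\<lambda>s. holonomy (loop_map p (C s))) = 0"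
proof -
  have pC: "continuous_map unit_top OB (\<lambda>s. loop_map p (C s))"
    using continuous_map_compose[OF C(1) continuous_loop_map_p] unfolding o_def .
  have "angle (\<lambda>s. holonomy (loop_map p (C s))) = angle (\<lambda>s. herm n ((\<lambda>z. C (fst z) (snd z)) (s, 1)) sphere_pt)"
  proof (rule angle_holonomy_of_lift[OF continuous_map_uncurry_loop[OF C(1), unfolded split_def] pC])
    show "(\<lambda>z. C (fst z) (snd z)) (s, 0) = sphere_pt" if "s \<in> {0..1}" for s
      using loop_map_values(1)[OF C(1)] that by simp
    show "p ((\<lambda>z. C (fst z) (snd z)) (s, t)) = loop_map p (C s) t" if "s \<in> {0..1}" "t \<in> {0..1}" for s t
      using that by (simp add: loop_map_def)
    show "loop_map p (C 0) = const_loop b0" "loop_map p (C 1) = const_loop b0"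
      unfolding C(2,3) by (rule loop_map_const)+
    show "(\<lambda>z. C (fst z) (snd z)) (0, t) = sphere_pt" "(\<lambda>z. C (fst z) (snd z)) (1, t) = sphere_pt" if "t \<in> {0..1}" for t
      using that C(2,3) by (simp_all add: const_loop_def)
  qed
  also have "\<dots> = angle (\<lambda>_. 1)"
    by (rule angle_cong) (use loop_map_values(2)[OF C(1)] in \<open>simp add: herm_sphere_pt\<close>)
  finally show ?thesis unfolding angle_const_one .
qed

text \<open>Exactness: once the holonomy has a logarithm \<open>\<theta>\<close>, turning the horizontal lift back at constant
  speed \<open>\<theta>\<close> closes it up.\<close>

lemma lift_of_zero_holonomy:
  assumes f: "continuous_map A OB f" and \<theta>: "continuous_map A euclideanreal \<theta>"
    and hol: "\<And>a. a \<in> topspace A \<Longrightarrow> holonomy (f a) = cis (\<theta> a)"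
  shows "\<exists>f'. continuous_map A OE f' \<and> (\<forall>a\<in>topspace A. loop_map p (f' a) = f a) \<and>
    (\<forall>a. f a = const_loop b0 \<and> \<theta> a = 0 \<longrightarrow> f' a = base_loop)"
proof -
  let ?X = "prod_topology A unit_top"
  let ?k = "\<lambda>a t. circle_act (cis (- (t * \<theta> a))) (horizontal (f a, t))"
  define f' where "f' a = restrict (?k a) {0..1}" for a
  have fin: "f a \<in> topspace OB" if "a \<in> topspace A" for a
    using continuous_map_funspace[OF f] that by blast
  have ext: "f a \<in> extensional {0..1}" if "a \<in> topspace A" for a
    using loop_map_values(3)[OF f that] .
  have "continuous_map A OE f'"
  proof (rule continuous_map_curry_loop)
    have ff: "continuous_map ?X OB (\<lambda>z. f (fst z))"
      using continuous_map_compose[OF continuous_map_fst f] unfolding o_def .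
    have ft: "continuous_map ?X euclideanreal (\<lambda>z. \<theta> (fst z))"
      using continuous_map_compose[OF continuous_map_fst \<theta>] unfolding o_def .
    have fs: "continuous_map ?X euclideanreal snd"
      using continuous_map_snd[of A unit_top] unfolding continuous_map_in_subtopology by blast
    have "continuous_map ?X circle_top (\<lambda>z. cis (- (snd z * \<theta> (fst z))))"
      by (intro continuous_map_circle_cis continuous_map_minus continuous_map_real_mult ft fs)
    from continuous_map_circle_act[OF this continuous_map_horizontal[OF ff continuous_map_snd]]
    show "continuous_map ?X E (\<lambda>(a, t). f' a t)"
      by (rule continuous_map_eq) (auto simp: f'_def)
    show "f' a \<in> extensional {0..1} \<and> f' a 0 = sphere_pt \<and> f' a 1 = sphere_pt" if a: "a \<in> topspace A" for a
    proof -
      have "?k a 1 = circle_act (cis (- \<theta> a) * cis (\<theta> a)) sphere_pt"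
        unfolding horizontal_1(1)[OF fin[OF a]] circle_act_mult hol[OF a] by simp
      also have "\<dots> = sphere_pt" by (simp add: cis_mult)
      finally have "?k a 1 = sphere_pt" .
      moreover have "?k a 0 = sphere_pt" using horizontal(3)[OF fin[OF a]] by simp
      ultimately show ?thesis unfolding f'_def by simp
    qed
  qed
  moreover have "loop_map p (f' a) = f a" if a: "a \<in> topspace A" for a
  proof -
    have "p (?k a t) = f a t" if t: "t \<in> {0..1}" for t
      using p_act[OF horizontal_in[OF fin[OF a] t], of "cis (- (t * \<theta> a))"] horizontal(2)[OF fin[OF a] t] by simp
    then have "loop_map p (f' a) = restrict (f a) {0..1}"
      unfolding loop_map_def f'_def by (intro restrict_ext) simp
    then show ?thesis using ext[OF a] by (simp add: extensional_restrict)
  qed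
  moreover have "f' a = base_loop" if "f a = const_loop b0 \<and> \<theta> a = 0" for a
    unfolding f'_def const_loop_def using that horizontal(4) by (intro restrict_ext) simp
  ultimately show ?thesis by blast
qed

text \<open>The fibre through the base point is null-homotopic in the sphere: the first complex coordinate moves along
  the straight line from \<open>c\<close> to \<open>1\<close>, and the second one, present as \<open>n \<ge> 1\<close>, makes up for the length lost.\<close>

definition orbit_null :: "complex \<Rightarrow> real \<Rightarrow> nat \<Rightarrow> real" where
  "orbit_null c s = (\<lambda>i. if i = 0 then Re ((1 - s) * c + s) else if i = 1 then Im ((1 - s) * c + s)
     else if i = 2 then sqrt (1 - (cmod ((1 - s) * c + s))\<^sup>2) else 0)"

lemma orbit_null_in:
  assumes c: "cmod c = 1" and s: "s \<in> {0..1}"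
  shows "orbit_null c s \<in> topspace E"
proof -
  let ?z = "(1 - s) * c + s"
  have "cmod ?z \<le> cmod ((1 - s) * c) + cmod (of_real s)" by (rule norm_triangle_ineq)
  also have "\<dots> = 1"
  proof -
    have "1 - complex_of_real s = complex_of_real (1 - s)" by simp
    then have "cmod (1 - complex_of_real s) = 1 - s" using s by (simp only: norm_of_real) simp
    then show ?thesis unfolding norm_mult c using s by simp
  qed
  finally have z: "(cmod ?z)\<^sup>2 \<le> 1" by (simp add: power_le_one)
  have n2: "2 \<le> 2 * n + 1" using n by linarith
  have "(\<Sum>i\<le>2 * n + 1. (orbit_null c s i)\<^sup>2) = (\<Sum>i\<le>2. (orbit_null c s i)\<^sup>2)"
  proof (rule sum.mono_neutral_right)
    show "{..2} \<subseteq> {..2 * n + 1}" using n2 by simp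
    show "\<forall>i\<in>{..2 * n + 1} - {..2}. (orbit_null c s i)\<^sup>2 = 0" by (simp add: orbit_null_def)
  qed simp
  also have "\<dots> = (Re ?z)\<^sup>2 + (Im ?z)\<^sup>2 + (sqrt (1 - (cmod ?z)\<^sup>2))\<^sup>2"
  proof -
    have "{..2::nat} = {0, 1, 2}" by auto
    then show ?thesis by (simp add: orbit_null_def)
  qed
  also have "\<dots> = 1" using z by (simp add: cmod_power2)
  finally have "(\<Sum>i\<le>2 * n + 1. (orbit_null c s i)\<^sup>2) = 1" .
  moreover have "orbit_null c s i = 0" if "i > 2 * n + 1" for i
    using that n by (simp add: orbit_null_def)
  ultimately show ?thesis unfolding topspace_nsphere_iff by blast
qed

lemma orbit_null_1: "orbit_null c 1 = sphere_pt"
  by (simp add: orbit_null_def sphere_pt_def fun_eq_iff)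

lemma orbit_null_fix: "orbit_null 1 s = sphere_pt"
  by (simp add: orbit_null_def sphere_pt_def fun_eq_iff)

lemma orbit_null_0:
  assumes "cmod c = 1"
  shows "orbit_null c 0 = circle_act c sphere_pt"
proof (rule complex_coord_eqI)
  show "complex_coord (orbit_null c 0) k = complex_coord (circle_act c sphere_pt) k" for k
    using assms unfolding complex_coord_circle_act complex_coord_sphere_pt
    by (simp add: complex_coord_def orbit_null_def complex_eq_iff)
qed

lemma continuous_map_orbit_null:
  assumes c: "continuous_map X circle_top c" and s: "continuous_map X unit_top s"
  shows "continuous_map X E (\<lambda>x. orbit_null (c x) (s x))"
proof (rule continuous_map_nsphereI)
  have c': "continuous_map X euclidean c" "\<And>x. x \<in> topspace X \<Longrightarrow> cmod (c x) = 1"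
    using c unfolding continuous_map_into_circle by blast+
  have s': "continuous_map X euclideanreal s" "\<And>x. x \<in> topspace X \<Longrightarrow> s x \<in> {0..1}"
    using s unfolding continuous_map_in_subtopology by (blast, auto)
  have z: "continuous_map X euclidean (\<lambda>x. (1 - complex_of_real (s x)) * c x + complex_of_real (s x))"
    by (rule continuous_map_comp2[where h = "\<lambda>c s. (1 - complex_of_real s) * c + complex_of_real s", OF c'(1) s'(1)])
       (intro continuous_intros)
  show "continuous_map X euclideanreal (\<lambda>x. orbit_null (c x) (s x) i)" for i
  proof -
    have 1: "continuous_map X euclideanreal (\<lambda>x. Re ((1 - complex_of_real (s x)) * c x + complex_of_real (s x)))"
      by (rule continuous_map_comp1[OF z]) (intro continuous_intros)
    have 2: "continuous_map X euclideanreal (\<lambda>x. Im ((1 - complex_of_real (s x)) * c x + complex_of_real (s x)))"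
      by (rule continuous_map_comp1[OF z]) (intro continuous_intros)
    have 3: "continuous_map X euclideanreal (\<lambda>x. sqrt (1 - (cmod ((1 - complex_of_real (s x)) * c x + complex_of_real (s x)))\<^sup>2))"
      by (rule continuous_map_comp1[OF z]) (intro continuous_intros)
    have 4: "continuous_map X euclideanreal (\<lambda>_. 0)" by (rule continuous_map_const[THEN iffD2]) simp
    consider "i = 0" | "i = 1" | "i = 2" | "i \<noteq> 0" "i \<noteq> 1" "i \<noteq> 2" by blast
    then show ?thesis
    proof cases
      case 1 then show ?thesis unfolding orbit_null_def using \<open>continuous_map X euclideanreal (\<lambda>x. Re _)\<close> by simp
    next
      case 2 then show ?thesis unfolding orbit_null_def using \<open>continuous_map X euclideanreal (\<lambda>x. Im _)\<close> by simp
    next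
      case 3 then show ?thesis unfolding orbit_null_def using \<open>continuous_map X euclideanreal (\<lambda>x. sqrt _)\<close> by simp
    next
      case 4 then show ?thesis unfolding orbit_null_def using \<open>continuous_map X euclideanreal (\<lambda>_. 0)\<close> by simp
    qed
  qed
  show "orbit_null (c x) (s x) \<in> topspace E" if "x \<in> topspace X" for x
    by (rule orbit_null_in[OF c'(2)[OF that] s'(2)[OF that]])
qed

text \<open>Projecting the null-homotopies of the fibre gives a section of the holonomy up to homotopy.\<close>

definition orbit_loop :: "complex \<Rightarrow> real \<Rightarrow> 'b" where
  "orbit_loop c = restrict (\<lambda>t. p (orbit_null c (1 - t))) {0..1}"

lemma continuous_orbit_loop:
  assumes c: "continuous_map X circle_top c"
  shows "continuous_map X OB (\<lambda>x. orbit_loop (c x))"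
    "continuous_map (prod_topology X unit_top) E (\<lambda>z. orbit_null (c (fst z)) (1 - snd z))"
proof -
  let ?X = "prod_topology X unit_top"
  have cf: "continuous_map ?X circle_top (\<lambda>z. c (fst z))"
    using continuous_map_compose[OF continuous_map_fst c] unfolding o_def .
  have "continuous_map ?X euclideanreal snd"
    using continuous_map_snd[of X unit_top] unfolding continuous_map_in_subtopology by blast
  then have "continuous_map ?X euclideanreal (\<lambda>z. 1 - snd z)"
    by (rule continuous_map_comp1) (intro continuous_intros)
  then have "continuous_map ?X unit_top (\<lambda>z. 1 - snd z)"
    by (rule continuous_map_unit_topI) auto
  from continuous_map_orbit_null[OF cf this]
  show 1: "continuous_map ?X E (\<lambda>z. orbit_null (c (fst z)) (1 - snd z))" .
  have c1: "cmod (c x) = 1" if "x \<in> topspace X" for x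
    using c that unfolding continuous_map_into_circle by blast
  show "continuous_map X OB (\<lambda>x. orbit_loop (c x))"
  proof (rule continuous_map_curry_loop)
    have "continuous_map ?X B (\<lambda>z. p (orbit_null (c (fst z)) (1 - snd z)))"
      using continuous_map_compose[OF 1 continuous_p] unfolding o_def .
    then show "continuous_map ?X B (\<lambda>(x, t). orbit_loop (c x) t)"
      by (rule continuous_map_eq) (auto simp: orbit_loop_def)
    show "orbit_loop (c x) \<in> extensional {0..1} \<and> orbit_loop (c x) 0 = b0 \<and> orbit_loop (c x) 1 = b0"
      if "x \<in> topspace X" for x
      using p_act[OF sphere_pt_in_nsphere c1[OF that]] unfolding orbit_loop_def
      by (simp add: orbit_null_1 orbit_null_0[OF c1[OF that]])
  qed
qed

lemma orbit_loop_1: "orbit_loop 1 = const_loop b0"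
  unfolding orbit_loop_def const_loop_def orbit_null_fix ..

lemma angle_holonomy_orbit_loop:
  assumes c: "continuous_map unit_top circle_top c" and c01: "c 0 = 1" "c 1 = 1"
  shows "angle (\<lambda>s. holonomy (orbit_loop (c s))) = angle c"
proof -
  let ?F = "\<lambda>z. orbit_null (c (fst z)) (1 - snd z)"
  have c1: "cmod (c s) = 1" if "s \<in> {0..1}" for s
    using c that unfolding continuous_map_into_circle by simp
  have "angle (\<lambda>s. holonomy (orbit_loop (c s))) = angle (\<lambda>s. herm n (?F (s, 1)) sphere_pt)"
  proof (rule angle_holonomy_of_lift[OF continuous_orbit_loop(2)[OF c] continuous_orbit_loop(1)[OF c]])
    show "?F (s, 0) = sphere_pt" for s by (simp add: orbit_null_1)
    show "p (?F (s, t)) = orbit_loop (c s) t" if "t \<in> {0..1}" for s t using that by (simp add: orbit_loop_def)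
    show "orbit_loop (c 0) = const_loop b0" "orbit_loop (c 1) = const_loop b0" unfolding c01 by (rule orbit_loop_1)+
    show "?F (0, t) = sphere_pt" "?F (1, t) = sphere_pt" for t by (simp_all add: c01 orbit_null_fix)
  qed
  also have "\<dots> = angle c"
    by (rule angle_cong) (simp add: orbit_null_0[OF c1] herm_act_left herm_sphere_pt)
  finally show ?thesis .
qed

text \<open>A lift of a product of two loops consists of the lift of the first and the lift of the second, rotated by
  the holonomy of the first.\<close>

lemma angle_holonomy_concat:
  assumes f: "continuous_map unit_top OB f" "f 0 = const_loop b0" "f 1 = const_loop b0"
    and g: "continuous_map unit_top OB g" "g 0 = const_loop b0" "g 1 = const_loop b0"
  shows "angle (\<lambda>s. holonomy (loop_concat (f s) (g s))) = angle (\<lambda>s. holonomy (f s)) + angle (\<lambda>s. holonomy (g s))"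
proof -
  let ?X = "prod_topology unit_top unit_top"
  let ?F = "\<lambda>z. if snd z \<le> 1/2 then horizontal (f (fst z), 2 * snd z)
    else circle_act (holonomy (f (fst z))) (horizontal (g (fst z), 2 * snd z - 1))"
  have fin: "f s \<in> topspace OB" and gin: "g s \<in> topspace OB" if "s \<in> {0..1}" for s
    using continuous_map_funspace[OF f(1)] continuous_map_funspace[OF g(1)] that by auto
  have snd: "continuous_map ?X euclideanreal snd"
    using continuous_map_snd[of unit_top unit_top] unfolding continuous_map_in_subtopology by blast
  have half: "continuous_map ?X euclideanreal (\<lambda>_. 1/2)" by (rule continuous_map_const[THEN iffD2]) simp
  have ff: "continuous_map ?X OB (\<lambda>z. f (fst z))"
    using continuous_map_compose[OF continuous_map_fst f(1)] unfolding o_def .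
  have gf: "continuous_map ?X OB (\<lambda>z. g (fst z))"
    using continuous_map_compose[OF continuous_map_fst g(1)] unfolding o_def .
  have F: "continuous_map ?X E ?F"
  proof (rule continuous_map_cases_le[OF snd half])
    let ?Y = "subtopology ?X {z \<in> topspace ?X. snd z \<le> 1/2}"
    have "continuous_map ?Y euclideanreal (\<lambda>z. 2 * snd z)"
      by (rule continuous_map_comp1[OF continuous_map_from_subtopology[OF snd]]) (intro continuous_intros)
    then have "continuous_map ?Y unit_top (\<lambda>z. 2 * snd z)" by (rule continuous_map_unit_topI) auto
    then show "continuous_map ?Y E (\<lambda>z. horizontal (f (fst z), 2 * snd z))"
      by (rule continuous_map_horizontal[OF continuous_map_from_subtopology[OF ff]])
    let ?Z = "subtopology ?X {z \<in> topspace ?X. 1/2 \<le> snd z}"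
    have "continuous_map ?Z euclideanreal (\<lambda>z. 2 * snd z - 1)"
      by (rule continuous_map_comp1[OF continuous_map_from_subtopology[OF snd]]) (intro continuous_intros)
    then have "continuous_map ?Z unit_top (\<lambda>z. 2 * snd z - 1)" by (rule continuous_map_unit_topI) auto
    then have "continuous_map ?Z E (\<lambda>z. horizontal (g (fst z), 2 * snd z - 1))"
      by (rule continuous_map_horizontal[OF continuous_map_from_subtopology[OF gf]])
    then show "continuous_map ?Z E (\<lambda>z. circle_act (holonomy (f (fst z))) (horizontal (g (fst z), 2 * snd z - 1)))"
      by (rule continuous_map_circle_act[OF holonomy_comp[OF continuous_map_from_subtopology[OF ff]]])
    fix z assume z: "z \<in> topspace ?X" "snd z = 1/2"
    then have s: "fst z \<in> {0..1}" and e: "2 * snd z = 1" by auto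
    show "horizontal (f (fst z), 2 * snd z) = circle_act (holonomy (f (fst z))) (horizontal (g (fst z), 2 * snd z - 1))"
      unfolding e using horizontal_1(1)[OF fin[OF s]] horizontal(3)[OF gin[OF s]] by simp
  qed
  have "angle (\<lambda>s. holonomy (loop_concat (f s) (g s))) = angle (\<lambda>s. herm n (?F (s, 1)) sphere_pt)"
  proof (rule angle_holonomy_of_lift[OF F continuous_map_loop_concat[OF f(1) g(1)]])
    show "?F (s, 0) = sphere_pt" if "s \<in> {0..1}" for s using horizontal(3)[OF fin[OF that]] by simp
    show "p (?F (s, t)) = loop_concat (f s) (g s) t" if s: "s \<in> {0..1}" and t: "t \<in> {0..1}" for s t
    proof (cases "t \<le> 1/2")
      case True
      then have "2 * t \<in> {0..1}" using t by simp
      from horizontal(2)[OF fin[OF s] this] show ?thesis using True t by (simp add: loop_concat_def)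
    next
      case False
      then have t': "2 * t - 1 \<in> {0..1}" using t by simp
      from p_act[OF horizontal_in[OF gin[OF s] this] horizontal_1(2)[OF fin[OF s]]] horizontal(2)[OF gin[OF s] t']
      show ?thesis using False t by (simp add: loop_concat_def)
    qed
    show "loop_concat (f 0) (g 0) = const_loop b0" "loop_concat (f 1) (g 1) = const_loop b0"
      unfolding f(2,3) g(2,3) by (rule loop_concat_const)+
    have c: "?F (s, t) = sphere_pt" if "f s = const_loop b0" "g s = const_loop b0" "t \<in> {0..1}" for s t
      using horizontal(4)[of "2 * t"] horizontal(4)[of "2 * t - 1"] that by (simp add: holonomy_const)
    show "?F (0, t) = sphere_pt" "?F (1, t) = sphere_pt" if "t \<in> {0..1}" for t
      by (rule c[OF f(2) g(2) that], rule c[OF f(3) g(3) that])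
  qed
  also have "\<dots> = angle (\<lambda>s. holonomy (f s) * holonomy (g s))"
  proof (rule angle_cong)
    show "herm n (?F (s, 1)) sphere_pt = holonomy (f s) * holonomy (g s)" for s
      by (simp add: herm_act_left holonomy_def)
  qed
  also have "\<dots> = angle (\<lambda>s. holonomy (f s)) + angle (\<lambda>s. holonomy (g s))"
    by (rule angle_mult[OF holonomy_comp[OF f(1)] holonomy_comp[OF g(1)]])
  finally show ?thesis .
qed

text \<open>The quotient of the two holonomies contracts along the homotopy.\<close>

lemma angle_holonomy_homotopic:
  assumes h: "homotopic_with (\<lambda>h. h a0 = const_loop b0) A OB f g"
    and C: "continuous_map unit_top A C" "C 0 = a0" "C 1 = a0"
  shows "angle (\<lambda>s. holonomy (f (C s))) = angle (\<lambda>s. holonomy (g (C s)))"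
proof -
  obtain h where h: "continuous_map (prod_topology unit_top A) OB h" "\<forall>x. h (0, x) = f x" "\<forall>x. h (1, x) = g x"
    "\<forall>t\<in>{0..1}. h (t, a0) = const_loop b0"
    using h unfolding homotopic_with_def by blast
  let ?X = "prod_topology unit_top unit_top"
  have "continuous_map ?X A (\<lambda>z. C (fst z))"
    using continuous_map_compose[OF continuous_map_fst C(1)] unfolding o_def .
  then have "continuous_map ?X (prod_topology unit_top A) (\<lambda>z. (snd z, C (fst z)))"
    by (intro continuous_map_paired[THEN iffD2] conjI continuous_map_snd)
  from continuous_map_compose[OF this h(1)] have hC: "continuous_map ?X OB (\<lambda>z. h (snd z, C (fst z)))" unfolding o_def .
  define v where "v z = holonomy (h (snd z, C (fst z)))" for z
  have v: "continuous_map ?X circle_top v" unfolding v_def by (rule holonomy_comp[OF hC])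
  have v0: "continuous_map unit_top circle_top (\<lambda>s. v (s, 0))" by (rule continuous_map_endpoint(1)[OF v])
  have v1: "continuous_map unit_top circle_top (\<lambda>s. v (s, 1))" by (rule continuous_map_endpoint(2)[OF v])
  have "continuous_map ?X circle_top (\<lambda>z. v (fst z, 0))"
    using continuous_map_compose[OF continuous_map_fst v0] unfolding o_def .
  then have u: "continuous_map ?X circle_top (\<lambda>z. v z * cnj (v (fst z, 0)))"
    by (intro continuous_map_circle_mult v continuous_map_circle_cnj)
  have unit: "cmod (v (s, 0)) = 1" if "s \<in> {0..1}" for s
    using v0 that unfolding continuous_map_into_circle by simp
  have end1: "v (0, t) = 1" "v (1, t) = 1" if "t \<in> {0..1}" for t
    using h(4) that C(2,3) unfolding v_def by (simp_all add: holonomy_const)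
  have "angle (\<lambda>s. (\<lambda>z. v z * cnj (v (fst z, 0))) (s, 1)) = 0"
    by (rule angle_nullhomotopic[OF u]) (simp_all add: circle_cnj unit end1)
  then have "angle (\<lambda>s. v (s, 1) * cnj (v (s, 0))) = 0" by simp
  moreover have "angle (\<lambda>s. v (s, 1) * cnj (v (s, 0))) = angle (\<lambda>s. v (s, 1)) + angle (\<lambda>s. cnj (v (s, 0)))"
    by (rule angle_mult[OF v1 continuous_map_circle_cnj[OF v0]])
  moreover have "angle (\<lambda>s. cnj (v (s, 0))) = - angle (\<lambda>s. v (s, 0))" by (rule angle_cnj[OF v0])
  moreover have "(\<lambda>s. v (s, 0)) = (\<lambda>s. holonomy (f (C s)))" "(\<lambda>s. v (s, 1)) = (\<lambda>s. holonomy (g (C s)))"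
    unfolding v_def using h(2,3) by simp_all
  ultimately show ?thesis by simp
qed

text \<open>Injectivity: a null-homotopy in the base, lifted horizontally and corrected by a path \<open>w\<close> in the circle
  that closes up the lifts, deforms \<open>f\<close> into a family of loops within a single fibre, and the fibre is
  null-homotopic.\<close>

lemma null_homotopic_lift:
  fixes A :: "'c topology"
  assumes f: "continuous_map A OE f" "f a0 = base_loop" and a0: "a0 \<in> topspace A"
    and null: "homotopic_with (\<lambda>h. h a0 = const_loop b0) A OB (\<lambda>a. loop_map p (f a)) (\<lambda>_. const_loop b0)"
  shows "homotopic_with (\<lambda>h. h a0 = base_loop) A OE f (\<lambda>_. base_loop)"
proof -
  obtain h where h: "continuous_map (prod_topology unit_top A) OB h" "\<And>x. h (0, x) = loop_map p (f x)"
    "\<And>x. h (1, x) = const_loop b0" "\<And>t. t \<in> {0..1} \<Longrightarrow> h (t, a0) = const_loop b0"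
    using null unfolding homotopic_with_def by blast
  have hin: "h (s, a) \<in> topspace OB" if "s \<in> {0..1}" "a \<in> topspace A" for s a
    using continuous_map_funspace[OF h(1)] that by auto
  have pf: "continuous_map A OB (\<lambda>a. loop_map p (f a))"
    using continuous_map_compose[OF f(1) continuous_loop_map_p] unfolding o_def .
  let ?AI = "prod_topology A unit_top"
  define u where "u z = herm n (f (fst z) (snd z)) (horizontal (loop_map p (f (fst z)), snd z))" for z
  have start: "f (fst (a, 0)) (snd (a, 0)) = sphere_pt" if "a \<in> topspace A" for a
    using loop_map_values(1)[OF f(1) that] by simp
  have pF: "p (f (fst (a, t)) (snd (a, t))) = loop_map p (f a) t" if "a \<in> topspace A" "t \<in> {0..1}" for a t
    using that by (simp add: loop_map_def)
  note cl = compare_lift[OF continuous_map_uncurry_loop[OF f(1), unfolded split_def] pf start pF, folded u_def]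
  have u: "continuous_map ?AI circle_top u" by (rule cl(1))
  have u0: "u (a, 0) = 1" if "a \<in> topspace A" for a using cl(2)[of a] that by simp
  have fu: "f a t = circle_act (u (a, t)) (horizontal (loop_map p (f a), t))" if "a \<in> topspace A" "t \<in> {0..1}" for a t
    using cl(3)[of a t] that by simp
  have u1: "herm n (f a 1) sphere_pt = u (a, 1) * holonomy (loop_map p (f a))" if "a \<in> topspace A" for a
    using cl(4)[of a] that by simp
  have upt: "u (a, t) = 1" if "loop_map p (f a) = const_loop b0" "f a t = sphere_pt" "t \<in> {0..1}" for a t
    using cl(5)[of a t] that by simp
  have ua0: "u (a0, t) = 1" if "t \<in> {0..1}" for t
  proof (rule upt[OF _ _ that])
    show "loop_map p (f a0) = const_loop b0" unfolding f(2) by (rule loop_map_const)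
    show "f a0 t = sphere_pt" unfolding f(2) const_loop_def using that by simp
  qed
  define v where "v z = cnj (holonomy (h (snd z, fst z)))" for z
  have v: "continuous_map ?AI circle_top v"
  proof -
    have "continuous_map ?AI (prod_topology unit_top A) (\<lambda>z. (snd z, fst z))"
      by (intro continuous_map_paired[THEN iffD2] conjI continuous_map_snd continuous_map_fst)
    from continuous_map_compose[OF this h(1)] have "continuous_map ?AI OB (\<lambda>z. h (snd z, fst z))" unfolding o_def .
    then show ?thesis unfolding v_def by (intro continuous_map_circle_cnj holonomy_comp)
  qed
  have uv: "u (a, 1) = v (a, 0)" if a: "a \<in> topspace A" for a
  proof -
    have e: "u (a, 1) * holonomy (loop_map p (f a)) = 1"
      using u1[OF a] loop_map_values(2)[OF f(1) a] by (simp add: herm_sphere_pt)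
    have c: "cmod (holonomy (loop_map p (f a))) = 1"
      using horizontal_1(2)[OF hin[of 0 a]] a by (simp add: h(2))
    have "u (a, 1) = u (a, 1) * (holonomy (loop_map p (f a)) * cnj (holonomy (loop_map p (f a))))"
      unfolding circle_cnj(1)[OF c] by simp
    also have "\<dots> = cnj (holonomy (loop_map p (f a)))" unfolding mult.assoc[symmetric] e by simp
    finally show ?thesis unfolding v_def by (simp add: h(2))
  qed
  have v1: "v (a, 1) = 1" for a unfolding v_def by (simp add: h(3) holonomy_const)
  have va0: "v (a0, t) = 1" if "t \<in> {0..1}" for t unfolding v_def by (simp add: h(4)[OF that] holonomy_const)
  let ?X = "prod_topology (prod_topology unit_top A) unit_top"
  \<comment> \<open>For fixed \<open>s\<close>, \<open>w\<close> runs through \<open>u\<close> followed by the part of \<open>v\<close> up to parameter \<open>s\<close>, at speed \<open>1 + s\<close>; it starts at \<open>1\<close>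
      and ends at the inverse of the holonomy at stage \<open>s\<close>.\<close>
  define r :: "(real \<times> 'c) \<times> real \<Rightarrow> real" where "r x = snd x * (1 + fst (fst x))" for x
  define w where "w x = (if r x \<le> 1 then u (snd (fst x), r x) else v (snd (fst x), r x - 1))" for x
  have s: "continuous_map ?X euclideanreal (\<lambda>x. fst (fst x))"
    using continuous_map_compose[OF continuous_map_fst continuous_map_fst, of unit_top A unit_top]
    unfolding o_def continuous_map_in_subtopology by blast
  have fst: "continuous_map ?X (prod_topology unit_top A) fst" by (rule continuous_map_fst)
  have a: "continuous_map ?X A (\<lambda>x. snd (fst x))"
    using continuous_map_compose[OF continuous_map_fst continuous_map_snd, of unit_top A unit_top] unfolding o_def .
  have t': "continuous_map ?X unit_top snd" by (rule continuous_map_snd)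
  then have t: "continuous_map ?X euclideanreal snd" unfolding continuous_map_in_subtopology by blast
  have r: "continuous_map ?X euclideanreal r"
    unfolding r_def by (rule continuous_map_comp2[where h = "\<lambda>t s. t * (1 + s)", OF t s]) (intro continuous_intros)
  have one: "continuous_map ?X euclideanreal (\<lambda>_. 1)" by (rule continuous_map_const[THEN iffD2]) simp
  have r02: "0 \<le> r x \<and> r x \<le> 2" if "x \<in> topspace ?X" for x
  proof -
    have "fst (fst x) \<in> {0..1}" "snd x \<in> {0..1}" using that by auto
    then show ?thesis unfolding r_def
      using mult_mono[of "snd x" 1 "1 + fst (fst x)" 2] by simp
  qed
  have w: "continuous_map ?X circle_top w"
    unfolding w_def
  proof (rule continuous_map_cases_le[OF r one])
    let ?Y = "subtopology ?X {x \<in> topspace ?X. r x \<le> 1}"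
    have "continuous_map ?Y unit_top r"
      by (rule continuous_map_unit_topI[OF continuous_map_from_subtopology[OF r]]) (use r02 in auto)
    then have "continuous_map ?Y ?AI (\<lambda>x. (snd (fst x), r x))"
      by (intro continuous_map_paired[THEN iffD2] conjI continuous_map_from_subtopology[OF a])
    from continuous_map_compose[OF this u] show "continuous_map ?Y circle_top (\<lambda>x. u (snd (fst x), r x))" unfolding o_def .
    let ?Z = "subtopology ?X {x \<in> topspace ?X. 1 \<le> r x}"
    have "continuous_map ?Z euclideanreal (\<lambda>x. r x - 1)"
      by (rule continuous_map_comp1[OF continuous_map_from_subtopology[OF r]]) (intro continuous_intros)
    then have "continuous_map ?Z unit_top (\<lambda>x. r x - 1)"
      by (rule continuous_map_unit_topI) (use r02 in auto)
    then have "continuous_map ?Z ?AI (\<lambda>x. (snd (fst x), r x - 1))"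
      by (intro continuous_map_paired[THEN iffD2] conjI continuous_map_from_subtopology[OF a])
    from continuous_map_compose[OF this v] show "continuous_map ?Z circle_top (\<lambda>x. v (snd (fst x), r x - 1))" unfolding o_def .
    show "u (snd (fst x), r x) = v (snd (fst x), r x - 1)" if "x \<in> topspace ?X" "r x = 1" for x
      using uv[of "snd (fst x)"] that by auto
  qed
  have wt0: "w ((s, a), 0) = 1" if "a \<in> topspace A" for s a
    using u0[OF that] by (simp add: w_def r_def)
  have wt1: "w ((s, a), 1) = v (a, s)" if "a \<in> topspace A" "s \<in> {0..1}" for s a
    using uv[OF that(1)] that(2) by (cases "s = 0") (simp_all add: w_def r_def)
  have wa0: "w ((s, a0), t) = 1" if "s \<in> {0..1}" "t \<in> {0..1}" for s t
  proof -
    have "((s, a0), t) \<in> topspace ?X" using that a0 by simp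
    from r02[OF this] show ?thesis unfolding w_def fst_conv snd_conv by (auto intro!: ua0 va0)
  qed
  have w0: "w ((0, a), t) = u (a, t)" if "t \<in> {0..1}" for a t
    using that by (simp add: w_def r_def)
  let ?k1 = "\<lambda>s a t. circle_act (w ((s, a), t)) (horizontal (h (s, a), t))"
  let ?g = "\<lambda>a. restrict (?k1 1 a) {0..1}"
  have 1: "homotopic_with (\<lambda>h. h a0 = base_loop) A OE f ?g"
  proof (rule homotopic_loop_mapsI[of A E ?k1])
    have "continuous_map ?X OB (\<lambda>x. h (fst x))"
      using continuous_map_compose[OF fst h(1)] unfolding o_def .
    from continuous_map_circle_act[OF w continuous_map_horizontal[OF this t']]
    show "continuous_map ?X E (\<lambda>((s, a), t). ?k1 s a t)"
      by (rule continuous_map_eq) (auto simp: split_def)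
    show "?k1 s a 0 = sphere_pt \<and> ?k1 s a 1 = sphere_pt" if s: "s \<in> {0..1}" and a: "a \<in> topspace A" for s a
    proof
      show "?k1 s a 0 = sphere_pt" using wt0[OF a] horizontal(3)[OF hin[OF s a]] by simp
      have "?k1 s a 1 = circle_act (cnj (holonomy (h (s, a))) * holonomy (h (s, a))) sphere_pt"
        unfolding wt1[OF a s] horizontal_1(1)[OF hin[OF s a]] circle_act_mult v_def by simp
      then show "?k1 s a 1 = sphere_pt" using circle_cnj(2)[OF horizontal_1(2)[OF hin[OF s a]]] by simp
    qed
    show "?k1 s a0 t = sphere_pt" if "s \<in> {0..1}" "t \<in> {0..1}" for s t
      using wa0[OF that] h(4)[OF that(1)] horizontal(4)[OF that(2)] by simp
    show "f a = restrict (?k1 0 a) {0..1}" if a: "a \<in> topspace A" for a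
    proof -
      have "restrict (?k1 0 a) {0..1} = restrict (f a) {0..1}"
        by (rule restrict_ext) (use fu[OF a] w0 h(2) in simp)
      then show ?thesis using loop_map_values(3)[OF f(1) a] by (simp add: extensional_restrict)
    qed
  qed (use a0 in simp_all)
  \<comment> \<open>At stage \<open>1\<close> the lift is constant, so only the loop \<open>\<zeta>\<close> in the fibre is left.\<close>
  define \<zeta> where "\<zeta> x = w ((1, fst x), snd x)" for x
  have 2: "homotopic_with (\<lambda>h. h a0 = base_loop) A OE ?g (\<lambda>_. base_loop)"
  proof (rule homotopic_loop_mapsI[of A E "\<lambda>s a t. orbit_null (\<zeta> (a, t)) s"])
    have "continuous_map ?X unit_top (\<lambda>_. 1)" by (rule continuous_map_const[THEN iffD2]) simp
    then have "continuous_map ?X ?X (\<lambda>x. ((1, snd (fst x)), snd x))"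
      by (intro continuous_map_paired[THEN iffD2] conjI a t')
    from continuous_map_compose[OF this w]
    have z: "continuous_map ?X circle_top (\<lambda>x. \<zeta> (snd (fst x), snd x))" unfolding o_def \<zeta>_def fst_conv snd_conv .
    have s': "continuous_map ?X unit_top (\<lambda>x. fst (fst x))"
      using continuous_map_compose[OF continuous_map_fst continuous_map_fst, of unit_top A unit_top] unfolding o_def .
    from continuous_map_orbit_null[OF z s']
    show "continuous_map ?X E (\<lambda>((s, a), t). orbit_null (\<zeta> (a, t)) s)"
      by (rule continuous_map_eq) (auto simp: split_def)
    show "orbit_null (\<zeta> (a, 0)) s = sphere_pt \<and> orbit_null (\<zeta> (a, 1)) s = sphere_pt" if a: "a \<in> topspace A" for s a
      using wt0[OF a] wt1[OF a, of 1] v1 by (simp add: \<zeta>_def orbit_null_fix)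
    show "orbit_null (\<zeta> (a0, t)) s = sphere_pt" if "t \<in> {0..1}" for s t
      using wa0[OF _ that, of 1] by (simp add: \<zeta>_def orbit_null_fix)
    show "?g a = restrict (\<lambda>t. orbit_null (\<zeta> (a, t)) 0) {0..1}" if a: "a \<in> topspace A" for a
    proof (rule restrict_ext)
      fix t :: real assume t: "t \<in> {0..1}"
      have "cmod (w ((1, a), t)) = 1" using w a t unfolding continuous_map_into_circle by simp
      from orbit_null_0[OF this] show "?k1 1 a t = orbit_null (\<zeta> (a, t)) 0"
        unfolding \<zeta>_def fst_conv snd_conv h(3) horizontal(4)[OF t] by simp
    qed
    show "base_loop = restrict (\<lambda>t. orbit_null (\<zeta> (a, t)) 1) {0..1}" for a
      unfolding const_loop_def orbit_null_1 ..
  qed (rule a0)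
  show ?thesis by (rule homotopic_with_trans[OF 1 2])
qed

end

section \<open>Closed paths in the loop space of the base\<close>

text \<open>A lift along the \<open>d\<close>-fold circle restricts on each of its \<open>d\<close> turns to a rescaled lift along the circle.\<close>

lemma angle_iterate:
  assumes k: "continuous_map circle_top circle_top k" and k1: "k 1 = 1"
  shows "angle (\<lambda>s. k (cis (2 * pi * (real d * s)))) = real d * angle (\<lambda>s. k (cis (2 * pi * s)))"
proof (cases "d = 0")
  case True
  have "angle (\<lambda>s. k (cis (2 * pi * (real d * s)))) = angle (\<lambda>_. 1)"
    by (rule angle_cong) (simp add: True k1)
  then show ?thesis using True angle_const_one by simp
next
  case False
  then have d: "real d > 0" by simp
  have "continuous_map unit_top circle_top (\<lambda>s. cis (2 * pi * (real d * s)))"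
    by (rule continuous_map_circle_cis) (simp add: continuous_intros)
  from continuous_map_compose[OF this k]
  have "continuous_map unit_top circle_top (\<lambda>s. k (cis (2 * pi * (real d * s))))" unfolding o_def .
  from lift_path_circle'[OF this] obtain \<eta> where \<eta>: "continuous_on {0..1} \<eta>"
    "\<forall>s\<in>{0..1}. k (cis (2 * pi * (real d * s))) = cis (\<eta> s)"
    "angle (\<lambda>s. k (cis (2 * pi * (real d * s)))) = \<eta> 1 - \<eta> 0" by blast
  have turn: "angle (\<lambda>s. k (cis (2 * pi * s))) = \<eta> (real (Suc j) / real d) - \<eta> (real j / real d)" if j: "j < d" for j
  proof -
    have j01: "(real j + t) / real d \<in> {0..1}" if "t \<in> {0..1}" for t
    proof -
      have "real j + 1 \<le> real d" using j by linarith
      then show ?thesis using that d by (simp add: divide_le_eq_1)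
    qed
    have "angle (\<lambda>s. k (cis (2 * pi * s))) = (\<lambda>t. \<eta> ((real j + t) / real d)) 1 - (\<lambda>t. \<eta> ((real j + t) / real d)) 0"
    proof (rule angle_eqI)
      have "continuous_on {0..1} (\<lambda>t. (real j + t) / real d)" by (intro continuous_intros) (use d in auto)
      then show "continuous_on {0..1} (\<lambda>t. \<eta> ((real j + t) / real d))"
        by (rule continuous_on_compose2[OF \<eta>(1)]) (use j01 in blast)
      fix t :: real assume t: "t \<in> {0..1}"
      have "cis (2 * pi * (real d * ((real j + t) / real d))) = cis (2 * pi * real j) * cis (2 * pi * t)"
      proof -
        have "real d * ((real j + t) / real d) = real j + t" using d by simp
        then show ?thesis by (simp only: cis_mult distrib_left)
      qed
      also have "cis (2 * pi * real j) = 1" by (rule cis_multiple_2pi) simp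
      finally show "k (cis (2 * pi * t)) = cis (\<eta> ((real j + t) / real d))"
        using \<eta>(2)[rule_format, OF j01[OF t]] by simp
    qed
    then show ?thesis by (simp add: add.commute)
  qed
  have "real d * angle (\<lambda>s. k (cis (2 * pi * s))) = (\<Sum>j<d. angle (\<lambda>s. k (cis (2 * pi * s))))" by simp
  also have "\<dots> = (\<Sum>j<d. \<eta> (real (Suc j) / real d) - \<eta> (real j / real d))"
    by (rule sum.cong[OF refl], rule turn) simp
  also have "\<dots> = \<eta> (real d / real d) - \<eta> (real 0 / real d)"
    by (rule sum_lessThan_telescope)
  also have "\<dots> = \<eta> 1 - \<eta> 0" using d by simp
  finally show ?thesis using \<eta>(3) by simp
qed

lemma angle_turns:
  "angle (\<lambda>s. cis (2 * pi * (real d * s))) = 2 * pi * real d"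
proof -
  have "angle (\<lambda>s. cis (2 * pi * (real d * s))) = (\<lambda>s. 2 * pi * (real d * s)) 1 - (\<lambda>s. 2 * pi * (real d * s)) 0"
    by (rule angle_eqI) (intro continuous_intros, simp)
  then show ?thesis by simp
qed

lemma continuous_map_turns: "continuous_map unit_top circle_top (\<lambda>s. cis (2 * pi * (real d * s)))"
  by (rule continuous_map_circle_cis) (simp add: continuous_intros)

lemma continuous_map_turn: "continuous_map unit_top circle_top (\<lambda>s. cis (2 * pi * s))"
  by (rule continuous_map_circle_cis) (simp add: continuous_intros)

context circle_bundle
begin

text \<open>With holonomy of angle zero, \<open>C\<close> lifts to a closed path in the loop space of the sphere, which is simply
  connected.\<close>

lemma angle_zero_of_zero_holonomy:
  assumes C: "continuous_map unit_top OB C" "C 0 = const_loop b0" "C 1 = const_loop b0"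
    and hol: "angle (\<lambda>s. holonomy (C s)) = 0" and g: "continuous_map OB circle_top g" "g (const_loop b0) = 1"
  shows "angle (\<lambda>s. g (C s)) = 0"
proof -
  have "holonomy (C 0) = cis 0" using C(2) holonomy_const by simp
  from lift_path_circle[OF holonomy_comp[OF C(1)] this]
  obtain \<theta> where \<theta>: "continuous_on {0..1} \<theta>" "\<forall>t\<in>{0..1}. holonomy (C t) = cis (\<theta> t)" "\<theta> 0 = 0" "\<theta> 1 = 0"
    using hol by auto
  have c\<theta>: "continuous_map unit_top euclideanreal \<theta>" using \<theta>(1) by simp
  have h\<theta>: "holonomy (C a) = cis (\<theta> a)" if "a \<in> topspace unit_top" for a using \<theta>(2) that by simp
  obtain D where D: "continuous_map unit_top OE D" "\<forall>a\<in>topspace unit_top. loop_map p (D a) = C a"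
    "\<forall>a. C a = const_loop b0 \<and> \<theta> a = 0 \<longrightarrow> D a = base_loop"
    using lift_of_zero_holonomy[OF C(1) c\<theta> h\<theta>] by blast
  have D01: "D 0 = base_loop" "D 1 = base_loop" using D(3) C(2,3) \<theta>(3,4) by blast+
  have "2 * n + 1 \<ge> 3" using n by simp
  from simply_connected_sphere_loops[OF this D(1) D01]
  obtain H where H: "continuous_map (prod_topology unit_top unit_top) OE H"
    "\<forall>s\<in>{0..1}. H (s, 0) = base_loop \<and> H (s, 1) = D s" "\<forall>r\<in>{0..1}. H (0, r) = base_loop \<and> H (1, r) = base_loop"
    by blast
  have "continuous_map (prod_topology unit_top unit_top) OB (\<lambda>z. loop_map p (H z))"
    using continuous_map_compose[OF H(1) continuous_loop_map_p] unfolding o_def .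
  from continuous_map_compose[OF this g(1)]
  have gH: "continuous_map (prod_topology unit_top unit_top) circle_top (\<lambda>z. g (loop_map p (H z)))" unfolding o_def .
  have "angle (\<lambda>s. g (loop_map p (H (s, 1)))) = 0"
    by (rule angle_nullhomotopic[OF gH]) (use H(2,3) g(2) loop_map_const in simp_all)
  moreover have "angle (\<lambda>s. g (C s)) = angle (\<lambda>s. g (loop_map p (H (s, 1))))"
    by (rule angle_cong) (use H(2) D(2) in simp)
  ultimately show ?thesis by simp
qed

lemma angle_comp_orbit_loop_turns:
  assumes g: "continuous_map OB circle_top g" "g (const_loop b0) = 1"
    and g0: "angle (\<lambda>s. g (orbit_loop (cis (2 * pi * s)))) = 0"
  shows "angle (\<lambda>s. g (orbit_loop (cis (2 * pi * (real d * s))))) = 0"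
proof -
  have "continuous_map circle_top circle_top (\<lambda>c. c)" by (rule continuous_map_id[unfolded id_def])
  from continuous_map_compose[OF continuous_orbit_loop(1)[OF this] g(1)]
  have k: "continuous_map circle_top circle_top (\<lambda>c. g (orbit_loop c))" unfolding o_def .
  show ?thesis using angle_iterate[OF k] g(2) g0 by (simp add: orbit_loop_1)
qed

text \<open>Up to loops that lift to the sphere, every closed path in the loop space of the base is an iterate of
  the one given by the fibre.\<close>

lemma angle_zero_on_closed_paths:
  assumes g: "continuous_map OB circle_top g" "g (const_loop b0) = 1"
    and g0: "angle (\<lambda>s. g (orbit_loop (cis (2 * pi * s)))) = 0"
    and C: "continuous_map unit_top OB C" "C 0 = const_loop b0" "C 1 = const_loop b0"
  shows "angle (\<lambda>s. g (C s)) = 0"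
proof -
  have "holonomy (C 0) = holonomy (C 1)" unfolding C(2,3) ..
  from angle_closed[OF holonomy_comp[OF C(1)] this]
  obtain m :: int where m: "angle (\<lambda>s. holonomy (C s)) = 2 * pi * m" .
  define d where "d = nat \<bar>m\<bar>"
  define T where "T s = orbit_loop (cis (2 * pi * (real d * s)))" for s
  have T: "continuous_map unit_top OB T" unfolding T_def by (rule continuous_orbit_loop(1)[OF continuous_map_turns])
  have T0: "T 0 = const_loop b0" by (simp add: T_def orbit_loop_1)
  have "cis (2 * pi * real d) = 1" by (rule cis_multiple_2pi) simp
  then have T1: "T 1 = const_loop b0" by (simp add: T_def orbit_loop_1)
  have "angle (\<lambda>s. holonomy (T s)) = angle (\<lambda>s. cis (2 * pi * (real d * s)))"
    unfolding T_def by (rule angle_holonomy_orbit_loop[OF continuous_map_turns]) (simp_all add: \<open>cis (2 * pi * real d) = 1\<close>)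
  then have hT: "angle (\<lambda>s. holonomy (T s)) = 2 * pi * real d" unfolding angle_turns .
  have gT: "angle (\<lambda>s. g (T s)) = 0" unfolding T_def by (rule angle_comp_orbit_loop_turns[OF g g0])
  have gc: "continuous_map unit_top circle_top (\<lambda>s. g (T s))"
    using continuous_map_compose[OF T g(1)] unfolding o_def .
  \<comment> \<open>Undo the winding of \<open>C\<close> by running through the \<open>d\<close>-fold fibre path, backwards if \<open>m\<close> is positive.\<close>
  define T' where "T' s = (if m \<ge> 0 then T (1 - s) else T s)" for s
  have T': "continuous_map unit_top OB T'" "T' 0 = const_loop b0" "T' 1 = const_loop b0"
    and hT': "angle (\<lambda>s. holonomy (T' s)) = - (2 * pi * m)" and gT': "angle (\<lambda>s. g (T' s)) = 0"
  proof -
    have "continuous_map unit_top OB T' \<and> T' 0 = const_loop b0 \<and> T' 1 = const_loop b0 \<and>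
      angle (\<lambda>s. holonomy (T' s)) = - (2 * pi * m) \<and> angle (\<lambda>s. g (T' s)) = 0"
    proof (cases "m \<ge> 0")
      case True
      then have T'_eq: "T' = (\<lambda>s. T (1 - s))" and dm: "real d = m" by (simp_all add: T'_def d_def fun_eq_iff)
      show ?thesis
        unfolding T'_eq angle_reverse[OF holonomy_comp[OF T]] angle_reverse[OF gc] hT gT dm
        using continuous_map_path_reverse[OF T] T0 T1 by simp
    next
      case False
      then have T'_eq: "T' = T" and dm: "real d = - m" by (simp_all add: T'_def d_def fun_eq_iff)
      show ?thesis unfolding T'_eq hT gT dm using T T0 T1 by simp
    qed
    then show "continuous_map unit_top OB T'" "T' 0 = const_loop b0" "T' 1 = const_loop b0"
      "angle (\<lambda>s. holonomy (T' s)) = - (2 * pi * m)" "angle (\<lambda>s. g (T' s)) = 0"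
      by blast+
  qed
  have CT: "C 1 = T' 0" unfolding C(3) T'(2) ..
  have h0: "angle (\<lambda>s. holonomy (loop_concat C T' s)) = 0"
    using angle_comp_concat[OF continuous_holonomy C(1) T'(1) CT] m hT' by linarith
  have "loop_concat C T' 0 = const_loop b0" "loop_concat C T' 1 = const_loop b0"
    unfolding loop_concat_ends by (rule C(2), rule T'(3))
  from angle_zero_of_zero_holonomy[OF continuous_map_path_concat[OF C(1) T'(1) CT] this h0 g]
  show ?thesis
    using angle_comp_concat[OF g(1) C(1) T'(1) CT] gT' by linarith
qed

section \<open>The projection on groups of homotopy classes\<close>

lemma loop_map_concat: "loop_map p (loop_concat l l') = loop_concat (loop_map p l) (loop_map p l')"
  by (auto simp: loop_map_def loop_concat_def restrict_def fun_eq_iff)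

end

locale circle_bundle_source = circle_bundle n B p for n :: nat and B :: "'b topology" and p +
  fixes A :: "'a topology" and a0 :: 'a
  assumes a0: "a0 \<in> topspace A"
begin

sublocale top: pointed_pair A a0 E sphere_pt
  by unfold_locales (rule a0, rule sphere_pt_in_nsphere)

sublocale base: pointed_pair A a0 B b0
  by unfold_locales (rule a0, rule b0)

abbreviation push where
  "push \<equiv> htpy_push A a0 OB (const_loop b0) (loop_map p)"

lemma pmap_push: "top.pmap f \<Longrightarrow> base.pmap (\<lambda>a. loop_map p (f a))"
  using continuous_map_compose[OF _ continuous_loop_map_p, of A f] by (simp add: o_def loop_map_const)

lemma push_cls: "top.pmap f \<Longrightarrow> push (top.cls f) = base.cls (\<lambda>a. loop_map p (f a))"
  using htpy_push_class[of A OE f a0 base_loop OB "loop_map p" "const_loop b0"] continuous_loop_map_p loop_map_const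
  by (simp add: o_def)

lemma push_hom: "push \<in> hom top.G base.G"
proof (rule homI)
  fix x assume "x \<in> carrier top.G"
  then obtain f where f: "top.pmap f" "x = top.cls f" by (rule top.carrierE)
  show "push x \<in> carrier base.G"
    unfolding f(2) push_cls[OF f(1)] by (rule base.cls_in_carrier[OF pmap_push[OF f(1)]])
next
  fix x y assume "x \<in> carrier top.G" "y \<in> carrier top.G"
  then obtain f g where f: "top.pmap f" "x = top.cls f" and g: "top.pmap g" "y = top.cls g"
    by (elim top.carrierE)
  show "push (x \<otimes>\<^bsub>top.G\<^esub> y) = push x \<otimes>\<^bsub>base.G\<^esub> push y"
    unfolding f(2) g(2) top.mult_eq[OF f(1) g(1)] push_cls[OF f(1)] push_cls[OF g(1)]
      push_cls[OF top.pmap_concat[OF f(1) g(1)]] base.mult_eq[OF pmap_push[OF f(1)] pmap_push[OF g(1)]] loop_map_concat ..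
qed

text \<open>A class in the kernel is represented by a map whose projection is null-homotopic.\<close>

lemma push_mon: "push \<in> mon top.G base.G"
proof -
  have "x = \<one>\<^bsub>top.G\<^esub>" if x: "x \<in> carrier top.G" "push x = \<one>\<^bsub>base.G\<^esub>" for x
  proof -
    obtain f where f: "top.pmap f" "x = top.cls f" using x(1) by (rule top.carrierE)
    have "base.cls (\<lambda>a. loop_map p (f a)) = base.cls (\<lambda>_. const_loop b0)"
      using x(2) unfolding f(2) push_cls[OF f(1)] base.one_eq .
    then have "base.hom_eq (\<lambda>_. const_loop b0) (\<lambda>a. loop_map p (f a))"
      using htpy_class_eq_iff[of A OB "\<lambda>_. const_loop b0" a0 "const_loop b0"] base.pmap_const by simp
    then have "base.hom_eq (\<lambda>a. loop_map p (f a)) (\<lambda>_. const_loop b0)" by (rule homotopic_with_symD)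
    from null_homotopic_lift[OF _ _ a0 this] f(1) have "top.hom_eq f (\<lambda>_. base_loop)" by blast
    then show ?thesis unfolding f(2) top.one_eq by (rule htpy_class_eqI)
  qed
  then have "inj_on push (carrier top.G)"
    unfolding inj_on_one_iff'[OF push_hom top.group_htpy_loop_group base.group_htpy_loop_group] by blast
  then show ?thesis unfolding mon_def using push_hom by blast
qed

lemma in_image_push:
  assumes f: "base.pmap f"
    and \<theta>: "continuous_map A euclideanreal \<theta>" "\<And>a. a \<in> topspace A \<Longrightarrow> holonomy (f a) = cis (\<theta> a)" "\<theta> a0 = 0"
  shows "base.cls f \<in> push ` carrier top.G"
proof -
  obtain f' where f': "continuous_map A OE f'" "\<forall>a\<in>topspace A. loop_map p (f' a) = f a"
    "\<forall>a. f a = const_loop b0 \<and> \<theta> a = 0 \<longrightarrow> f' a = base_loop"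
    using lift_of_zero_holonomy[OF conjunct1[OF f] \<theta>(1,2)] by blast
  have p': "top.pmap f'" using f' f \<theta>(3) by simp
  have "base.hom_eq f (\<lambda>a. loop_map p (f' a))"
  proof (rule homotopic_with_eq)
    show "base.hom_eq f f" using f by simp
    show "loop_map p (f' a) = f a" if "a \<in> topspace A" for a using f'(2) that by blast
  qed (use a0 in simp_all)
  from htpy_class_eqI[OF this] have "base.cls f = push (top.cls f')" unfolding push_cls[OF p'] .
  then show ?thesis using top.cls_in_carrier[OF p'] by blast
qed

text \<open>Angles of closed paths are integer multiples of \<open>2 * pi\<close>, additive and invariant under homotopy, so the
  holonomy along a fixed closed path of \<open>A\<close> defines a homomorphism to the integers.\<close>

lemma exists_winding:
  assumes C: "continuous_map unit_top A C" "C 0 = a0" "C 1 = a0"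
  shows "\<exists>q. q \<in> hom base.G integer_group \<and>
    (\<forall>f. base.pmap f \<longrightarrow> angle (\<lambda>s. holonomy (f (C s))) = 2 * pi * of_int (q (base.cls f)))"
proof -
  define W where "W f = angle (\<lambda>s. holonomy (f (C s)))" for f
  have fC: "continuous_map unit_top OB (\<lambda>s. f (C s))" "f (C 0) = const_loop b0" "f (C 1) = const_loop b0" if "base.pmap f" for f
    using continuous_map_compose[OF C(1), of OB f] that C(2,3) by (simp_all add: o_def)
  have int: "\<exists>k::int. W f = 2 * pi * k" if f: "base.pmap f" for f
  proof -
    have "holonomy (f (C 0)) = holonomy (f (C 1))" unfolding fC(2,3)[OF f] ..
    from angle_closed[OF holonomy_comp[OF fC(1)[OF f]] this] show ?thesis unfolding W_def by blast
  qed
  have cong: "W f = W g" if "base.cls f = base.cls g" "base.pmap g" for f g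
  proof -
    have "base.hom_eq g f" using htpy_class_eq_iff[of A OB g a0 "const_loop b0" f] that by simp
    from angle_holonomy_homotopic[OF homotopic_with_symD[OF this] C] show ?thesis unfolding W_def .
  qed
  define q :: "('a \<Rightarrow> real \<Rightarrow> 'b) set \<Rightarrow> int" where
    "q x = \<lfloor>W (SOME f. base.pmap f \<and> x = base.cls f) / (2 * pi)\<rfloor>" for x
  have qW: "W f = 2 * pi * of_int (q (base.cls f))" if f: "base.pmap f" for f
  proof -
    let ?f = "SOME f'. base.pmap f' \<and> base.cls f = base.cls f'"
    have "base.pmap ?f \<and> base.cls f = base.cls ?f" by (rule someI[of _ f]) (use f in blast)
    then have "W f = W ?f" using cong by blast
    then have "q (base.cls f) = \<lfloor>W f / (2 * pi)\<rfloor>" unfolding q_def by (simp only:)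
    moreover obtain k :: int where "W f = 2 * pi * k" using int[OF f] by blast
    ultimately show ?thesis by simp
  qed
  have "q \<in> hom base.G integer_group"
  proof (rule homI)
    fix x y assume "x \<in> carrier base.G" "y \<in> carrier base.G"
    then obtain f g where f: "base.pmap f" "x = base.cls f" and g: "base.pmap g" "y = base.cls g"
      by (elim base.carrierE)
    have "W (\<lambda>a. loop_concat (f a) (g a)) = W f + W g"
      unfolding W_def by (rule angle_holonomy_concat[OF fC[OF f(1)] fC[OF g(1)]])
    then have "2 * pi * of_int (q (base.cls (\<lambda>a. loop_concat (f a) (g a)))) = 2 * pi * of_int (q x + q y)"
      unfolding qW[OF base.pmap_concat[OF f(1) g(1)]] qW[OF f(1)] qW[OF g(1)] f(2) g(2) by (simp add: distrib_left)
    then have "real_of_int (q (base.cls (\<lambda>a. loop_concat (f a) (g a)))) = real_of_int (q x + q y)" by simp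
    then have "q (base.cls (\<lambda>a. loop_concat (f a) (g a))) = q x + q y" by linarith
    then show "q (x \<otimes>\<^bsub>base.G\<^esub> y) = q x \<otimes>\<^bsub>integer_group\<^esub> q y"
      unfolding f(2) g(2) base.mult_eq[OF f(1) g(1)] by simp
  qed simp
  then show ?thesis using qW unfolding W_def by blast
qed

lemma push_iso:
  assumes "\<And>g. continuous_map A circle_top g \<Longrightarrow> g a0 = 1 \<Longrightarrow>
     \<exists>\<theta>. continuous_map A euclideanreal \<theta> \<and> (\<forall>a\<in>topspace A. g a = cis (\<theta> a)) \<and> \<theta> a0 = 0"
  shows "push \<in> iso top.G base.G"
proof -
  have "carrier base.G \<subseteq> push ` carrier top.G"
  proof
    fix x assume "x \<in> carrier base.G"
    then obtain f where f: "base.pmap f" "x = base.cls f" by (rule base.carrierE)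
    obtain \<theta> where \<theta>: "continuous_map A euclideanreal \<theta>" "\<forall>a\<in>topspace A. holonomy (f a) = cis (\<theta> a)" "\<theta> a0 = 0"
      using assms[OF holonomy_comp[OF conjunct1[OF f(1)]]] f(1) holonomy_const by auto
    show "x \<in> push ` carrier top.G" unfolding f(2) by (rule in_image_push[OF f(1) \<theta>(1) bspec[OF \<theta>(2)] \<theta>(3)])
  qed
  moreover have "push ` carrier top.G \<subseteq> carrier base.G" using push_hom by (auto simp: hom_def)
  ultimately show ?thesis using push_mon unfolding iso_def mon_def bij_betw_def by blast
qed

text \<open>The path \<open>C\<close> is assumed to detect whether a circle-valued map has a logarithm, so the winding number of the
  holonomy along \<open>C\<close> has the image of \<open>push\<close> as its kernel. The map \<open>\<delta>\<close>, which winds once along \<open>C\<close>, gives a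
  class with value \<open>1\<close>, and its powers split the sequence.\<close>

lemma push_split_exact:
  assumes C: "continuous_map unit_top A C" "C 0 = a0" "C 1 = a0"
    and zero: "\<And>g. continuous_map A circle_top g \<Longrightarrow> g a0 = 1 \<Longrightarrow> angle (\<lambda>s. g (C s)) = 0 \<Longrightarrow>
     \<exists>\<theta>. continuous_map A euclideanreal \<theta> \<and> (\<forall>a\<in>topspace A. g a = cis (\<theta> a)) \<and> \<theta> a0 = 0"
    and gen: "continuous_map A circle_top \<delta>" "\<delta> a0 = 1" "angle (\<lambda>s. \<delta> (C s)) = 2 * pi"
  shows "\<exists>q. split_short_exact top.G base.G integer_group push q"
proof -
  interpret G: group base.G by (rule base.group_htpy_loop_group)
  obtain q where q: "q \<in> hom base.G integer_group"
    and qW: "\<And>f. base.pmap f \<Longrightarrow> angle (\<lambda>s. holonomy (f (C s))) = 2 * pi * of_int (q (base.cls f))"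
    using exists_winding[OF C] by blast
  interpret q: group_hom base.G integer_group q
    by (rule group_hom.intro[OF G.is_group group_integer_group]) (unfold_locales, rule q)
  have gf: "base.pmap (\<lambda>a. orbit_loop (\<delta> a))"
    using continuous_orbit_loop(1)[OF gen(1)] gen(2) by (simp add: orbit_loop_1)
  let ?x = "base.cls (\<lambda>a. orbit_loop (\<delta> a))"
  have \<delta>C: "continuous_map unit_top circle_top (\<lambda>s. \<delta> (C s))"
    using continuous_map_compose[OF C(1) gen(1)] unfolding o_def .
  have "2 * pi * of_int (q ?x) = 2 * pi * 1"
    using qW[OF gf] angle_holonomy_orbit_loop[OF \<delta>C] C(2,3) gen(2,3) by simp
  then have qx: "q ?x = 1" by simp
  have x: "?x \<in> carrier base.G" by (rule base.cls_in_carrier[OF gf])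
  define s where "s k = ?x [^]\<^bsub>base.G\<^esub> (k::int)" for k
  have s: "s \<in> hom integer_group base.G"
    unfolding s_def using G.hom_integer_group_pow[OF x] .
  have qs: "q (s k) = k" for k
    unfolding s_def q.hom_int_pow[OF x] qx by simp
  have sc: "s k \<in> carrier base.G" for k using s by (auto simp: hom_def)
  have epi: "q \<in> epi base.G integer_group"
    unfolding epi_def using q qs sc by (auto simp: image_iff) metis
  have ker: "push ` carrier top.G = kernel base.G integer_group q"
  proof (intro equalityI subsetI)
    fix y assume "y \<in> push ` carrier top.G"
    then obtain x where "x \<in> carrier top.G" "y = push x" by blast
    then obtain f where f: "top.pmap f" "y = push (top.cls f)" by (metis top.carrierE)
    have fC: "continuous_map unit_top OE (\<lambda>s. f (C s))"
      using continuous_map_compose[OF C(1) conjunct1[OF f(1)]] unfolding o_def .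
    have "angle (\<lambda>s. holonomy (loop_map p (f (C s)))) = 0"
      by (rule angle_holonomy_loop_map[OF fC]) (use C(2,3) f(1) in simp_all)
    then have "q y = 0" unfolding f(2) push_cls[OF f(1)] using qW[OF pmap_push[OF f(1)]] by simp
    moreover have "y \<in> carrier base.G"
      unfolding f(2) push_cls[OF f(1)] by (rule base.cls_in_carrier[OF pmap_push[OF f(1)]])
    ultimately show "y \<in> kernel base.G integer_group q" unfolding kernel_def by simp
  next
    fix y assume "y \<in> kernel base.G integer_group q"
    then have y: "y \<in> carrier base.G" "q y = 0" unfolding kernel_def by simp_all
    obtain f where f: "base.pmap f" "y = base.cls f" using y(1) by (rule base.carrierE)
    have "angle (\<lambda>s. holonomy (f (C s))) = 0" using qW[OF f(1)] y(2) f(2) by simp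
    then obtain \<theta> where \<theta>: "continuous_map A euclideanreal \<theta>" "\<forall>a\<in>topspace A. holonomy (f a) = cis (\<theta> a)" "\<theta> a0 = 0"
      using zero[OF holonomy_comp[OF conjunct1[OF f(1)]]] f(1) holonomy_const by auto
    show "y \<in> push ` carrier top.G" unfolding f(2) by (rule in_image_push[OF f(1) \<theta>(1) bspec[OF \<theta>(2)] \<theta>(3)])
  qed
  show ?thesis
    unfolding split_short_exact_def
    using top.group_htpy_loop_group base.group_htpy_loop_group push_mon epi ker s qs by auto
qed

end

section \<open>The bundle over complex projective space\<close>

lemma cproj_eq_iff: "cproj x = cproj y \<longleftrightarrow> (\<exists>u. cmod u = 1 \<and> y = circle_act u x)"
proof
  assume "cproj x = cproj y"
  moreover have "y \<in> cproj y" unfolding cproj_def using circle_act_1[of y, symmetric] by (intro CollectI exI[of _ 1]) simp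
  ultimately show "\<exists>u. cmod u = 1 \<and> y = circle_act u x" unfolding cproj_def by blast
next
  assume "\<exists>u. cmod u = 1 \<and> y = circle_act u x"
  then obtain u where u: "cmod u = 1" "y = circle_act u x" by blast
  show "cproj x = cproj y"
  proof (intro equalityI subsetI)
    fix z assume "z \<in> cproj x"
    then obtain v where v: "cmod v = 1" "z = circle_act v x" unfolding cproj_def by blast
    have vu: "v * cnj u * u = v" using circle_cnj(2)[OF u(1)] by (simp only: mult.assoc mult_1_right)
    have "z = circle_act (v * cnj u) y" unfolding v(2) u(2) circle_act_mult vu ..
    moreover have "cmod (v * cnj u) = 1" using u(1) v(1) by (simp add: norm_mult)
    ultimately show "z \<in> cproj y" unfolding cproj_def by blast
  next
    fix z assume "z \<in> cproj y"
    then obtain v where v: "cmod v = 1" "z = circle_act v y" unfolding cproj_def by blast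
    then have "z = circle_act (v * u) x" unfolding u(2) circle_act_mult by simp
    moreover have "cmod (v * u) = 1" using u(1) v(1) by (simp add: norm_mult)
    ultimately show "z \<in> cproj x" unfolding cproj_def by blast
  qed
qed

lemma circle_bundle_CP: "n \<ge> 1 \<Longrightarrow> circle_bundle n (CP n) cproj"
  by unfold_locales (simp_all only: quotient_map_cproj cproj_eq_iff)

section \<open>The bundle over the two-sphere\<close>

lemma compact_space_nsphere: "compact_space (nsphere m)"
proof -
  let ?P = "product_topology (\<lambda>i. euclideanreal) UNIV"
  let ?S = "{x :: nat \<Rightarrow> real. (\<Sum>i\<le>m. (x i)\<^sup>2) = 1 \<and> (\<forall>i>m. x i = 0)}"
  have c: "continuous_map ?P euclideanreal (\<lambda>x. x i)" for i
    by (rule continuous_map_product_projection) simp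
  have "closedin ?P {x \<in> topspace ?P. (\<Sum>i\<le>m. (x i)\<^sup>2) \<in> {1}}"
    by (rule closedin_continuous_map_preimage[where Y = euclideanreal])
       (intro continuous_map_sum continuous_map_real_pow c, auto)
  moreover have "closedin ?P {x \<in> topspace ?P. x i \<in> {0}}" for i
    by (rule closedin_continuous_map_preimage[OF c]) auto
  then have "closedin ?P (\<Inter>i\<in>{m<..}. {x \<in> topspace ?P. x i \<in> {0}})"
    by (intro closedin_INT) auto
  ultimately have "closedin ?P ({x \<in> topspace ?P. (\<Sum>i\<le>m. (x i)\<^sup>2) \<in> {1}} \<inter> (\<Inter>i\<in>{m<..}. {x \<in> topspace ?P. x i \<in> {0}}))"
    by (rule closedin_Int)
  also have "\<dots> = ?S" by auto
  finally have closed: "closedin ?P ?S" .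
  have "compactin ?P (PiE UNIV (\<lambda>i. {-1..1}))" by (simp add: compactin_PiE)
  moreover have "?S \<subseteq> PiE UNIV (\<lambda>i. {-1..1})"
  proof
    fix x assume x: "x \<in> ?S"
    have "\<bar>x i\<bar> \<le> 1" for i
    proof (cases "i \<le> m")
      case True
      have "(x i)\<^sup>2 \<le> (\<Sum>i\<le>m. (x i)\<^sup>2)" by (rule member_le_sum) (use True in auto)
      then show ?thesis using x by (simp add: abs_square_le_1)
    next
      case False then show ?thesis using x by simp
    qed
    then show "x \<in> PiE UNIV (\<lambda>i. {-1..1})" by (simp add: PiE_UNIV_domain abs_le_iff Pi_iff)
  qed
  ultimately have "compactin ?P ?S" using closed closed_compactin by blast
  then show ?thesis unfolding nsphere by (simp add: compact_space_subtopology)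
qed

lemma Hausdorff_space_nsphere: "Hausdorff_space (nsphere m)"
  unfolding nsphere_def by (rule Hausdorff_space_subtopology[OF Hausdorff_Euclidean_space])

text \<open>The Hopf map \<open>(z, w) \<mapsto> (\<bar>z\<bar>\<^sup>2 - \<bar>w\<bar>\<^sup>2, 2 z w\<^sup>*)\<close>, in real coordinates that take the base point of \<open>S\<^sup>3\<close> to that of \<open>S\<^sup>2\<close>.\<close>

definition hopf :: "(nat \<Rightarrow> real) \<Rightarrow> nat \<Rightarrow> real" where
  "hopf x = (\<lambda>i. if i = 0 then (cmod (complex_coord x 0))\<^sup>2 - (cmod (complex_coord x 1))\<^sup>2
     else if i = 1 then Re (2 * complex_coord x 0 * cnj (complex_coord x 1))
     else if i = 2 then Im (2 * complex_coord x 0 * cnj (complex_coord x 1)) else 0)"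

lemma nsphere3_iff:
  "x \<in> topspace (nsphere 3) \<longleftrightarrow> (cmod (complex_coord x 0))\<^sup>2 + (cmod (complex_coord x 1))\<^sup>2 = 1 \<and> (\<forall>i>3. x i = 0)"
proof -
  have "(\<Sum>i\<le>3. (x i)\<^sup>2) = (cmod (complex_coord x 0))\<^sup>2 + (cmod (complex_coord x 1))\<^sup>2"
    using sum_squares_complex_coord[of x 1] by (simp add: numeral_3_eq_3)
  then show ?thesis unfolding topspace_nsphere_iff by simp
qed

lemma nsphere2_iff: "y \<in> topspace (nsphere 2) \<longleftrightarrow> (y 0)\<^sup>2 + (y 1)\<^sup>2 + (y 2)\<^sup>2 = 1 \<and> (\<forall>i>2. y i = 0)"
proof -
  have "{..2::nat} = {0, 1, 2}" by auto
  then show ?thesis unfolding topspace_nsphere_iff by (simp add: add.assoc)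
qed

lemma hopf_in:
  assumes x: "x \<in> topspace (nsphere 3)"
  shows "hopf x \<in> topspace (nsphere 2)"
proof -
  let ?z = "complex_coord x 0" and ?w = "complex_coord x 1"
  have "(Re (2 * ?z * cnj ?w))\<^sup>2 + (Im (2 * ?z * cnj ?w))\<^sup>2 = (cmod (2 * ?z * cnj ?w))\<^sup>2"
    by (rule cmod_power2[symmetric])
  also have "\<dots> = 4 * (cmod ?z)\<^sup>2 * (cmod ?w)\<^sup>2" by (simp add: norm_mult power_mult_distrib)
  finally have "(hopf x 0)\<^sup>2 + (hopf x 1)\<^sup>2 + (hopf x 2)\<^sup>2 =
      ((cmod ?z)\<^sup>2 - (cmod ?w)\<^sup>2)\<^sup>2 + 4 * (cmod ?z)\<^sup>2 * (cmod ?w)\<^sup>2"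
    unfolding hopf_def by simp
  also have "\<dots> = ((cmod ?z)\<^sup>2 + (cmod ?w)\<^sup>2)\<^sup>2" by (simp add: power2_eq_square algebra_simps)
  also have "\<dots> = 1" using x unfolding nsphere3_iff by simp
  finally show ?thesis unfolding nsphere2_iff by (simp add: hopf_def)
qed

lemma continuous_map_hopf: "continuous_map (nsphere 3) (nsphere 2) hopf"
proof (rule continuous_map_nsphereI)
  have c: "continuous_map (nsphere 3) euclidean (\<lambda>x. complex_coord x k)" for k
    by (rule continuous_map_complex_coord[OF continuous_map_id[unfolded id_def]])
  have 1: "continuous_map (nsphere 3) euclideanreal (\<lambda>x. (cmod (complex_coord x 0))\<^sup>2 - (cmod (complex_coord x 1))\<^sup>2)"
    by (rule continuous_map_comp2[where h = "\<lambda>z w. (cmod z)\<^sup>2 - (cmod w)\<^sup>2", OF c c]) (intro continuous_intros)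
  have 2: "continuous_map (nsphere 3) euclideanreal (\<lambda>x. Re (2 * complex_coord x 0 * cnj (complex_coord x 1)))"
    by (rule continuous_map_comp2[where h = "\<lambda>z w. Re (2 * z * cnj w)", OF c c]) (intro continuous_intros)
  have 3: "continuous_map (nsphere 3) euclideanreal (\<lambda>x. Im (2 * complex_coord x 0 * cnj (complex_coord x 1)))"
    by (rule continuous_map_comp2[where h = "\<lambda>z w. Im (2 * z * cnj w)", OF c c]) (intro continuous_intros)
  fix i :: nat assume "i \<le> 2"
  then consider "i = 0" | "i = 1" | "i = 2" by linarith
  then show "continuous_map (nsphere 3) euclideanreal (\<lambda>x. hopf x i)"
  proof cases
    case a: 1 show ?thesis unfolding hopf_def a using 1 by simp
  next
    case a: 2 show ?thesis unfolding hopf_def a using 2 by simp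
  next
    case a: 3 show ?thesis unfolding hopf_def a using 3 by simp
  qed
qed (rule hopf_in)

lemma hopf_surj: "hopf ` topspace (nsphere 3) = topspace (nsphere 2)"
proof (intro equalityI subsetI)
  fix y assume "y \<in> topspace (nsphere 2)"
  then have y: "(y 0)\<^sup>2 + (y 1)\<^sup>2 + (y 2)\<^sup>2 = 1" "\<forall>i>2. y i = 0" unfolding nsphere2_iff by blast+
  have "\<exists>z w. (cmod z)\<^sup>2 + (cmod w)\<^sup>2 = 1 \<and> (cmod z)\<^sup>2 - (cmod w)\<^sup>2 = y 0 \<and> 2 * z * cnj w = Complex (y 1) (y 2)"
  proof (cases "y 0 = -1")
    case True
    then have "(y 1)\<^sup>2 + (y 2)\<^sup>2 = 0" using y(1) by simp
    then have "y 1 = 0" "y 2 = 0" by (simp_all add: sum_power2_eq_zero_iff)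
    then show ?thesis using True by (intro exI[of _ 0] exI[of _ 1]) (simp add: complex_eq_iff)
  next
    case False
    have "(y 0)\<^sup>2 \<le> 1" using y(1) zero_le_power2[of "y 1"] zero_le_power2[of "y 2"] by linarith
    then have "\<bar>y 0\<bar> \<le> 1" by (simp add: abs_square_le_1)
    then have pos: "1 + y 0 > 0" using False by linarith
    define r where "r = sqrt ((1 + y 0) / 2)"
    define w where "w = cnj (Complex (y 1) (y 2)) / complex_of_real (2 * r)"
    have r: "r > 0" "r\<^sup>2 = (1 + y 0) / 2" using pos by (simp_all add: r_def)
    have "(cmod w)\<^sup>2 = ((y 1)\<^sup>2 + (y 2)\<^sup>2) / (4 * r\<^sup>2)"
      unfolding w_def norm_divide power_divide complex_mod_cnj cmod_power2 using r(1) by (simp add: power_mult_distrib cmod_power2)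
    also have "(y 1)\<^sup>2 + (y 2)\<^sup>2 = (1 + y 0) * (1 - y 0)" using y(1) by (simp add: power2_eq_square algebra_simps)
    also have "(1 + y 0) * (1 - y 0) / (4 * r\<^sup>2) = (1 - y 0) / 2" 
    proof -
      have "a * b / (4 * (a / 2)) = b / 2" if "a \<noteq> 0" for a b :: real using that by simp
      from this[of "1 + y 0" "1 - y 0"] pos show ?thesis unfolding r(2) by linarith
    qed
    finally have w: "(cmod w)\<^sup>2 = (1 - y 0) / 2" .
    have z: "(cmod (complex_of_real r))\<^sup>2 = (1 + y 0) / 2" using r by simp
    have "2 * complex_of_real r * cnj w = Complex (y 1) (y 2)" unfolding w_def using r(1) by simp
    then show ?thesis using w z by (intro exI[of _ "complex_of_real r"] exI[of _ w]) (simp add: field_simps)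
  qed
  then obtain z w where zw: "(cmod z)\<^sup>2 + (cmod w)\<^sup>2 = 1" "(cmod z)\<^sup>2 - (cmod w)\<^sup>2 = y 0" "2 * z * cnj w = Complex (y 1) (y 2)"
    by blast
  define x where "x i = (if i = 0 then Re z else if i = 1 then Im z else if i = 2 then Re w else if i = 3 then Im w else 0)" for i :: nat
  have c: "complex_coord x 0 = z" "complex_coord x 1 = w" by (simp_all add: complex_coord_def x_def)
  have x: "x \<in> topspace (nsphere 3)" unfolding nsphere3_iff c using zw(1) by (simp add: x_def)
  have "hopf x = y"
  proof
    fix i :: nat
    consider "i = 0" | "i = 1" | "i = 2" | "i > 2" by linarith
    then show "hopf x i = y i"
      by cases (simp_all only: hopf_def c zw(2,3), simp_all add: y(2))
  qed
  then show "y \<in> hopf ` topspace (nsphere 3)" using x by blast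
qed (use hopf_in in blast)

lemma hopf_fibres:
  assumes x: "x \<in> topspace (nsphere 3)" and y: "y \<in> topspace (nsphere 3)"
  shows "hopf x = hopf y \<longleftrightarrow> (\<exists>u. cmod u = 1 \<and> y = circle_act u x)"
proof
  assume eq: "hopf x = hopf y"
  let ?z = "complex_coord x 0" and ?w = "complex_coord x 1" and ?z' = "complex_coord y 0" and ?w' = "complex_coord y 1"
  have nx: "(cmod ?z)\<^sup>2 + (cmod ?w)\<^sup>2 = 1" and ny: "(cmod ?z')\<^sup>2 + (cmod ?w')\<^sup>2 = 1"
    using x y unfolding nsphere3_iff by blast+
  have "(cmod ?z)\<^sup>2 - (cmod ?w)\<^sup>2 = (cmod ?z')\<^sup>2 - (cmod ?w')\<^sup>2" using fun_cong[OF eq, of 0] by (simp add: hopf_def)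
  then have m: "(cmod ?z)\<^sup>2 = (cmod ?z')\<^sup>2" "(cmod ?w)\<^sup>2 = (cmod ?w')\<^sup>2" using nx ny by linarith+
  have "2 * ?z * cnj ?w = 2 * ?z' * cnj ?w'"
    using fun_cong[OF eq, of 1] fun_cong[OF eq, of 2] unfolding hopf_def by (intro complex_eqI) simp_all
  then have zw: "?z * cnj ?w = ?z' * cnj ?w'" by simp
  then have zw': "cnj ?z * ?w = cnj ?z' * ?w'" by (metis complex_cnj_cnj complex_cnj_mult)
  have sq: "a * cnj a = complex_of_real ((cmod a)\<^sup>2)" for a by (rule complex_norm_square[symmetric])
  \<comment> \<open>The Hermitian product of \<open>y\<close> and \<open>x\<close>.\<close>
  define u where "u = ?z' * cnj ?z + ?w' * cnj ?w"
  have "u * ?z = ?z' * (?z * cnj ?z) + ?w' * (?z * cnj ?w)" by (simp add: u_def algebra_simps)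
  also have "\<dots> = ?z' * (?z * cnj ?z + ?w' * cnj ?w')" unfolding zw by (simp add: algebra_simps)
  also have "?z * cnj ?z + ?w' * cnj ?w' = complex_of_real ((cmod ?z)\<^sup>2 + (cmod ?w)\<^sup>2)"
    unfolding sq m of_real_add ..
  finally have "u * ?z = ?z' * complex_of_real 1" unfolding nx .
  then have uz: "?z' = u * ?z" by simp
  have "u * ?w = ?z' * (cnj ?z * ?w) + ?w' * (?w * cnj ?w)" by (simp add: u_def algebra_simps)
  also have "\<dots> = ?w' * (?z' * cnj ?z' + ?w * cnj ?w)" unfolding zw' by (simp add: algebra_simps)
  also have "?z' * cnj ?z' + ?w * cnj ?w = complex_of_real ((cmod ?z)\<^sup>2 + (cmod ?w)\<^sup>2)"
    unfolding sq m of_real_add ..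
  finally have "u * ?w = ?w' * complex_of_real 1" unfolding nx .
  then have uw: "?w' = u * ?w" by simp
  have yu: "y = circle_act u x"
  proof (rule complex_coord_eqI)
    fix k :: nat
    consider "k = 0" | "k = 1" | "k > 1" by linarith
    then show "complex_coord y k = complex_coord (circle_act u x) k"
    proof cases
      case 1 then show ?thesis using uz by (simp add: complex_coord_circle_act)
    next
      case 2 then show ?thesis using uw by (simp add: complex_coord_circle_act)
    next
      case 3
      then have "2 * k > 3" "2 * k + 1 > 3" by simp_all
      then have "complex_coord x k = 0" "complex_coord y k = 0"
        using x y unfolding nsphere3_iff complex_coord_def by (simp_all add: complex_eq_iff)
      then show ?thesis by (simp add: complex_coord_circle_act)
    qed
  qed
  have "(cmod u)\<^sup>2 * ((cmod ?z)\<^sup>2 + (cmod ?w)\<^sup>2) = 1"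
    using ny unfolding uz uw by (simp add: norm_mult power_mult_distrib distrib_left)
  then have "(cmod u)\<^sup>2 = 1" unfolding nx by simp
  then have "cmod u = 1" by (simp add: power2_eq_1_iff) (metis norm_ge_zero not_one_le_zero neg_0_le_iff_le order_trans)
  then show "\<exists>u. cmod u = 1 \<and> y = circle_act u x" using yu by blast
next
  assume "\<exists>u. cmod u = 1 \<and> y = circle_act u x"
  then obtain u where u: "cmod u = 1" "y = circle_act u x" by blast
  have "complex_coord y 0 * cnj (complex_coord y 1) = (u * cnj u) * (complex_coord x 0 * cnj (complex_coord x 1))"
    unfolding u(2) complex_coord_circle_act by (simp add: mult_ac)
  then have e: "2 * complex_coord y 0 * cnj (complex_coord y 1) = 2 * complex_coord x 0 * cnj (complex_coord x 1)"
    unfolding circle_cnj(1)[OF u(1)] by (simp only: mult.assoc mult_1_left)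
  show "hopf x = hopf y"
    unfolding hopf_def e unfolding u(2) complex_coord_circle_act norm_mult u(1) mult_1_left ..
qed

lemma circle_bundle_hopf: "circle_bundle 1 (nsphere 2) hopf"
proof unfold_locales
  show "quotient_map (nsphere (2 * 1 + 1)) (nsphere 2) hopf"
    using T1_Spaces.continuous_imp_quotient_map[OF continuous_map_hopf compact_space_nsphere Hausdorff_space_nsphere hopf_surj]
    by (simp add: numeral_3_eq_3)
  show "hopf x = hopf y \<longleftrightarrow> (\<exists>u. cmod u = 1 \<and> y = circle_act u x)"
    if "x \<in> topspace (nsphere (2 * 1 + 1))" "y \<in> topspace (nsphere (2 * 1 + 1))" for x y
    using hopf_fibres[of x y] that by (simp add: numeral_3_eq_3)
qed simp

lemma hopf_sphere_pt: "hopf sphere_pt = sphere_pt"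
  by (rule ext) (simp add: hopf_def complex_coord_sphere_pt, simp add: sphere_pt_def)

text \<open>For \<open>C\<close> take the closed path of loops swept out by the fibre of the Hopf bundle, on which the holonomy \<open>\<delta>\<close> of
  this bundle winds once. Every closed path in \<open>\<Omega>S\<^sup>2\<close> is an iterate of \<open>C\<close> up to paths from \<open>\<Omega>S\<^sup>3\<close>, so the angle
  along \<open>C\<close> decides whether a circle-valued map has a logarithm.\<close>

lemma sphere_loops_2_winding:
  "\<exists>C \<delta>. continuous_map unit_top (sphere_loops 2) C \<and> C 0 = base_loop \<and> C 1 = base_loop \<and>
     continuous_map (sphere_loops 2) circle_top \<delta> \<and> \<delta> base_loop = 1 \<and> angle (\<lambda>s. \<delta> (C s)) = 2 * pi \<and>
     (\<forall>g. continuous_map (sphere_loops 2) circle_top g \<longrightarrow> g base_loop = 1 \<longrightarrow> angle (\<lambda>s. g (C s)) = 0 \<longrightarrow>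
       (\<exists>\<theta>. continuous_map (sphere_loops 2) euclideanreal \<theta> \<and> (\<forall>l\<in>topspace (sphere_loops 2). g l = cis (\<theta> l)) \<and> \<theta> base_loop = 0))"
proof -
  interpret H: circle_bundle 1 "nsphere 2" hopf by (rule circle_bundle_hopf)
  let ?C = "\<lambda>s. H.orbit_loop (cis (2 * pi * s))"
  have C: "continuous_map unit_top (sphere_loops 2) ?C"
    using H.continuous_orbit_loop(1)[OF continuous_map_turn] unfolding hopf_sphere_pt .
  have C01: "?C 0 = base_loop" "?C 1 = base_loop"
    using H.orbit_loop_1 unfolding hopf_sphere_pt by simp_all
  have \<delta>: "continuous_map (sphere_loops 2) circle_top H.holonomy" "H.holonomy base_loop = 1"
    using H.continuous_holonomy H.holonomy_const unfolding hopf_sphere_pt .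
  have "angle (\<lambda>s. H.holonomy (?C s)) = angle (\<lambda>s. cis (2 * pi * s))"
    by (rule H.angle_holonomy_orbit_loop[OF continuous_map_turn]) simp_all
  also have "\<dots> = 2 * pi" using angle_turns[of 1] by simp
  finally have w: "angle (\<lambda>s. H.holonomy (?C s)) = 2 * pi" .
  have lift: "\<exists>\<theta>. continuous_map (sphere_loops 2) euclideanreal \<theta> \<and> (\<forall>l\<in>topspace (sphere_loops 2). g l = cis (\<theta> l)) \<and> \<theta> base_loop = 0"
    if g: "continuous_map (sphere_loops 2) circle_top g" "g base_loop = 1" "angle (\<lambda>s. g (?C s)) = 0" for g
    by (rule lift_sphere_loops[OF order_refl g(1,2)])
       (rule H.angle_zero_on_closed_paths[unfolded hopf_sphere_pt, OF g])
  show ?thesis using C C01 \<delta> w lift by blast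
qed

section \<open>Torsion exponents\<close>

text \<open>An injective homomorphism preserves orders, so it identifies the \<open>p\<close>-torsion of \<open>G\<close> with that of its
  image, which here is all the \<open>p\<close>-torsion of \<open>H\<close>.\<close>

lemma exp_p_mon:
  assumes G: "group G" and H: "group H" and f: "f \<in> mon G H" and sub: "p_torsion p H \<subseteq> f ` carrier G"
  shows "exp_p p H = exp_p p G"
proof -
  interpret G: group G by (rule G)
  interpret H: group H by (rule H)
  have fh: "f \<in> hom G H" and inj: "inj_on f (carrier G)" using f unfolding mon_def by blast+
  interpret f: group_hom G H f by unfold_locales (rule fh)
  have pow: "f x [^]\<^bsub>H\<^esub> k = \<one>\<^bsub>H\<^esub> \<longleftrightarrow> x [^]\<^bsub>G\<^esub> k = \<one>\<^bsub>G\<^esub>" if x: "x \<in> carrier G" for x and k :: nat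
    using f.hom_nat_pow[OF x, of k] f.inj_on_one_iff inj G.nat_pow_closed[OF x, of k] f.hom_one by metis
  have ord: "H.ord (f x) = G.ord x" if x: "x \<in> carrier G" for x
  proof (rule dvd_antisym)
    have fx: "f x \<in> carrier H" using x by (rule f.hom_closed)
    show "H.ord (f x) dvd G.ord x" using pow[OF x, of "G.ord x"] G.pow_ord_eq_1[OF x] H.pow_eq_id[OF fx] by blast
    show "G.ord x dvd H.ord (f x)" using pow[OF x, of "H.ord (f x)"] H.pow_ord_eq_1[OF fx] G.pow_eq_id[OF x] by blast
  qed
  have img: "p_torsion p H = f ` p_torsion p G"
  proof (intro equalityI subsetI)
    fix y assume y: "y \<in> p_torsion p H"
    then obtain x where x: "x \<in> carrier G" "y = f x" using sub by blast
    then show "y \<in> f ` p_torsion p G" using y ord[OF x(1)] unfolding p_torsion_def by auto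
  next
    fix y assume "y \<in> f ` p_torsion p G"
    then obtain x where x: "x \<in> carrier G" "y = f x" "\<exists>k. G.ord x = p ^ k" unfolding p_torsion_def by blast
    then show "y \<in> p_torsion p H" using ord[OF x(1)] f.hom_closed[OF x(1)] unfolding p_torsion_def by simp
  qed
  have eq: "(\<forall>\<alpha>\<in>p_torsion p H. \<alpha> [^]\<^bsub>H\<^esub> (p ^ t) = \<one>\<^bsub>H\<^esub>) \<longleftrightarrow> (\<forall>\<alpha>\<in>p_torsion p G. \<alpha> [^]\<^bsub>G\<^esub> (p ^ t) = \<one>\<^bsub>G\<^esub>)" for t
    unfolding img using pow by (simp add: p_torsion_def)
  show ?thesis unfolding exp_p_def eq ..
qed

text \<open>An element of finite order maps to zero in the integers, hence comes from the kernel.\<close>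

lemma exp_p_split_short_exact:
  assumes ses: "split_short_exact G H integer_group f q" and p: "prime p"
  shows "exp_p p H = exp_p p G"
proof (rule exp_p_mon)
  have q: "q \<in> hom H integer_group" and ker: "f ` carrier G = kernel H integer_group q" and H: "group H"
    using ses unfolding split_short_exact_def epi_def by blast+
  interpret H: group H by (rule H)
  interpret q: group_hom H integer_group q
    by (rule group_hom.intro[OF H group_integer_group]) (unfold_locales, rule q)
  show "p_torsion p H \<subseteq> f ` carrier G"
  proof
    fix y assume "y \<in> p_torsion p H"
    then obtain k where y: "y \<in> carrier H" "H.ord y = p ^ k" unfolding p_torsion_def by blast
    have "y [^]\<^bsub>H\<^esub> (p ^ k) = \<one>\<^bsub>H\<^esub>" using H.pow_ord_eq_1[OF y(1)] y(2) by simp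
    then have "q y [^]\<^bsub>integer_group\<^esub> (p ^ k) = \<one>\<^bsub>integer_group\<^esub>"
      using q.hom_nat_pow[OF y(1), of "p ^ k"] q.hom_one by metis
    then have "int (p ^ k) * q y = 0" by simp
    moreover have "p ^ k \<noteq> 0" using p prime_gt_0_nat[OF p] by simp
    ultimately have "q y = 0" by auto
    then show "y \<in> f ` carrier G" unfolding ker kernel_def using y(1) by simp
  qed
qed (use ses in \<open>simp_all add: split_short_exact_def\<close>)

section \<open>Loops on complex projective space\<close>

theorem theorem3p6:
  fixes n :: nat
  assumes "n \<ge> 1"
  shows
    "(\<exists>q. split_short_exact
            (sphere_loop_group 1 (nsphere (2 * n + 1)) sphere_pt)
            (sphere_loop_group 1 (CP n) (cproj sphere_pt))
            integer_group (cproj_push 1 n) q) \<and>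
     (\<forall>r\<ge>2.
        group (sphere_loop_group r (CP n) (cproj sphere_pt)) \<and>
        group (sphere_loop_group r (nsphere (2 * n + 1)) sphere_pt) \<and>
        (\<exists>\<phi> \<in> iso (sphere_loop_group r (CP n) (cproj sphere_pt))
                     (sphere_loop_group r (nsphere (2 * n + 1)) sphere_pt).
           \<forall>c \<in> carrier (sphere_loop_group r (nsphere (2 * n + 1)) sphere_pt).
             \<phi> (cproj_push r n c) = c)) \<and>
     (\<forall>r\<ge>1. \<forall>p. prime p \<longrightarrow>
        exp_p p (sphere_loop_group r (CP n) (cproj sphere_pt)) =
        exp_p p (sphere_loop_group r (nsphere (2 * n + 1)) sphere_pt))"
proof -
  let ?S = "\<lambda>r. sphere_loop_group r (nsphere (2 * n + 1)) sphere_pt"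
  let ?P = "\<lambda>r. sphere_loop_group r (CP n) (cproj sphere_pt)"
  have src: "circle_bundle_source n (CP n) cproj (sphere_loops (r + 1)) base_loop" for r
    unfolding circle_bundle_source_def circle_bundle_source_axioms_def
    using circle_bundle_CP[OF assms] base_loop_in by blast
  have groups: "group (?S r)" "group (?P r)" and mon: "cproj_push r n \<in> mon (?S r) (?P r)" for r
  proof -
    interpret circle_bundle_source n "CP n" cproj "sphere_loops (r + 1)" base_loop by (rule src)
    show "group (?S r)" unfolding sphere_loop_group_def by (rule top.group_htpy_loop_group)
    show "group (?P r)" unfolding sphere_loop_group_def by (rule base.group_htpy_loop_group)
    show "cproj_push r n \<in> mon (?S r) (?P r)" unfolding sphere_loop_group_def cproj_push_def by (rule push_mon)
  qed
  have split: "\<exists>q. split_short_exact (?S 1) (?P 1) integer_group (cproj_push 1 n) q"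
  proof -
    interpret circle_bundle_source n "CP n" cproj "sphere_loops (1 + 1)" base_loop by (rule src)
    have two: "(1::nat) + 1 = 2" by simp
    obtain C \<delta> where C: "continuous_map unit_top (sphere_loops (1 + 1)) C" "C 0 = base_loop" "C 1 = base_loop"
      and \<delta>: "continuous_map (sphere_loops (1 + 1)) circle_top \<delta>" "\<delta> base_loop = 1" "angle (\<lambda>s. \<delta> (C s)) = 2 * pi"
      and lift: "\<And>g. continuous_map (sphere_loops (1 + 1)) circle_top g \<Longrightarrow> g base_loop = 1 \<Longrightarrow> angle (\<lambda>s. g (C s)) = 0 \<Longrightarrow>
        (\<exists>\<theta>. continuous_map (sphere_loops (1 + 1)) euclideanreal \<theta> \<and> (\<forall>l\<in>topspace (sphere_loops (1 + 1)). g l = cis (\<theta> l)) \<and> \<theta> base_loop = 0)"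
      using sphere_loops_2_winding[folded two] by blast
    show ?thesis
      unfolding sphere_loop_group_def cproj_push_def
      by (rule push_split_exact[OF C lift \<delta>])
  qed
  have iso: "cproj_push r n \<in> iso (?S r) (?P r)" if r: "r \<ge> 2" for r
  proof -
    interpret circle_bundle_source n "CP n" cproj "sphere_loops (r + 1)" base_loop by (rule src)
    have "r + 1 \<ge> 3" using r by simp
    from lift_sphere_loops_3[OF this] show ?thesis
      unfolding sphere_loop_group_def cproj_push_def by (rule push_iso)
  qed
  have inverse: "\<exists>\<phi> \<in> iso (?P r) (?S r). \<forall>c \<in> carrier (?S r). \<phi> (cproj_push r n c) = c" if r: "r \<ge> 2" for r
  proof (rule bexI)
    show "inv_into (carrier (?S r)) (cproj_push r n) \<in> iso (?P r) (?S r)"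
      by (rule group.iso_set_sym[OF groups(1) iso[OF r]])
    show "\<forall>c \<in> carrier (?S r). inv_into (carrier (?S r)) (cproj_push r n) (cproj_push r n c) = c"
      using mon[of r] unfolding mon_def by (auto intro: inv_into_f_f)
  qed
  have "exp_p p (?P r) = exp_p p (?S r)" if "r \<ge> 1" "prime p" for r p
  proof (cases "r = 1")
    case True
    then show ?thesis using split exp_p_split_short_exact[OF _ that(2)] by metis
  next
    case False
    then have "r \<ge> 2" using that(1) by simp
    from iso[OF this] have "cproj_push r n ` carrier (?S r) = carrier (?P r)" by (simp add: iso_def bij_betw_def)
    then show ?thesis
      by (intro exp_p_mon[OF groups mon]) (auto simp: p_torsion_def)
  qed
  then show ?thesis using split groups inverse by blast
qed

end
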